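(* Let $s_1=\sigma_1+it_1$, $s_2=\sigma_2+it_2\in\mathbb{C}$ with $s_2\neq 1$, $T\ge 2$, and \[ I^{[1]}(T)=\int_2^T|\zeta_2(s_1,s_2)|^2\,dt_1, \] where $\sigma_1,\sigma_2,t_2$ are fixed and only $t_1$ varies. Assume that as $t_1$ moves from $2$ to $T$ the point $(s_1,s_2)$ does not meet the singularities of $\zeta_2$. Let \[ \zeta_2^{[1]}(2\sigma_1,s_2)=\sum_{m=1}^\infty\frac{1}{m^{2\sigma_1}}\Bigl|\zeta(s_2)-\sum_{n=1}^m\frac{1}{n^{s_2}}\Bigr|^2, \] a series which converges for $\sigma_1+\sigma_2>3/2$. Then: (i) if $\sigma_1+\sigma_2>2$, $I^{[1]}(T)=\zeta_2^{[1]}(2\sigma_1,s_2)T+O(1)$, where the implied constant depends on $s_2$; (ii) if $3/2<\sigma_1+\sigma_2<2$, $I^{[1]}(T)=\zeta_2^{[1]}(2\sigma_1,s_2)T+O(T^{4-2\sigma_1-2\sigma_2})$; (iii) if $\sigma_1+\sigma_2=2$, $I^{[1]}(T)=\zeta_2^{[1]}(2\sigma_1,s_2)T+O((\log T)^2)$; (iv) if $\sigma_1+\sigma_2=3/2$, $I^{[1]}(T)=|s_2-1|^{-2}T\log T+O(T)$.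
   Context: The Euler double zeta-function is $\zeta_2(s_1,s_2)=\sum_{m=1}^\infty m^{-s_1}\sum_{n=1}^\infty (m+n)^{-s_2}$, absolutely convergent for $\Re s_2>1$, $\Re(s_1+s_2)>2$; it continues meromorphically to $\mathbb{C}^2$ and is holomorphic on $\{(s_1,s_2): s_2\neq 1,\ s_1+s_2\notin\{2,1,0,-2,-4,-6,\dots\}\}$. "Singularities" refers to the complement of this set. $\zeta$ is the Riemann zeta-function. Implied constants are independent of $T$. *)

theory Defs
  imports "HOL-Complex_Analysis.Complex_Analysis"
begin

text \<open>The Riemann zeta-function: the analytic continuation of the Dirichlet series to the plane
  without the point 1, which is unique because that domain is connected.  The value at 1 is
  unspecified.\<close>

definition zeta :: "complex \<Rightarrow> complex" where
  "zeta = (SOME f. f holomorphic_on - {1} \<and>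
     (\<forall>s. Re s > 1 \<longrightarrow> f s = (\<Sum>n. of_nat (Suc n) powr (- s))))"

text \<open>Holomorphy in two variables, to be used on open sets only: continuous, and holomorphic in
  each variable separately.\<close>

definition holomorphic2_on :: "(complex \<times> complex \<Rightarrow> complex) \<Rightarrow> (complex \<times> complex) set \<Rightarrow> bool" where
  "holomorphic2_on f U \<longleftrightarrow> continuous_on U f \<and>
     (\<forall>w. (\<lambda>z. f (z, w)) holomorphic_on {z. (z, w) \<in> U}) \<and>
     (\<forall>z. (\<lambda>w. f (z, w)) holomorphic_on {w. (z, w) \<in> U})"

definition double_zeta_series :: "complex \<Rightarrow> complex \<Rightarrow> complex" where
  "double_zeta_series s1 s2 =
     (\<Sum>m. of_nat (Suc m) powr (- s1) * (\<Sum>n. of_nat (Suc m + Suc n) powr (- s2)))"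

text \<open>The second set below is the union of the lines \<open>s1 + s2 = c\<close> for
  \<open>c = 1\<close> and \<open>c = 2, 0, -2, -4, ...\<close>.\<close>

definition double_zeta_singularities :: "(complex \<times> complex) set" where
  "double_zeta_singularities =
     {(s1, s2). s2 = 1} \<union>
     {(s1, s2). s1 + s2 = 1 \<or> (\<exists>k::nat. s1 + s2 = 2 - 2 * of_nat k)}"

text \<open>The Euler double zeta-function: the analytic continuation of the double series.  The
  complement of the singularities is open and connected and contains the region of absolute
  convergence, so the values there are unique; values at the singularities are unspecified.\<close>

definition double_zeta :: "complex \<times> complex \<Rightarrow> complex" where
  "double_zeta = (SOME f. holomorphic2_on f (- double_zeta_singularities) \<and>
     (\<forall>s1 s2. Re s2 > 1 \<and> Re (s1 + s2) > 2 \<longrightarrow> f (s1, s2) = double_zeta_series s1 s2))"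

definition zeta_sq_term :: "real \<Rightarrow> complex \<Rightarrow> nat \<Rightarrow> real" where
  "zeta_sq_term a s2 m =
     1 / real m powr a * (cmod (zeta s2 - (\<Sum>n=1..m. 1 / of_nat n powr s2)))\<^sup>2"

text \<open>The series \<open>\<zeta>\<^sub>2\<^sup>[\<^sup>1\<^sup>](a, s2)\<close>, needed for real \<open>a\<close> only.\<close>

definition zeta_sq_series :: "real \<Rightarrow> complex \<Rightarrow> real" where
  "zeta_sq_series a s2 = (\<Sum>m. zeta_sq_term a s2 (Suc m))"

definition mean_square :: "real \<Rightarrow> complex \<Rightarrow> real \<Rightarrow> real" where
  "mean_square \<sigma>1 s2 T = integral {2..T} (\<lambda>t1. (cmod (double_zeta (Complex \<sigma>1 t1, s2)))\<^sup>2)"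

end

theory Submission imports Defs begin

text \<open>Write \<open>\<zeta>\<^sub>2(s1, s2) = \<Sum>m. m\<^sup>-\<^sup>s\<^sup>1 R(m)\<close> with \<open>R(m) = \<zeta>(s2) - \<Sum>n\<le>m. n\<^sup>-\<^sup>s\<^sup>2\<close>.  Euler--Maclaurin expands \<open>R(m)\<close> in
  powers of \<open>m\<close>, which continues \<open>\<zeta>\<close> and \<open>\<zeta>\<^sub>2\<close> strip by strip, and gives
  \<open>R(m) = m\<^sup>1\<^sup>-\<^sup>s\<^sup>2 / (s2 - 1) + O(m\<^sup>-\<^sup>\<sigma>\<^sup>2)\<close>.  Put \<open>r = \<sigma>1 + \<sigma>2\<close>.  The Hardy--Littlewood approximation of \<open>\<zeta>(s1 + s2 - 1)\<close> then
  replaces \<open>\<zeta>\<^sub>2\<close> by the partial sum over \<open>m \<le> X\<close> up to \<open>O(X\<^sup>2\<^sup>-\<^sup>r / t1 + X\<^sup>1\<^sup>-\<^sup>r)\<close> for \<open>t1 \<le> X / 2\<close>.  The mean square of the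
  partial sum is its diagonal, up to an error controlled by Hilbert's inequality.  For \<open>r < 2\<close> this is
  applied on dyadic intervals \<open>[T, 2T]\<close> with \<open>X\<close> about \<open>4T\<close>; for \<open>r = 2\<close>, where summation over dyadic blocks
  would lose a logarithm, on the whole interval with \<open>X\<close> about \<open>2T\<close>; for \<open>r > 2\<close> one lets \<open>X\<close> tend to infinity.\<close>

section \<open>Euler--Maclaurin summation of powers\<close>

text \<open>Only \<open>r\<close> is restricted, so \<open>Re s2\<close> may be very negative; hence
  Euler--Maclaurin of every order, although the asymptotics use only the leading term. As
  \<open>zeta\<close> and \<open>double_zeta\<close> are chosen by \<open>SOME\<close>, a
  continuation must be constructed and proved unique before anything can be estimated. The
  thresholds come from the coefficients \<open>m^(-s1) R(m)\<close>, of size \<open>m^(1-r)\<close>.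
  Their squares are summable for \<open>r > 3/2\<close> and essentially harmonic at
  \<open>r = 3/2\<close>, with the factor \<open>1 / |s2 - 1|^2\<close> of the leading term of
  \<open>R(m)\<close>; they are themselves summable for \<open>r > 2\<close>. The truncation error
  \<open>X^(2-r) / t\<close> decides how the interval is treated. With one \<open>X\<close> of size
  \<open>T\<close> for the whole interval, the cross term is at most the supremum of the partial sum
  times \<open>X^(2-r)\<close> times the integral of \<open>1 / t\<close>. For \<open>r < 2\<close>
  this is \<open>T^(4-2r) log T\<close>, a logarithm too many; a block \<open>[T, 2T]\<close> avoids
  it, and the blocks add up geometrically because \<open>4 - 2r > 0\<close>. At \<open>r = 2\<close>
  the supremum and the integral are each \<open>O(log T)\<close>, which together is exactly the
  permitted error.\<close>

text \<open>\<open>em_coeff k = B\<^bsub>2k\<^esub> / (2k)!\<close> with the Bernoulli numbers; the recursion comes from comparing the Taylor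
  expansions of the trapezoidal rule and of the integral about the midpoint of \<open>[m, m + 1]\<close>, where the
  even and odd powers separate by themselves.\<close>

fun em_coeff :: "nat \<Rightarrow> real" where
  "em_coeff k = 1 / (4 ^ k * fact (2 * k)) - (\<Sum>j<k. em_coeff j / (4 ^ (k - j) * fact (Suc (2 * (k - j)))))"

declare em_coeff.simps [simp del]

lemma em_coeff_0 [simp]: "em_coeff 0 = 1"
  by (subst em_coeff.simps) simp

text \<open>In generating functions: \<open>cosh (x/2)\<close> is the product of the series with
  coefficients \<open>em_coeff\<close> in powers of \<open>x^2\<close> and
  \<open>sinh (x/2) / (x/2)\<close>. The former series is thus
  \<open>(x/2) coth (x/2)\<close>.\<close>

lemma em_coeff_convolution:
  "(\<Sum>j\<le>k. em_coeff j / (4 ^ (k - j) * fact (Suc (2 * (k - j))))) = 1 / (4 ^ k * fact (2 * k))"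
proof -
  have "em_coeff k = 1 / (4 ^ k * fact (2 * k)) - (\<Sum>j<k. em_coeff j / (4 ^ (k - j) * fact (Suc (2 * (k - j)))))"
    by (rule em_coeff.simps)
  then show ?thesis by (simp add: lessThan_Suc_atMost [symmetric] del: fact_Suc)
qed

text \<open>The \<open>i\<close>-th derivative of \<open>x\<^sup>1\<^sup>-\<^sup>s / (1 - s)\<close>, so that index 1 is \<open>x\<^sup>-\<^sup>s\<close> itself.\<close>

definition em_deriv :: "nat \<Rightarrow> complex \<Rightarrow> complex \<Rightarrow> complex" where
  "em_deriv i s x = (- 1) ^ i * pochhammer (s - 1) i / (1 - s) * x powr (1 - s - of_nat i)"

lemma em_deriv_1: "s \<noteq> 1 \<Longrightarrow> em_deriv (Suc 0) s x = x powr (- s)"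
  by (simp add: em_deriv_def divide_simps algebra_simps)

lemma has_field_derivative_em_deriv:
  assumes "Re x > 0"
  shows "(em_deriv i s has_field_derivative em_deriv (Suc i) s x) (at x within A)"
proof -
  have [simp]: "x \<notin> \<real>\<^sub>\<le>\<^sub>0" using assms by (auto simp: complex_nonpos_Reals_iff)
  show ?thesis unfolding em_deriv_def
    by (rule derivative_eq_intros refl | simp)+ (simp add: pochhammer_Suc diff_divide_distrib add_divide_distrib algebra_simps)
qed

text \<open>The window \<open>[x, 2x]\<close> contains \<open>[m, m + 1]\<close> for
  \<open>x = m >= 1\<close>. Since \<open>y / x >= 1\<close>, the exponent may be replaced by its
  crude upper bound \<open>\<bar>Re s\<bar> + i + 1\<close>, whatever its sign.\<close>

lemma em_deriv_bound:
  assumes "x > 0" "x \<le> y" "y \<le> 2 * x"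
  shows "cmod (em_deriv i s (of_real y)) \<le>
    cmod (pochhammer (s - 1) i / (1 - s)) * 2 powr (\<bar>Re s\<bar> + i + 1) * x powr (1 - Re s - i)"
proof -
  have "y powr (1 - Re s - i) = (y / x) powr (1 - Re s - i) * x powr (1 - Re s - i)"
    using assms by (subst powr_mult [symmetric]) auto
  moreover have "(y / x) powr (1 - Re s - i) \<le> (y / x) powr (\<bar>Re s\<bar> + i + 1)"
    using assms by (intro powr_mono) auto
  moreover have "(y / x) powr (\<bar>Re s\<bar> + i + 1) \<le> 2 powr (\<bar>Re s\<bar> + i + 1)"
    using assms by (intro powr_mono2) (auto simp: field_simps)
  ultimately have *: "y powr (1 - Re s - i) \<le> 2 powr (\<bar>Re s\<bar> + i + 1) * x powr (1 - Re s - i)"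
    by (simp add: mult_right_mono)
  have "cmod (em_deriv i s (of_real y)) = cmod (pochhammer (s - 1) i / (1 - s)) * y powr (1 - Re s - i)"
    using assms by (simp add: em_deriv_def norm_mult norm_divide norm_power norm_powr_real_powr)
  also have "\<dots> \<le> cmod (pochhammer (s - 1) i / (1 - s)) * (2 powr (\<bar>Re s\<bar> + i + 1) * x powr (1 - Re s - i))"
    using * by (intro mult_left_mono) auto
  finally show ?thesis by (simp add: mult.assoc)
qed

text \<open>The degree \<open>n - i\<close> depends on \<open>i\<close> so that all remainders
  involve the derivative of the same index \<open>Suc n\<close> and share one bound.\<close>

lemma em_deriv_Taylor:
  assumes m: "m \<ge> 1" and i: "i \<le> n" and h: "h = 1/2 \<or> h = - (1/2)"
    and u: "u = of_nat m + 1/2"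
  shows "cmod (em_deriv i s (u + h) - (\<Sum>k\<le>n - i. em_deriv (i + k) s u * h ^ k / fact k)) \<le>
    cmod (pochhammer (s - 1) (Suc n) / (1 - s)) * 2 powr (\<bar>Re s\<bar> + Suc n + 1) * real m powr (1 - Re s - Suc n)"
    (is "_ \<le> ?B")
proof -
  let ?S = "closed_segment (of_real (real m)) (of_real (real m + 1)) :: complex set"
  have S: "\<exists>y. x = of_real y \<and> real m \<le> y \<and> y \<le> real m + 1" if "x \<in> ?S" for x
    using that unfolding closed_segment_of_real by (auto simp: closed_segment_eq_real_ivl)
  have inS: "of_real y \<in> ?S" if "real m \<le> y" "y \<le> real m + 1" for y
    unfolding closed_segment_of_real using that by (auto simp: closed_segment_eq_real_ivl)
  have u': "u = of_real (real m + 1/2)" by (simp add: u)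
  have uh: "u + h \<in> ?S"
  proof -
    have "u + h = of_real (real m + 1) \<or> u + h = of_real (real m)"
      using h by (elim disjE) (simp_all only: u, simp_all)
    then show ?thesis using inS[of "real m"] inS[of "real m + 1"] by auto
  qed
  have "cmod (em_deriv (i + 0) s (u + h) - (\<Sum>k\<le>n - i. em_deriv (i + k) s u * (u + h - u) ^ k / fact k))
     \<le> ?B * cmod (u + h - u) ^ Suc (n - i) / fact (n - i)"
  proof (rule complex_Taylor[where S = ?S and f = "\<lambda>k. em_deriv (i + k) s"])
    show "convex ?S" by simp
    fix k x assume "x \<in> ?S"
    then obtain y where y: "x = of_real y" "real m \<le> y" "y \<le> real m + 1" using S by blast
    show "(em_deriv (i + k) s has_field_derivative em_deriv (i + Suc k) s x) (at x within ?S)"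
      using has_field_derivative_em_deriv[of x "i + k" s] y m by simp
  next
    fix x assume "x \<in> ?S"
    then obtain y where y: "x = of_real y" "real m \<le> y" "y \<le> real m + 1" using S by blast
    show "cmod (em_deriv (i + Suc (n - i)) s x) \<le> ?B"
      using em_deriv_bound[of "real m" y "Suc n" s] y m i by simp
  next
    show "u \<in> ?S" unfolding u' using inS[of "real m + 1/2"] by simp
  qed (rule uh)
  also have "\<dots> \<le> ?B"
  proof -
    have "cmod h = cmod (1/2)" using h by (elim disjE) (simp_all only: norm_minus_cancel)
    then have "cmod (u + h - u) = 1/2" by (simp add: norm_divide)
    then have "cmod (u + h - u) ^ Suc (n - i) \<le> 1" by (simp only: power_le_one)
    moreover have "(1::real) \<le> fact (n - i)" by (simp add: fact_ge_1)
    ultimately have "cmod (u + h - u) ^ Suc (n - i) \<le> fact (n - i)" by linarith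
    then have "cmod (u + h - u) ^ Suc (n - i) / fact (n - i) \<le> 1" by simp
    moreover have "?B \<ge> 0" by simp
    ultimately have "?B * (cmod (u + h - u) ^ Suc (n - i) / fact (n - i)) \<le> ?B * 1" by (intro mult_left_mono)
    then show ?thesis by simp
  qed
  finally show ?thesis by simp
qed

text \<open>For \<open>Re s > 1\<close> the term \<open>j = 0\<close> is the integral of
  \<open>x^(-s)\<close> over \<open>x >= m\<close>; the whole approximates the sum over
  \<open>n >= m\<close> with half weight at \<open>m\<close>.\<close>

definition em_main :: "nat \<Rightarrow> complex \<Rightarrow> nat \<Rightarrow> complex" where
  "em_main N s m = - (\<Sum>j\<le>N. of_real (em_coeff j) * em_deriv (2 * j) s (of_nat m))"

definition em_delta :: "nat \<Rightarrow> complex \<Rightarrow> nat \<Rightarrow> complex" where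
  "em_delta N s m = (of_nat m powr (- s) + of_nat (Suc m) powr (- s)) / 2
     - (em_main N s m - em_main N s (Suc m))"

text \<open>The weight \<open>1\<close> belongs to the trapezoidal average, \<open>2\<close> to the
  two endpoints of each correction term; \<open>2 * N + 3\<close> is the index of the derivative in
  the common Taylor remainder.\<close>

definition em_const :: "nat \<Rightarrow> complex \<Rightarrow> real" where
  "em_const N s = (1 + 2 * (\<Sum>j\<le>N. \<bar>em_coeff j\<bar>)) *
     (cmod (pochhammer (s - 1) (2 * N + 3) / (1 - s)) * 2 powr (\<bar>Re s\<bar> + 2 * N + 4))"

lemma em_const_nonneg: "em_const N s \<ge> 0"
  unfolding em_const_def by (intro mult_nonneg_nonneg add_nonneg_nonneg sum_nonneg) auto

lemma sum_even_only:
  fixes g :: "nat \<Rightarrow> complex"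
  assumes "\<And>k. odd k \<Longrightarrow> g k = 0"
  shows "(\<Sum>k\<le>Suc (2 * n). g k) = (\<Sum>l\<le>n. g (2 * l))"
  unfolding sum.in_pairs_0 by (simp add: assms)

lemma sum_odd_only:
  fixes g :: "nat \<Rightarrow> complex"
  assumes "\<And>k. even k \<Longrightarrow> g k = 0"
  shows "(\<Sum>k\<le>Suc (2 * n). g k) = (\<Sum>l\<le>n. g (Suc (2 * l)))"
  unfolding sum.in_pairs_0 by (simp add: assms)

text \<open>A formal identity for arbitrary \<open>D\<close>: averaging over \<open>h\<close> and
  \<open>- h\<close> keeps the even powers, taking differences keeps the odd ones, and comparing the
  coefficients of \<open>D (Suc (2 * k))\<close> leaves exactly
  \<open>em_coeff_convolution\<close>.\<close>

lemma em_cancellation: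
  fixes D :: "nat \<Rightarrow> complex"
  defines "h \<equiv> (1/2 :: complex)"
  shows "(\<Sum>k\<le>2 * N + 1. D (Suc k) * (- h) ^ k / fact k) / 2 + (\<Sum>k\<le>2 * N + 1. D (Suc k) * h ^ k / fact k) / 2
   = (\<Sum>j\<le>N. of_real (em_coeff j) * ((\<Sum>k\<le>2 * N + 2 - 2 * j. D (2 * j + k) * h ^ k / fact k)
       - (\<Sum>k\<le>2 * N + 2 - 2 * j. D (2 * j + k) * (- h) ^ k / fact k)))"
proof -
  have "(\<Sum>k\<le>2 * N + 1. D (Suc k) * (- h) ^ k / fact k) / 2 + (\<Sum>k\<le>2 * N + 1. D (Suc k) * h ^ k / fact k) / 2
     = (\<Sum>k\<le>Suc (2 * N). D (Suc k) * ((- h) ^ k + h ^ k) / 2 / fact k)"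
    unfolding sum_divide_distrib sum.distrib[symmetric] Suc_eq_plus1[symmetric]
    by (intro sum.cong refl) (simp add: ring_distribs add_divide_distrib mult.commute)
  also have "\<dots> = (\<Sum>l\<le>N. D (Suc (2 * l)) * ((- h) ^ (2 * l) + h ^ (2 * l)) / 2 / fact (2 * l))"
    by (rule sum_even_only) (auto simp: power_minus_odd)
  also have "\<dots> = (\<Sum>l\<le>N. D (Suc (2 * l)) * of_real (1 / (4 ^ l * fact (2 * l))))"
    by (intro sum.cong) (auto simp: h_def power_divide power_mult)
  also have "\<dots> = (\<Sum>k\<le>N. D (Suc (2 * k)) * (\<Sum>j\<le>k. of_real (em_coeff j / (4 ^ (k - j) * fact (Suc (2 * (k - j)))))))"
    by (simp add: em_coeff_convolution[symmetric] del: fact_Suc)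
  also have "\<dots> = (\<Sum>k\<le>N. (\<Sum>j\<le>k. D (Suc (2 * (j + (k - j)))) * of_real (em_coeff j / (4 ^ (k - j) * fact (Suc (2 * (k - j)))))))"
    by (simp add: sum_distrib_left del: fact_Suc)
  also have "\<dots> = (\<Sum>(j,l)\<in>{(j,l). j + l \<le> N}. D (Suc (2 * (j + l))) * of_real (em_coeff j / (4 ^ l * fact (Suc (2 * l)))))"
    by (rule sum.triangle_reindex_eq[symmetric])
  also have "{(j,l). j + l \<le> N} = Sigma {..N} (\<lambda>j. {..N - j})" by auto
  also have "(\<Sum>(j,l)\<in>Sigma {..N} (\<lambda>j. {..N - j}). D (Suc (2 * (j + l))) * of_real (em_coeff j / (4 ^ l * fact (Suc (2 * l)))))
     = (\<Sum>j\<le>N. \<Sum>l\<le>N-j. D (Suc (2 * (j + l))) * of_real (em_coeff j / (4 ^ l * fact (Suc (2 * l)))))"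
    by (rule sum.Sigma[symmetric]) auto
  also have "\<dots> = (\<Sum>j\<le>N. of_real (em_coeff j) * ((\<Sum>k\<le>2 * N + 2 - 2 * j. D (2 * j + k) * h ^ k / fact k)
       - (\<Sum>k\<le>2 * N + 2 - 2 * j. D (2 * j + k) * (- h) ^ k / fact k)))"
  proof (rule sum.cong[OF refl])
    fix j assume "j \<in> {..N}"
    then have e: "2 * N + 2 - 2 * j = Suc (Suc (2 * (N - j)))" by auto
    have "(\<Sum>k\<le>2 * N + 2 - 2 * j. D (2 * j + k) * h ^ k / fact k)
       - (\<Sum>k\<le>2 * N + 2 - 2 * j. D (2 * j + k) * (- h) ^ k / fact k)
       = (\<Sum>k\<le>Suc (Suc (2 * (N - j))). D (2 * j + k) * (h ^ k - (- h) ^ k) / fact k)"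
      unfolding e by (simp add: sum_subtractf[symmetric] diff_divide_distrib ring_distribs del: sum.atMost_Suc)
    also have "\<dots> = (\<Sum>k\<le>Suc (2 * (N - j)). D (2 * j + k) * (h ^ k - (- h) ^ k) / fact k)"
      by (subst sum.atMost_Suc) simp
    also have "\<dots> = (\<Sum>l\<le>N-j. D (2 * j + Suc (2 * l)) * (h ^ Suc (2 * l) - (- h) ^ Suc (2 * l)) / fact (Suc (2 * l)))"
      by (rule sum_odd_only) auto
    also have "\<dots> = (\<Sum>l\<le>N-j. D (Suc (2 * (j + l))) * of_real (1 / (4 ^ l * fact (Suc (2 * l)))))"
      by (intro sum.cong) (auto simp: h_def power_divide power_mult simp del: fact_Suc)
    finally show "(\<Sum>l\<le>N-j. D (Suc (2 * (j + l))) * of_real (em_coeff j / (4 ^ l * fact (Suc (2 * l))))) =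
       of_real (em_coeff j) * ((\<Sum>k\<le>2 * N + 2 - 2 * j. D (2 * j + k) * h ^ k / fact k)
       - (\<Sum>k\<le>2 * N + 2 - 2 * j. D (2 * j + k) * (- h) ^ k / fact k))"
      by (simp add: sum_distrib_left mult_ac del: fact_Suc)
  qed
  finally show ?thesis .
qed

text \<open>By \<open>em_cancellation\<close> the Taylor polynomials about the midpoint drop out
  entirely, so \<open>em_delta\<close> is a combination of Taylor remainders.\<close>

lemma em_delta_bound:
  assumes m: "m \<ge> 1" and s: "s \<noteq> 1"
  shows "cmod (em_delta N s m) \<le> em_const N s * real m powr (- Re s - 2 * N - 2)"
proof -
  define u :: complex where "u = of_nat m + 1/2"
  define h :: complex where "h = 1/2"
  define B where "B = cmod (pochhammer (s - 1) (2 * N + 3) / (1 - s)) * 2 powr (\<bar>Re s\<bar> + 2 * N + 4) * real m powr (- Re s - 2 * N - 2)"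
  define e where "e i h = em_deriv i s (u + h) - (\<Sum>k\<le>2 * N + 2 - i. em_deriv (i + k) s u * h ^ k / fact k)" for i h
  have e_bound: "cmod (e i h') \<le> B" if "i \<le> 2 * N + 2" "h' = h \<or> h' = - h" for i h'
  proof -
    have "cmod (e i h') \<le> cmod (pochhammer (s - 1) (Suc (2 * N + 2)) / (1 - s)) *
       2 powr (\<bar>Re s\<bar> + Suc (2 * N + 2) + 1) * real m powr (1 - Re s - Suc (2 * N + 2))"
      unfolding e_def using that
      by (intro em_deriv_Taylor[where m = m] m) (auto simp: u_def h_def)
    also have "\<dots> = B" by (simp add: B_def eval_nat_numeral algebra_simps)
    finally show ?thesis .
  qed
  have um: "u - h = of_nat m" "u + h = of_nat (Suc m)" by (simp_all add: u_def h_def)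
  have "em_delta N s m = (em_deriv 1 s (u + - h) + em_deriv 1 s (u + h)) / 2
       - (\<Sum>j\<le>N. of_real (em_coeff j) * (em_deriv (2 * j) s (u + h) - em_deriv (2 * j) s (u + - h)))"
    using s um by (simp add: em_delta_def em_main_def em_deriv_1 sum_subtractf ring_distribs)
  also have "\<dots> = (e 1 (- h) + e 1 h) / 2 - (\<Sum>j\<le>N. of_real (em_coeff j) * (e (2 * j) h - e (2 * j) (- h)))"
  proof -
    define P where "P h = (\<Sum>k\<le>2 * N + 1. em_deriv (Suc k) s u * h ^ k / fact k)" for h
    define Q where "Q j h = (\<Sum>k\<le>2 * N + 2 - 2 * j. em_deriv (2 * j + k) s u * h ^ k / fact k)" for j h
    let ?c = "\<lambda>j. complex_of_real (em_coeff j)"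
    have "P (- h) / 2 + P h / 2 = (\<Sum>j\<le>N. ?c j * (Q j h - Q j (- h)))"
      unfolding h_def P_def Q_def by (rule em_cancellation)
    then have 1: "P (- h) + P h = 2 * (\<Sum>j\<le>N. ?c j * (Q j h - Q j (- h)))"
      by (simp add: field_simps)
    have 2: "e 1 h' = em_deriv 1 s (u + h') - P h'" for h'
      by (simp add: e_def P_def del: sum.atMost_Suc)
    have e2: "e (2 * j) h' = em_deriv (2 * j) s (u + h') - Q j h'" for j h'
      by (simp add: e_def Q_def)
    have 3: "(\<Sum>j\<le>N. ?c j * (e (2 * j) h - e (2 * j) (- h))) =
        (\<Sum>j\<le>N. ?c j * (em_deriv (2 * j) s (u + h) - em_deriv (2 * j) s (u + - h)))
        - (\<Sum>j\<le>N. ?c j * (Q j h - Q j (- h)))"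
      unfolding sum_subtractf[symmetric] e2 by (intro sum.cong refl) (simp add: algebra_simps)
    have "e 1 (- h) + e 1 h = (em_deriv 1 s (u + - h) + em_deriv 1 s (u + h))
        - 2 * (\<Sum>j\<le>N. ?c j * (Q j h - Q j (- h)))"
      unfolding 2 1[symmetric] by simp
    then show ?thesis unfolding 3 by (simp add: diff_divide_distrib)
  qed
  also have "cmod \<dots> \<le> B + (\<Sum>j\<le>N. \<bar>em_coeff j\<bar> * (2 * B))"
  proof (rule order_trans[OF norm_triangle_ineq4] add_mono)+
    have "cmod (e 1 (- h) + e 1 h) \<le> B + B"
      by (intro norm_triangle_le add_mono e_bound) auto
    then show "cmod ((e 1 (- h) + e 1 h) / 2) \<le> B" by (simp add: norm_divide)
    have "cmod (e (2 * j) h - e (2 * j) (- h)) \<le> 2 * B" if "j \<le> N" for j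
      using norm_triangle_ineq4[of "e (2 * j) h" "e (2 * j) (- h)"]
        e_bound[of "2*j" h] e_bound[of "2*j" "- h"] that by auto
    then show "cmod (\<Sum>j\<le>N. of_real (em_coeff j) * (e (2 * j) h - e (2 * j) (- h))) \<le> (\<Sum>j\<le>N. \<bar>em_coeff j\<bar> * (2 * B))"
      by (intro sum_norm_le) (auto simp: norm_mult intro!: mult_left_mono)
  qed
  also have "\<dots> = em_const N s * real m powr (- Re s - 2 * N - 2)"
    by (simp add: em_const_def B_def sum_distrib_right sum_distrib_left algebra_simps)
  finally show ?thesis .
qed

section \<open>Continuation of the zeta-function\<close>

lemma continuous_on_series_local:
  fixes f :: "nat \<Rightarrow> 'a::metric_space \<Rightarrow> complex"
  assumes S: "open S" and f: "\<And>n. continuous_on S (f n)"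
    and bound: "\<And>x. x \<in> S \<Longrightarrow> \<exists>V M. open V \<and> x \<in> V \<and> summable M \<and> (\<forall>n. \<forall>y\<in>V \<inter> S. norm (f n y) \<le> M n)"
  shows "continuous_on S (\<lambda>x. \<Sum>n. f n x)"
proof (rule continuous_at_imp_continuous_on, rule ballI)
  fix x assume x: "x \<in> S"
  from bound[OF x] obtain V M where V: "open V" "x \<in> V" "summable M"
    and le: "\<forall>n. \<forall>y\<in>V \<inter> S. norm (f n y) \<le> M n"
    by (elim exE conjE)
  have "uniform_limit (V \<inter> S) (\<lambda>n x. \<Sum>i<n. f i x) (\<lambda>x. \<Sum>i. f i x) sequentially"
    by (rule Weierstrass_m_test[OF _ V(3)]) (use le in blast)
  moreover have "\<forall>\<^sub>F n in sequentially. continuous_on (V \<inter> S) (\<lambda>x. \<Sum>i<n. f i x)"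
    by (intro always_eventually allI continuous_on_sum continuous_on_subset[OF f]) auto
  ultimately have "continuous_on (V \<inter> S) (\<lambda>x. \<Sum>i. f i x)"
    by (intro uniform_limit_theorem[of _ "\<lambda>n x. \<Sum>i<n. f i x" sequentially]) auto
  then show "isCont (\<lambda>x. \<Sum>n. f n x) x"
    using S V x continuous_on_eq_continuous_at[of "V \<inter> S"] by auto
qed

lemma holomorphic_on_series_local:
  fixes f :: "nat \<Rightarrow> complex \<Rightarrow> complex"
  assumes S: "open S" and f: "\<And>n. f n holomorphic_on S"
    and bound: "\<And>x. x \<in> S \<Longrightarrow> \<exists>V M. open V \<and> x \<in> V \<and> summable M \<and> (\<forall>n. \<forall>y\<in>V \<inter> S. norm (f n y) \<le> M n)"
  shows "(\<lambda>x. \<Sum>n. f n x) holomorphic_on S"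
proof (rule holomorphic_uniform_sequence[OF S, of "\<lambda>n x. \<Sum>i<n. f i x"])
  show "(\<lambda>x. \<Sum>i<n. f i x) holomorphic_on S" for n
    by (intro holomorphic_on_sum f)
  fix x assume x: "x \<in> S"
  from bound[OF x] obtain V M where V: "open V" "x \<in> V" "summable M"
    and le: "\<forall>n. \<forall>y\<in>V \<inter> S. norm (f n y) \<le> M n"
    by (elim exE conjE)
  obtain d where d: "d > 0" "cball x d \<subseteq> V \<inter> S"
    using S V x open_contains_cball[of "V \<inter> S"] by (meson IntI open_Int)
  have "uniform_limit (cball x d) (\<lambda>n x. \<Sum>i<n. f i x) (\<lambda>x. \<Sum>i. f i x) sequentially"
    by (rule Weierstrass_m_test[OF _ V(3)]) (use le d in blast)
  then show "\<exists>d>0. cball x d \<subseteq> S \<and> uniform_limit (cball x d) (\<lambda>n x. \<Sum>i<n. f i x) (\<lambda>x. \<Sum>n. f n x) sequentially"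
    using d by (intro exI[of _ d]) auto
qed

lemma norm_of_nat_powr: "n \<ge> 1 \<Longrightarrow> cmod (of_nat n powr s) = real n powr Re s"
  using norm_powr_real_powr[of "of_nat n" s] by simp

lemma tendsto_of_nat_powr_0:
  assumes "Re s < 0"
  shows "(\<lambda>n. of_nat n powr s :: complex) \<longlonglongrightarrow> 0"
proof (rule tendsto_norm_zero_cancel, rule Lim_transform_eventually)
  show "(\<lambda>n. real n powr Re s) \<longlonglongrightarrow> 0"
    using assms by (intro tendsto_neg_powr filterlim_real_sequentially)
  show "\<forall>\<^sub>F n in sequentially. real n powr Re s = norm (of_nat n powr s :: complex)"
    using eventually_ge_at_top[of 1] by eventually_elim (simp add: norm_of_nat_powr)
qed

section \<open>Convergence of the Euler--Maclaurin approximants\<close>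

definition inv_sq_sum :: real where "inv_sq_sum = (\<Sum>k. 1 / real (Suc k) ^ 2)"

lemma summable_inv_sq: "summable (\<lambda>k. 1 / real (Suc k) ^ 2)"
  using inverse_squares_sums by (simp add: sums_iff add.commute)

text \<open>Half weight for the last term makes the increments trapezoidal, hence equal to
  \<open>em_delta\<close>; \<open>em_main\<close> stands in for the missing tail.\<close>

definition em_partial :: "nat \<Rightarrow> complex \<Rightarrow> nat \<Rightarrow> complex" where
  "em_partial N s m = (\<Sum>n=1..m. of_nat n powr (- s)) - of_nat m powr (- s) / 2 + em_main N s m"

lemma em_partial_Suc: "em_partial N s (Suc m) = em_partial N s m + em_delta N s m"
  by (simp add: em_partial_def em_delta_def add_divide_distrib)

lemma em_partial_add: "em_partial N s (m + n) = em_partial N s m + (\<Sum>k<n. em_delta N s (k + m))"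
  by (induction n) (simp_all add: em_partial_Suc add.commute)

text \<open>Of the exponent in \<open>em_delta_bound\<close>, the \<open>- 2\<close> secures
  summability in \<open>k\<close>; the rest is negative by hypothesis and is kept as decay in
  \<open>m\<close>.\<close>

lemma em_delta_bound_tail:
  assumes m: "m \<ge> 1" and s: "s \<noteq> 1" "Re s > - 2 * real N"
  shows "cmod (em_delta N s (k + m)) \<le> em_const N s * real m powr (- Re s - 2 * N) * (1 / real (Suc k) ^ 2)"
proof -
  note c = em_const_nonneg[of N s]
  have "cmod (em_delta N s (k + m)) \<le> em_const N s * real (k + m) powr (- Re s - 2 * N - 2)"
    using em_delta_bound[of "k + m" s N] m s by simp
  also have "real (k + m) powr (- Re s - 2 * N - 2) = real (k + m) powr (- (Re s + 2 * N)) * (1 / real (k + m) ^ 2)"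
    using m by (simp add: powr_diff powr_numeral)
  also have "\<dots> \<le> real m powr (- (Re s + 2 * N)) * (1 / real (Suc k) ^ 2)"
    using m s by (intro mult_mono powr_mono2' frac_le power_mono) auto
  finally show ?thesis using c by (simp add: mult_left_mono mult.assoc)
qed

lemma summable_em_delta:
  assumes "m \<ge> 1" and "s \<noteq> 1" "Re s > - 2 * real N"
  shows "summable (\<lambda>k. em_delta N s (k + m))"
  by (rule summable_comparison_test'[OF summable_mult[OF summable_inv_sq] em_delta_bound_tail[OF assms]])

definition em_limit :: "nat \<Rightarrow> complex \<Rightarrow> complex" where
  "em_limit N s = em_partial N s 1 + (\<Sum>k. em_delta N s (k + 1))"

lemma em_partial_tendsto:
  assumes "s \<noteq> 1" "Re s > - 2 * real N"
  shows "(\<lambda>n. em_partial N s n) \<longlonglongrightarrow> em_limit N s"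
proof -
  have "(\<lambda>n. em_partial N s (1 + n)) \<longlonglongrightarrow> em_limit N s"
    unfolding em_partial_add em_limit_def
    by (intro tendsto_intros summable_LIMSEQ summable_em_delta assms) auto
  then show ?thesis by (simp add: LIMSEQ_imp_Suc)
qed

lemma em_limit_tail:
  assumes m: "m \<ge> 1" and s: "s \<noteq> 1" "Re s > - 2 * real N"
  shows "cmod (em_limit N s - em_partial N s m) \<le> em_const N s * inv_sq_sum * real m powr (- Re s - 2 * N)"
proof -
  have "(\<lambda>n. em_partial N s (m + n)) \<longlonglongrightarrow> em_partial N s m + (\<Sum>k. em_delta N s (k + m))"
    unfolding em_partial_add by (intro tendsto_intros summable_LIMSEQ summable_em_delta m s)
  moreover have "(\<lambda>n. em_partial N s (m + n)) \<longlonglongrightarrow> em_limit N s"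
    using LIMSEQ_ignore_initial_segment[OF em_partial_tendsto[OF s], of m] by (simp add: add.commute)
  ultimately have "em_limit N s - em_partial N s m = (\<Sum>k. em_delta N s (k + m))"
    using LIMSEQ_unique by fastforce
  also have "cmod \<dots> \<le> (\<Sum>k. em_const N s * real m powr (- Re s - 2 * N) * (1 / real (Suc k) ^ 2))"
    by (intro norm_suminf_le em_delta_bound_tail m s summable_mult summable_inv_sq)
  also have "\<dots> = em_const N s * real m powr (- Re s - 2 * N) * inv_sq_sum"
    unfolding inv_sq_sum_def by (intro suminf_mult summable_inv_sq)
  finally show ?thesis by (simp add: mult_ac)
qed

lemma em_main_Suc: "em_main (Suc N) s m = em_main N s m - of_real (em_coeff (Suc N)) * em_deriv (2 * Suc N) s (of_nat m)"
  by (simp add: em_main_def)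

text \<open>In the half-plane belonging to \<open>N\<close>, the extra term of order
  \<open>Suc N\<close> is a power of \<open>n\<close> whose exponent has negative real part, so it
  vanishes in the limit.\<close>

lemma em_limit_Suc:
  assumes "s \<noteq> 1" "Re s > - 2 * real N"
  shows "em_limit (Suc N) s = em_limit N s"
proof (rule LIMSEQ_unique)
  show "(\<lambda>n. em_partial (Suc N) s n) \<longlonglongrightarrow> em_limit (Suc N) s"
    by (rule em_partial_tendsto) (use assms in auto)
  have "(\<lambda>n. em_partial N s n - of_real (em_coeff (Suc N)) * em_deriv (2 * Suc N) s (of_nat n)) \<longlonglongrightarrow>
     em_limit N s - of_real (em_coeff (Suc N)) * ((- 1) ^ (2 * Suc N) * pochhammer (s - 1) (2 * Suc N) / (1 - s) * 0)"
    unfolding em_deriv_def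
    by (intro tendsto_intros em_partial_tendsto tendsto_of_nat_powr_0) (use assms in auto)
  then show "(\<lambda>n. em_partial (Suc N) s n) \<longlonglongrightarrow> em_limit N s"
    by (simp add: em_partial_def em_main_Suc algebra_simps)
qed

lemma em_limit_eq:
  assumes "s \<noteq> 1" "Re s > - 2 * real N" "N \<le> M"
  shows "em_limit M s = em_limit N s"
  using assms(3)
proof (induction M rule: dec_induct)
  case (step n)
  then have "real N \<le> real n" by simp
  then show ?case using em_limit_Suc[of s n] step assms by simp
qed simp

lemma continuous_on_em_const: "continuous_on (- {1}) (em_const N)"
  unfolding em_const_def pochhammer_prod
  by (intro continuous_intros) auto

lemma holomorphic_on_pochhammer [holomorphic_intros]:
  "f holomorphic_on A \<Longrightarrow> (\<lambda>z. pochhammer (f z) n) holomorphic_on A"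
  unfolding pochhammer_prod by (intro holomorphic_intros)

lemma holomorphic_on_em_deriv [holomorphic_intros]:
  "f holomorphic_on A \<Longrightarrow> (\<And>z. z \<in> A \<Longrightarrow> f z \<noteq> 1) \<Longrightarrow> m \<ge> 1 \<Longrightarrow> (\<lambda>z. em_deriv i (f z) (of_nat m)) holomorphic_on A"
  unfolding em_deriv_def by (intro holomorphic_intros) (auto dest: sym)

lemma holomorphic_on_em_main [holomorphic_intros]:
  "f holomorphic_on A \<Longrightarrow> (\<And>z. z \<in> A \<Longrightarrow> f z \<noteq> 1) \<Longrightarrow> m \<ge> 1 \<Longrightarrow> (\<lambda>z. em_main N (f z) m) holomorphic_on A"
  unfolding em_main_def by (intro holomorphic_intros)

lemma holomorphic_on_em_partial [holomorphic_intros]: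
  "f holomorphic_on A \<Longrightarrow> (\<And>z. z \<in> A \<Longrightarrow> f z \<noteq> 1) \<Longrightarrow> m \<ge> 1 \<Longrightarrow> (\<lambda>z. em_partial N (f z) m) holomorphic_on A"
  unfolding em_partial_def by (intro holomorphic_intros) auto

lemma holomorphic_on_em_delta:
  "m \<ge> 1 \<Longrightarrow> (\<lambda>s. em_delta N s m) holomorphic_on - {1}"
  unfolding em_delta_def by (intro holomorphic_intros) auto

lemma holomorphic_em_limit: "em_limit N holomorphic_on {s. s \<noteq> 1 \<and> Re s > - 2 * real N}" (is "_ holomorphic_on ?S")
proof -
  have "open {s. Re s > - 2 * real N}" by (rule open_halfspace_Re_gt)
  then have S: "open ?S" by (simp add: open_Collect_conj open_Collect_neg Collect_conj_eq open_Int open_Compl)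
  have "(\<lambda>s. \<Sum>k. em_delta N s (k + 1)) holomorphic_on ?S"
  proof (rule holomorphic_on_series_local[OF S])
    show "(\<lambda>s. em_delta N s (n + 1)) holomorphic_on ?S" for n
      by (rule holomorphic_on_subset[OF holomorphic_on_em_delta]) auto
    fix x assume x: "x \<in> ?S"
    \<comment> \<open>\<open>em_const\<close> grows with \<open>s\<close>, so no majorant holds on
      all of the half-plane; its continuity supplies one near each point.\<close>
    have "isCont (em_const N) x"
      using continuous_on_em_const[of N] x continuous_on_eq_continuous_at[of "- {1}" "em_const N"]
      by (simp add: open_Compl)
    then obtain d where d: "d > 0" "\<And>y. dist y x < d \<Longrightarrow> dist (em_const N y) (em_const N x) < 1"
      unfolding continuous_at_eps_delta by (meson zero_less_one)
    have "cmod (em_delta N y (n + 1)) \<le> (em_const N x + 1) * (1 / real (Suc n) ^ 2)" if "y \<in> ball x d \<inter> ?S" for n y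
    proof -
      have "cmod (em_delta N y (n + 1)) \<le> em_const N y * (1 / real (Suc n) ^ 2)"
        using em_delta_bound_tail[of 1 y N n] that by auto
      also have "\<dots> \<le> (em_const N x + 1) * (1 / real (Suc n) ^ 2)"
        using d(2)[of y] that by (intro mult_right_mono) (auto simp: dist_commute dist_real_def)
      finally show ?thesis .
    qed
    then show "\<exists>V M. open V \<and> x \<in> V \<and> summable M \<and> (\<forall>n. \<forall>y\<in>V \<inter> ?S. cmod (em_delta N y (n + 1)) \<le> M n)"
      using d(1) by (intro exI[of _ "ball x d"] exI[of _ "\<lambda>n. (em_const N x + 1) * (1 / real (Suc n) ^ 2)"] conjI
         summable_mult summable_inv_sq) auto
  qed
  then show ?thesis
    unfolding em_limit_def by (intro holomorphic_intros) auto
qed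

section \<open>Gluing the half-planes, and identification with \<open>zeta\<close>\<close>

definition em_order :: "complex \<Rightarrow> nat" where "em_order s = Suc (nat \<lceil>\<bar>Re s\<bar>\<rceil>)"

lemma em_order: "Re s > - 2 * real (em_order s)"
  unfolding em_order_def by (simp; linarith)

text \<open>The order may vary with \<open>s\<close> because all admissible orders give the same
  limit; on each half-plane a single order represents the function.\<close>

definition zeta_cont :: "complex \<Rightarrow> complex" where
  "zeta_cont s = em_limit (em_order s) s"

lemma zeta_cont_eq: "s \<noteq> 1 \<Longrightarrow> Re s > - 2 * real N \<Longrightarrow> zeta_cont s = em_limit N s"
  unfolding zeta_cont_def using em_limit_eq[of s N "em_order s"] em_limit_eq[of s "em_order s" N] em_order[of s]
  by (cases "N \<le> em_order s") auto

lemma holomorphic_zeta_cont: "zeta_cont holomorphic_on - {1}"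
proof -
  have "zeta_cont holomorphic_on (\<Union>N\<in>UNIV. {s. s \<noteq> 1 \<and> Re s > - 2 * real N})"
  proof (rule holomorphic_on_UN_open)
    show "zeta_cont holomorphic_on {s. s \<noteq> 1 \<and> Re s > - 2 * real N}" for N
      using holomorphic_em_limit[of N] by (rule holomorphic_transform) (simp add: zeta_cont_eq[of _ N])
    have "open {s. Re s > - 2 * real N}" for N by (rule open_halfspace_Re_gt)
    then show "open {s. s \<noteq> 1 \<and> Re s > - 2 * real N}" for N
      by (simp add: Collect_conj_eq Collect_neg_eq open_Int open_Compl)
  qed
  moreover have "(\<Union>N\<in>UNIV. {s. s \<noteq> 1 \<and> Re s > - 2 * real N}) = - {1}"
    using em_order by auto
  ultimately show ?thesis by simp
qed

lemma em_main_0: "em_main 0 s m = of_nat m powr (1 - s) / (s - 1)"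
  by (simp add: em_main_def em_deriv_def minus_divide_right)

lemma summable_of_nat_powr:
  assumes "Re s > 1"
  shows "summable (\<lambda>n. of_nat (Suc n) powr (- s) :: complex)"
proof (rule summable_norm_cancel)
  have "summable (\<lambda>n. real (Suc n) powr (- Re s))"
    using assms by (subst summable_Suc_iff) (simp add: summable_real_powr_iff)
  then show "summable (\<lambda>n. norm (of_nat (Suc n) powr (- s) :: complex))"
    using norm_of_nat_powr[of "Suc _" "- s"] by simp
qed

lemma zeta_cont_series:
  assumes "Re s > 1"
  shows "zeta_cont s = (\<Sum>n. of_nat (Suc n) powr (- s))"
proof (rule LIMSEQ_unique)
  have s: "s \<noteq> 1" using assms by auto
  show "(\<lambda>n. em_partial 0 s n) \<longlonglongrightarrow> zeta_cont s"
    using em_partial_tendsto[of s 0] zeta_cont_eq[of s 0] s assms by simp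
  have e: "(\<Sum>n=1..m. of_nat n powr (- s)) = (\<Sum>n<m. of_nat (Suc n) powr (- s))" for m
    by (simp add: sum.atLeast1_atMost_eq)
  have "(\<lambda>n. em_partial 0 s n) \<longlonglongrightarrow> (\<Sum>n. of_nat (Suc n) powr (- s)) - 0 / 2 + 0 / (s - 1)"
    unfolding em_partial_def em_main_0 e using s assms
    by (intro tendsto_intros summable_LIMSEQ summable_of_nat_powr tendsto_of_nat_powr_0) auto
  then show "(\<lambda>n. em_partial 0 s n) \<longlonglongrightarrow> (\<Sum>n. of_nat (Suc n) powr (- s))" by simp
qed

text \<open>\<open>zeta_cont\<close> witnesses that the choice defining \<open>zeta\<close> has
  something to choose from.\<close>

lemma zeta_spec: "zeta holomorphic_on - {1}"
  "Re s > 1 \<Longrightarrow> zeta s = (\<Sum>n. of_nat (Suc n) powr (- s))"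
proof -
  have "zeta holomorphic_on - {1} \<and> (\<forall>s. Re s > 1 \<longrightarrow> zeta s = (\<Sum>n. of_nat (Suc n) powr (- s)))"
    unfolding zeta_def
    by (rule someI[of _ zeta_cont]) (simp add: holomorphic_zeta_cont zeta_cont_series)
  then show "zeta holomorphic_on - {1}" "Re s > 1 \<Longrightarrow> zeta s = (\<Sum>n. of_nat (Suc n) powr (- s))"
    by auto
qed

text \<open>\<open>SOME\<close> need not have picked \<open>zeta_cont\<close> itself; the identity
  theorem on the connected punctured plane shows that there is only one candidate off the point
  \<open>1\<close>.\<close>

lemma zeta_eq_zeta_cont:
  assumes "s \<noteq> 1"
  shows "zeta s = zeta_cont s"
proof (rule analytic_continuation_open[of "{s. Re s > 1}" "- {1}" zeta zeta_cont])
  show "open {s. Re s > 1}" by (rule open_halfspace_Re_gt)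
  show "{s. Re s > 1} \<noteq> {}" by (auto intro: exI[of _ 2])
  show "connected (- {1::complex})" by (simp add: connected_punctured_universe)
qed (use assms in \<open>auto simp: zeta_spec zeta_cont_series holomorphic_zeta_cont\<close>)

theorem zeta_Euler_Maclaurin:
  assumes "m \<ge> 1" "s \<noteq> 1" "Re s > - 2 * real N"
  shows "cmod (zeta s - em_partial N s m) \<le> em_const N s * inv_sq_sum * real m powr (- Re s - 2 * N)"
  using em_limit_tail[OF assms] zeta_eq_zeta_cont[of s] zeta_cont_eq[of s N] assms by simp

section \<open>Continuation of the double zeta-function\<close>

lemma holomorphic_on_zeta [holomorphic_intros]:
  assumes "f holomorphic_on A" "\<And>z. z \<in> A \<Longrightarrow> f z \<noteq> 1"
  shows "(\<lambda>z. zeta (f z)) holomorphic_on A"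
proof -
  have "f ` A \<subseteq> - {1}" using assms(2) by (metis ComplI image_subsetI singletonD)
  then show ?thesis using holomorphic_on_compose_gen[OF assms(1) zeta_spec(1)] by (simp add: o_def)
qed

lemma continuous_on_zeta [continuous_intros]:
  assumes "continuous_on A f" "\<And>z. z \<in> A \<Longrightarrow> f z \<noteq> 1"
  shows "continuous_on A (\<lambda>z. zeta (f z))"
proof -
  have "f ` A \<subseteq> - {1}" using assms(2) by (metis ComplI image_subsetI singletonD)
  then show ?thesis
    using continuous_on_compose2[OF holomorphic_on_imp_continuous_on[OF zeta_spec(1)] assms(1)] by simp
qed

lemma zeta_sums:
  assumes "Re s > 1"
  shows "(\<lambda>n. of_nat (Suc n) powr (- s)) sums zeta s"
  using summable_sums[OF summable_of_nat_powr[OF assms]] zeta_spec(2)[OF assms] by simp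

definition zeta_tail :: "complex \<Rightarrow> nat \<Rightarrow> complex" where
  "zeta_tail s m = zeta s - (\<Sum>n=1..m. of_nat n powr (- s))"

definition zeta_rem :: "nat \<Rightarrow> complex \<Rightarrow> nat \<Rightarrow> complex" where
  "zeta_rem N s m = zeta s - em_partial N s m"

lemma zeta_tail_eq: "zeta_tail s m = em_main N s m - of_nat m powr (- s) / 2 + zeta_rem N s m"
  by (simp add: zeta_tail_def zeta_rem_def em_partial_def)

lemma zeta_tail_series:
  assumes "Re s > 1"
  shows "zeta_tail s m = (\<Sum>n. of_nat (m + Suc n) powr (- s))"
proof -
  have "(\<Sum>n=1..m. of_nat n powr (- s)) = (\<Sum>n<m. of_nat (Suc n) powr (- s))"
    by (simp add: sum.atLeast1_atMost_eq)
  then show ?thesis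
    using suminf_split_initial_segment[OF summable_of_nat_powr[OF assms], of m] zeta_spec(2)[OF assms]
    by (simp add: zeta_tail_def add_ac)
qed

section \<open>The polar set and uniqueness of the continuation\<close>

definition dz_poles :: "complex set" where
  "dz_poles = insert 1 (range (\<lambda>k::nat. 2 - 2 * of_nat k))"

lemma closed_dz_poles: "closed dz_poles"
  by (rule closed_subset_Ints) (auto simp: dz_poles_def)

lemma countable_dz_poles: "countable dz_poles"
  by (simp add: dz_poles_def)

lemma dz_poles_le: "w \<in> dz_poles \<Longrightarrow> Re w \<le> 2"
  by (auto simp: dz_poles_def)

lemma mem_singularities_iff:
  "(s1, s2) \<in> double_zeta_singularities \<longleftrightarrow> s2 = 1 \<or> s1 + s2 \<in> dz_poles"
  by (auto simp: double_zeta_singularities_def dz_poles_def)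

text \<open>For \<open>w = 1\<close> the slice is empty. Otherwise it is the complement of a
  translate of a set of integers, closed and countable, hence open and connected.\<close>

lemma open_slice1: "open {z. (z, w) \<in> - double_zeta_singularities}"
  and connected_slice1: "connected {z. (z, w) \<in> - double_zeta_singularities}"
proof -
  have *: "{z. (z, w) \<in> - double_zeta_singularities} = (if w = 1 then {} else - ((\<lambda>p. p - w) ` dz_poles))"
    by (auto simp: mem_singularities_iff image_iff algebra_simps)
  have "closed ((\<lambda>p. p - w) ` dz_poles)"
    using closed_translation_subtract[OF closed_dz_poles] by simp
  then show "open {z. (z, w) \<in> - double_zeta_singularities}" unfolding * by (auto simp: open_Compl)
  have "countable ((\<lambda>p. p - w) ` dz_poles)" using countable_dz_poles by simp
  then show "connected {z. (z, w) \<in> - double_zeta_singularities}"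
    unfolding * by (auto intro!: path_connected_imp_connected path_connected_complement_countable)
qed

lemma open_slice2: "open {w. (z, w) \<in> - double_zeta_singularities}"
  and connected_slice2: "connected {w. (z, w) \<in> - double_zeta_singularities}"
proof -
  have *: "{w. (z, w) \<in> - double_zeta_singularities} = - insert 1 ((\<lambda>p. p - z) ` dz_poles)"
    by (auto simp: mem_singularities_iff image_iff algebra_simps)
  have "closed ((\<lambda>p. p - z) ` dz_poles)"
    using closed_translation_subtract[OF closed_dz_poles] by simp
  then show "open {w. (z, w) \<in> - double_zeta_singularities}" unfolding * by (auto simp: open_Compl)
  have "countable (insert 1 ((\<lambda>p. p - z) ` dz_poles))" using countable_dz_poles by simp
  then show "connected {w. (z, w) \<in> - double_zeta_singularities}"
    unfolding * by (auto intro!: path_connected_imp_connected path_connected_complement_countable)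
qed

text \<open>The identity theorem is used in one variable at a time: \<open>s1\<close> moves first
  with \<open>Re s2 > 1\<close> held fixed, then \<open>s2\<close> moves with \<open>s1\<close>
  fixed. Connectedness is thus needed for the slices only.\<close>

lemma double_zeta_continuation_unique:
  assumes f: "holomorphic2_on f (- double_zeta_singularities)"
    and g: "holomorphic2_on g (- double_zeta_singularities)"
    and eq: "\<And>s1 s2. Re s2 > 1 \<Longrightarrow> Re (s1 + s2) > 2 \<Longrightarrow> f (s1, s2) = g (s1, s2)"
    and p: "(s1, s2) \<notin> double_zeta_singularities"
  shows "f (s1, s2) = g (s1, s2)"
proof -
  have 1: "f (z, w) = g (z, w)" if w: "Re w > 1" and zw: "(z, w) \<notin> double_zeta_singularities" for z w
  proof (rule analytic_continuation_open[of "{z. Re z > 2 - Re w}" "{z. (z, w) \<in> - double_zeta_singularities}"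
        "\<lambda>z. f (z, w)" "\<lambda>z. g (z, w)"])
    show "open {z. Re z > 2 - Re w}" by (rule open_halfspace_Re_gt)
    show "{z. Re z > 2 - Re w} \<noteq> {}" by (auto intro: exI[of _ "of_real (3 - Re w)"])
    show "{z. Re z > 2 - Re w} \<subseteq> {z. (z, w) \<in> - double_zeta_singularities}"
      using w by (auto simp: mem_singularities_iff dest!: dz_poles_le)
    show "(\<lambda>z. f (z, w)) holomorphic_on {z. (z, w) \<in> - double_zeta_singularities}"
      "(\<lambda>z. g (z, w)) holomorphic_on {z. (z, w) \<in> - double_zeta_singularities}"
      using f g by (auto simp: holomorphic2_on_def)
    show "f (z, w) = g (z, w)" if "z \<in> {z. Re z > 2 - Re w}" for z
      using eq[of w z] w that by simp
    show "z \<in> {z. (z, w) \<in> - double_zeta_singularities}" using zw by simp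
  qed (rule open_slice1 connected_slice1)+
  show ?thesis
  proof (rule analytic_continuation_open[of "{w. (s1, w) \<in> - double_zeta_singularities} \<inter> {w. Re w > 1}"
        "{w. (s1, w) \<in> - double_zeta_singularities}" "\<lambda>w. f (s1, w)" "\<lambda>w. g (s1, w)"])
    show "open ({w. (s1, w) \<in> - double_zeta_singularities} \<inter> {w. Re w > 1})"
      by (intro open_Int open_slice2 open_halfspace_Re_gt)
    \<comment> \<open>With this \<open>w\<close> the real part of \<open>s1 + w\<close> is at least
      \<open>3\<close>, to the right of every element of \<open>dz_poles\<close>.\<close>
    have "of_real (3 + \<bar>Re s1\<bar>) \<in> {w. (s1, w) \<in> - double_zeta_singularities} \<inter> {w. Re w > 1}"
      by (auto simp: mem_singularities_iff complex_eq_iff dest!: dz_poles_le)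
    then show "{w. (s1, w) \<in> - double_zeta_singularities} \<inter> {w. Re w > 1} \<noteq> {}" by blast
    show "(\<lambda>w. f (s1, w)) holomorphic_on {w. (s1, w) \<in> - double_zeta_singularities}"
      "(\<lambda>w. g (s1, w)) holomorphic_on {w. (s1, w) \<in> - double_zeta_singularities}"
      using f g by (auto simp: holomorphic2_on_def)
    show "s2 \<in> {w. (s1, w) \<in> - double_zeta_singularities}" using p by simp
    show "f (s1, w) = g (s1, w)" if "w \<in> {w. (s1, w) \<in> - double_zeta_singularities} \<inter> {w. Re w > 1}" for w
      using 1[of w s1] that by simp
  qed (rule open_slice2 connected_slice2 Int_lower1)+
qed

section \<open>Construction of the continuation\<close>

definition dz_domain :: "nat \<Rightarrow> (complex \<times> complex) set" where
  "dz_domain N = - double_zeta_singularities \<inter>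
     {p. Re (snd p) > - 2 * real N \<and> Re (fst p + snd p) > 1 - 2 * real N}"

lemma open_dz_domain: "open (dz_domain N)"
proof -
  have "open ((\<lambda>p::complex\<times>complex. fst p + snd p) -` (- dz_poles))"
    by (intro open_vimage open_Compl closed_dz_poles continuous_intros)
  moreover have "open ((snd :: complex \<times> complex \<Rightarrow> complex) -` (- {1}))"
    by (intro open_vimage open_Compl closed_singleton continuous_intros)
  moreover have "open {p::complex\<times>complex. - 2 * real N < Re (snd p)}" "open {p::complex\<times>complex. 1 - 2 * real N < Re (fst p + snd p)}"
    by (intro open_Collect_less continuous_intros)+
  moreover have "dz_domain N = ((\<lambda>p. fst p + snd p) -` (- dz_poles)) \<inter> (snd -` (- {1})) \<inter>
     {p. - 2 * real N < Re (snd p)} \<inter> {p. 1 - 2 * real N < Re (fst p + snd p)}"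
    by (auto simp: dz_domain_def mem_singularities_iff)
  ultimately show ?thesis by auto
qed

text \<open>On \<open>dz_domain N\<close> the bound on \<open>Re s2\<close> makes the remainder
  estimate of order \<open>N\<close> available, and the bound on \<open>Re (s1 + s2)\<close> makes
  the resulting powers of \<open>m\<close> summable.\<close>

definition dz_term :: "nat \<Rightarrow> nat \<Rightarrow> complex \<times> complex \<Rightarrow> complex" where
  "dz_term N m p = of_nat (Suc m) powr (- fst p) * zeta_rem N (snd p) (Suc m)"

text \<open>Termwise the series \<open>\<Sum>m. m\<^sup>-\<^sup>s\<^sup>1 (\<zeta>(s2) - \<Sum>n\<le>m. n\<^sup>-\<^sup>s\<^sup>2)\<close> with the Euler--Maclaurin main terms of the inner tail
  summed to zeta values; all poles come from these.\<close>

definition dz_approx :: "nat \<Rightarrow> complex \<times> complex \<Rightarrow> complex" where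
  "dz_approx N p = (\<Sum>j\<le>N. of_real (em_coeff j) * pochhammer (snd p - 1) (2 * j) / (snd p - 1)
       * zeta (fst p + snd p - 1 + 2 * of_nat j)) - zeta (fst p + snd p) / 2 + (\<Sum>m. dz_term N m p)"

lemma norm_zeta_rem_le:
  assumes "m \<ge> 1" "s \<noteq> 1" "Re s > - 2 * real N"
  shows "cmod (zeta_rem N s m) \<le> em_const N s * inv_sq_sum * real m powr (- Re s - 2 * N)"
  unfolding zeta_rem_def by (rule zeta_Euler_Maclaurin[OF assms])

lemma inv_sq_sum_nonneg: "inv_sq_sum \<ge> 0"
  unfolding inv_sq_sum_def by (intro suminf_nonneg summable_inv_sq) auto

lemma norm_dz_term_le:
  assumes "p \<in> dz_domain N"
  shows "cmod (dz_term N m p) \<le> em_const N (snd p) * inv_sq_sum * real (Suc m) powr (- (Re (fst p + snd p) + 2 * N))"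
proof -
  have "cmod (dz_term N m p) \<le> real (Suc m) powr (- Re (fst p)) * (em_const N (snd p) * inv_sq_sum * real (Suc m) powr (- Re (snd p) - 2 * N))"
    unfolding dz_term_def norm_mult using assms
    by (intro mult_mono norm_zeta_rem_le) (auto simp: norm_of_nat_powr dz_domain_def double_zeta_singularities_def simp del: of_nat_Suc)
  also have "\<dots> = em_const N (snd p) * inv_sq_sum * (real (Suc m) powr (- Re (fst p)) * real (Suc m) powr (- Re (snd p) - 2 * N))"
    by (simp only: mult_ac)
  also have "real (Suc m) powr (- Re (fst p)) * real (Suc m) powr (- Re (snd p) - 2 * N) = real (Suc m) powr (- (Re (fst p + snd p) + 2 * N))"
    unfolding powr_add[symmetric] by (rule arg_cong2[of _ _ _ _ "(powr)"]) auto
  finally show ?thesis .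
qed

lemma summable_Suc_powr: "a > 1 \<Longrightarrow> summable (\<lambda>m. real (Suc m) powr (- a))"
  by (subst summable_Suc_iff) (simp add: summable_real_powr_iff)

lemma summable_dz_term:
  assumes "p \<in> dz_domain N"
  shows "summable (\<lambda>m. dz_term N m p)"
proof (rule summable_comparison_test'[OF _ norm_dz_term_le[OF assms]])
  show "summable (\<lambda>m. em_const N (snd p) * inv_sq_sum * real (Suc m) powr (- (Re (fst p + snd p) + 2 * N)))"
    by (intro summable_mult summable_Suc_powr) (use assms in \<open>auto simp: dz_domain_def\<close>)
qed

lemma dz_term_locally_bounded:
  assumes p: "p \<in> dz_domain N"
  shows "\<exists>V M. open V \<and> p \<in> V \<and> summable M \<and> (\<forall>m. \<forall>q\<in>V \<inter> dz_domain N. cmod (dz_term N m q) \<le> M m)"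
proof -
  define c where "c = em_const N (snd p) + 1"
  \<comment> \<open>The midpoint between \<open>1\<close> and the exponent at \<open>p\<close>: a
    neighbourhood of \<open>p\<close> keeps its exponents above \<open>a\<close>, while
    \<open>a > 1\<close> still gives a summable majorant.\<close>
  define a where "a = (Re (fst p + snd p) + 2 * real N + 1) / 2"
  have a: "a > 1" "Re (fst p + snd p) + 2 * real N > a" using p by (auto simp: a_def dz_domain_def)
  define V where "V = (dz_domain N \<inter> (\<lambda>q. em_const N (snd q)) -` {..<c}) \<inter> {q. a - 2 * real N < Re (fst q + snd q)}"
  have "continuous_on (dz_domain N) (\<lambda>q. em_const N (snd q))"
    by (rule continuous_on_compose2[OF continuous_on_em_const])
      (auto intro!: continuous_intros simp: dz_domain_def double_zeta_singularities_def)
  then have "open (dz_domain N \<inter> (\<lambda>q. em_const N (snd q)) -` {..<c})"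
    by (intro continuous_open_preimage open_dz_domain) auto
  moreover have "open {q::complex\<times>complex. a - 2 * real N < Re (fst q + snd q)}"
    by (intro open_Collect_less continuous_intros)
  ultimately have "open V" unfolding V_def by (rule open_Int)
  moreover have "p \<in> V" using p a by (auto simp: V_def c_def)
  moreover have "summable (\<lambda>m. c * inv_sq_sum * real (Suc m) powr (- a))"
    by (intro summable_mult summable_Suc_powr a)
  moreover have "cmod (dz_term N m q) \<le> c * inv_sq_sum * real (Suc m) powr (- a)" if q: "q \<in> V \<inter> dz_domain N" for m q
  proof -
    have le: "em_const N (snd q) \<le> c" "a \<le> Re (fst q + snd q) + 2 * N" using q by (simp_all add: V_def)
    have "c \<ge> 0" using em_const_nonneg[of N "snd q"] le(1) by linarith
    then have "em_const N (snd q) * inv_sq_sum * real (Suc m) powr (- (Re (fst q + snd q) + 2 * N)) \<le> c * inv_sq_sum * real (Suc m) powr (- a)"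
      using le inv_sq_sum_nonneg by (intro mult_mono powr_mono mult_nonneg_nonneg) auto
    moreover have "cmod (dz_term N m q) \<le> em_const N (snd q) * inv_sq_sum * real (Suc m) powr (- (Re (fst q + snd q) + 2 * N))"
      by (rule norm_dz_term_le) (use q in blast)
    ultimately show ?thesis by linarith
  qed
  ultimately show ?thesis by (intro exI[of _ V] exI[of _ "\<lambda>m. c * inv_sq_sum * real (Suc m) powr (- a)"]) blast
qed

lemma holomorphic_on_zeta_rem [holomorphic_intros]:
  "f holomorphic_on A \<Longrightarrow> (\<And>z. z \<in> A \<Longrightarrow> f z \<noteq> 1) \<Longrightarrow> m \<ge> 1 \<Longrightarrow> (\<lambda>z. zeta_rem N (f z) m) holomorphic_on A"
  unfolding zeta_rem_def by (intro holomorphic_intros)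

text \<open>The pole of \<open>zeta\<close> at \<open>1\<close>, met at the arguments occurring in
  \<open>dz_approx\<close>, accounts for the lines \<open>s1 + s2 = 1\<close> and
  \<open>s1 + s2 = 2 - 2 j\<close>.\<close>

lemma dz_domain_not_pole:
  assumes "p \<in> dz_domain N"
  shows "fst p + snd p \<noteq> 1" "snd p \<noteq> 1" "snd p - 1 \<noteq> 0" "fst p + snd p - 1 + 2 * of_nat j \<noteq> 1"
proof -
  have "(fst p, snd p) \<notin> double_zeta_singularities" using assms by (simp add: dz_domain_def)
  then have *: "snd p \<noteq> 1" "fst p + snd p \<notin> dz_poles" unfolding mem_singularities_iff by simp_all
  then show "snd p \<noteq> 1" "snd p - 1 \<noteq> 0" by simp_all
  show "fst p + snd p \<noteq> 1" using *(2) by (auto simp: dz_poles_def)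
  have "fst p + snd p = (fst p + snd p - 1 + 2 * of_nat j) + (1 - 2 * of_nat j)" by simp
  moreover have "2 - 2 * of_nat j \<in> dz_poles" by (simp add: dz_poles_def)
  moreover have "(1::complex) + (1 - 2 * of_nat j) = 2 - 2 * of_nat j" by simp
  ultimately show "fst p + snd p - 1 + 2 * of_nat j \<noteq> 1" using *(2) by metis
qed

lemma continuous_on_pochhammer [continuous_intros]:
  fixes f :: "'a::topological_space \<Rightarrow> complex"
  shows "continuous_on A f \<Longrightarrow> continuous_on A (\<lambda>z. pochhammer (f z) n)"
  unfolding pochhammer_prod by (intro continuous_intros)

lemma continuous_on_dz_term: "continuous_on (dz_domain N) (dz_term N m)"
proof -
  have "(\<lambda>z. zeta_rem N z (Suc m)) holomorphic_on - {1}" by (intro holomorphic_intros) auto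
  then have "continuous_on (- {1}) (\<lambda>z. zeta_rem N z (Suc m))" by (rule holomorphic_on_imp_continuous_on)
  note c = this
  have i: "snd ` dz_domain N \<subseteq> - {1}" using dz_domain_not_pole(2) by (metis ComplI image_subsetI singletonD)
  have "continuous_on (dz_domain N) (\<lambda>p. zeta_rem N (snd p) (Suc m))"
    by (rule continuous_on_compose2[OF c continuous_on_snd[OF continuous_on_id] i])
  then show ?thesis unfolding dz_term_def by (intro continuous_intros) (auto simp del: of_nat_Suc)
qed

lemma continuous_on_dz_approx: "continuous_on (dz_domain N) (dz_approx N)"
proof -
  have 1: "continuous_on (dz_domain N) (\<lambda>p. \<Sum>m. dz_term N m p)"
    by (intro continuous_on_series_local open_dz_domain continuous_on_dz_term dz_term_locally_bounded)
  have 2: "continuous_on (dz_domain N) (\<lambda>p. zeta (fst p + snd p) / 2)"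
    by (intro continuous_intros) (simp_all add: dz_domain_not_pole)
  have 3: "continuous_on (dz_domain N) (\<lambda>p. of_real (em_coeff j) * pochhammer (snd p - 1) (2 * j) / (snd p - 1)
       * zeta (fst p + snd p - 1 + 2 * of_nat j))" for j
    by (intro continuous_intros) (use dz_domain_not_pole(3,4) in blast)+
  show ?thesis unfolding dz_approx_def by (intro continuous_on_add continuous_on_diff continuous_on_sum 1 2 3)
qed

text \<open>Both coordinate directions are treated at once through the embedding
  \<open>h\<close>.\<close>

lemma holomorphic_dz_approx_comp:
  assumes h: "h = (\<lambda>z. (z, w)) \<or> h = (\<lambda>z. (w, z))"
  shows "open {z. h z \<in> dz_domain N}" "(\<lambda>z. dz_approx N (h z)) holomorphic_on {z. h z \<in> dz_domain N}"
proof -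
  have hc: "continuous_on UNIV h" using h by (auto intro!: continuous_intros)
  have "open (h -` V)" if "open V" for V using hc that by (simp add: open_vimage)
  note open_h = this
  show S: "open {z. h z \<in> dz_domain N}" using open_h[OF open_dz_domain[of N]] by (simp add: vimage_def)
  have hh: "(\<lambda>z. fst (h z)) holomorphic_on A" "(\<lambda>z. snd (h z)) holomorphic_on A" for A
    using h by (auto intro!: holomorphic_intros)
  have "(\<lambda>z. \<Sum>m. dz_term N m (h z)) holomorphic_on {z. h z \<in> dz_domain N}"
  proof (rule holomorphic_on_series_local[OF S])
    show "(\<lambda>z. dz_term N n (h z)) holomorphic_on {z. h z \<in> dz_domain N}" for n
      unfolding dz_term_def by (intro holomorphic_intros hh) (use dz_domain_not_pole(2) in auto)
    fix z assume "z \<in> {z. h z \<in> dz_domain N}"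
    then obtain V M where V: "open V" "h z \<in> V" "summable M" "\<forall>m. \<forall>q\<in>V \<inter> dz_domain N. cmod (dz_term N m q) \<le> M m"
      using dz_term_locally_bounded[of "h z" N] by auto
    then show "\<exists>V M. open V \<and> z \<in> V \<and> summable M \<and> (\<forall>n. \<forall>y\<in>V \<inter> {z. h z \<in> dz_domain N}. cmod (dz_term N n (h y)) \<le> M n)"
      by (intro exI[of _ "h -` V"] exI[of _ M]) (auto simp: open_h)
  qed
  then show "(\<lambda>z. dz_approx N (h z)) holomorphic_on {z. h z \<in> dz_domain N}"
    unfolding dz_approx_def by (intro holomorphic_intros hh)
      (unfold mem_Collect_eq, (rule dz_domain_not_pole, assumption | simp)+)
qed

lemma em_deriv_even:
  assumes "s \<noteq> 1"
  shows "c * em_deriv (2 * j) s x = - (c * pochhammer (s - 1) (2 * j) / (s - 1) * x powr (1 - s - 2 * of_nat j))"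
proof -
  have "x / (1 - s) = - (x / (s - 1))" for x by (metis minus_diff_eq minus_divide_right)
  then show ?thesis by (simp add: em_deriv_def)
qed

lemma em_main_eq:
  assumes "s \<noteq> 1"
  shows "em_main N s m = (\<Sum>j\<le>N. of_real (em_coeff j) * pochhammer (s - 1) (2 * j) / (s - 1) * of_nat m powr (1 - s - 2 * of_nat j))"
  unfolding em_main_def em_deriv_even[OF assms] by (simp add: sum_negf)

text \<open>Raising the order moves one power of \<open>m\<close> out of the remainder. On
  \<open>dz_domain N\<close> the real part of \<open>?w\<close> exceeds \<open>2\<close>, so the sum
  of these powers is the zeta value that the finite sum gains.\<close>

lemma dz_approx_Suc:
  assumes p: "p \<in> dz_domain N"
  shows "dz_approx (Suc N) p = dz_approx N p"
proof -
  let ?w = "fst p + snd p - 1 + 2 * of_nat (Suc N)"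
  define c where "c = of_real (em_coeff (Suc N)) * pochhammer (snd p - 1) (2 * Suc N) / (snd p - 1)"
  have p': "p \<in> dz_domain (Suc N)" using p by (auto simp: dz_domain_def)
  have s2: "snd p \<noteq> 1" using dz_domain_not_pole[OF p] by auto
  have "dz_term (Suc N) m p = dz_term N m p - c * of_nat (Suc m) powr (- ?w)" for m
  proof -
    have "zeta_rem (Suc N) (snd p) (Suc m) = zeta_rem N (snd p) (Suc m) - c * of_nat (Suc m) powr (1 - snd p - 2 * of_nat (Suc N))"
      unfolding zeta_rem_def em_partial_def em_main_Suc em_deriv_even[OF s2] c_def by simp
    then have "dz_term (Suc N) m p = dz_term N m p - c * (of_nat (Suc m) powr (- fst p) * of_nat (Suc m) powr (1 - snd p - 2 * of_nat (Suc N)))"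
      by (simp add: dz_term_def right_diff_distrib del: of_nat_Suc)
    also have "of_nat (Suc m) powr (- fst p) * of_nat (Suc m) powr (1 - snd p - 2 * of_nat (Suc N)) = of_nat (Suc m) powr (- ?w)"
      unfolding powr_add[symmetric] by (rule arg_cong2[of _ _ _ _ "(powr)"]) auto
    finally show ?thesis .
  qed
  moreover have "(\<lambda>m. dz_term N m p - c * of_nat (Suc m) powr (- ?w)) sums ((\<Sum>m. dz_term N m p) - c * zeta ?w)"
    by (intro sums_diff sums_mult summable_sums summable_dz_term p zeta_sums) (use p in \<open>auto simp: dz_domain_def\<close>)
  ultimately have "(\<Sum>m. dz_term (Suc N) m p) = (\<Sum>m. dz_term N m p) - c * zeta ?w"
    by (simp add: sums_iff)
  then show ?thesis by (simp add: dz_approx_def c_def)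
qed

lemma dz_domain_mono: "N \<le> M \<Longrightarrow> dz_domain N \<subseteq> dz_domain M"
proof -
  assume "N \<le> M"
  then have "real N \<le> real M" by simp
  then show ?thesis by (auto simp: dz_domain_def)
qed

lemma dz_approx_eq:
  assumes "p \<in> dz_domain N" "N \<le> M"
  shows "dz_approx M p = dz_approx N p"
  using assms(2)
proof (induction M rule: dec_induct)
  case (step n)
  then show ?case using dz_approx_Suc[of p n] dz_domain_mono[of N n] assms by auto
qed simp

definition dz_order :: "complex \<times> complex \<Rightarrow> nat" where
  "dz_order p = nat \<lceil>\<bar>Re (snd p)\<bar> + \<bar>Re (fst p + snd p)\<bar>\<rceil> + 1"

lemma dz_order: "p \<notin> double_zeta_singularities \<Longrightarrow> p \<in> dz_domain (dz_order p)"
proof -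
  have "real (dz_order p) \<ge> \<bar>Re (snd p)\<bar> + \<bar>Re (fst p + snd p)\<bar> + 1"
    unfolding dz_order_def by simp
  then show "p \<notin> double_zeta_singularities \<Longrightarrow> p \<in> dz_domain (dz_order p)"
    by (auto simp: dz_domain_def)
qed

definition dz_cont :: "complex \<times> complex \<Rightarrow> complex" where
  "dz_cont p = dz_approx (dz_order p) p"

lemma dz_cont_eq:
  assumes "p \<in> dz_domain N"
  shows "dz_cont p = dz_approx N p"
proof -
  have p: "p \<in> dz_domain (dz_order p)" using assms by (intro dz_order) (simp add: dz_domain_def)
  show ?thesis
    using dz_approx_eq[OF assms, of "dz_order p"] dz_approx_eq[OF p, of N]
    unfolding dz_cont_def by (cases "N \<le> dz_order p") simp_all
qed

lemma UN_dz_domain: "(\<Union>N. dz_domain N) = - double_zeta_singularities"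
  using dz_order by (auto simp: dz_domain_def)

lemma holomorphic2_dz_cont: "holomorphic2_on dz_cont (- double_zeta_singularities)"
proof -
  have "continuous_on (\<Union>N. dz_domain N) dz_cont"
  proof (rule continuous_on_open_UN)
    show "continuous_on (dz_domain N) dz_cont" for N
      using continuous_on_dz_approx[of N] by (rule continuous_on_eq) (simp add: dz_cont_eq[of _ N])
  qed (rule open_dz_domain)
  moreover have "(\<lambda>z. dz_cont (h z)) holomorphic_on {z. h z \<in> - double_zeta_singularities}"
    if h: "h = (\<lambda>z. (z, w)) \<or> h = (\<lambda>z. (w, z))" for h w
  proof -
    have "(\<lambda>z. dz_cont (h z)) holomorphic_on (\<Union>N\<in>UNIV. {z. h z \<in> dz_domain N})"
    proof (rule holomorphic_on_UN_open)
      show "(\<lambda>z. dz_cont (h z)) holomorphic_on {z. h z \<in> dz_domain N}" for N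
        using holomorphic_dz_approx_comp(2)[OF h, of N] by (rule holomorphic_transform) (simp add: dz_cont_eq[of _ N])
    qed (rule holomorphic_dz_approx_comp(1)[OF h])
    moreover have "(\<Union>N\<in>UNIV. {z. h z \<in> dz_domain N}) = {z. h z \<in> - double_zeta_singularities}"
      unfolding UN_dz_domain[symmetric] by blast
    ultimately show ?thesis by simp
  qed
  ultimately show ?thesis unfolding holomorphic2_on_def UN_dz_domain by blast
qed

section \<open>Splitting off the leading term of the inner tail\<close>

definition zeta_eta :: "complex \<Rightarrow> nat \<Rightarrow> complex" where
  "zeta_eta s m = zeta_tail s m - of_nat m powr (1 - s) / (s - 1)"

text \<open>Only the leading power of \<open>R(m)\<close> obstructs absolute convergence for
  \<open>Re (s1 + s2) > 1\<close>. Its contribution is carried by the explicit term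
  \<open>zeta (s1 + s2 - 1) / (s2 - 1)\<close>, and what remains is a series that no longer depends
  on \<open>N\<close>.\<close>

lemma dz_approx_sums:
  assumes p: "p \<in> dz_domain N" and re: "Re (fst p + snd p) > 1"
  shows "(\<lambda>m. of_nat (Suc m) powr (- fst p) * zeta_eta (snd p) (Suc m)) sums
    (dz_approx N p - zeta (fst p + snd p - 1) / (snd p - 1))"
proof -
  have s2: "snd p \<noteq> 1" using dz_domain_not_pole[OF p] by auto
  define c where "c j = of_real (em_coeff j) * pochhammer (snd p - 1) (2 * j) / (snd p - 1)" for j
  have *: "of_nat (Suc m) powr (- fst p) * zeta_eta (snd p) (Suc m) = 
     (\<Sum>j\<in>{1..N}. c j * of_nat (Suc m) powr (- (fst p + snd p - 1 + 2 * of_nat j))) - of_nat (Suc m) powr (- (fst p + snd p)) / 2 + dz_term N m p" for m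
  proof -
    let ?M = "of_nat (Suc m) :: complex"
    have "em_main N (snd p) (Suc m) = (\<Sum>j\<le>N. c j * ?M powr (1 - snd p - 2 * of_nat j))"
      by (simp add: em_main_eq[OF s2] c_def del: of_nat_Suc)
    \<comment> \<open>\<open>c 0 = 1 / (s2 - 1)\<close>, so the term split off here is precisely the
      one subtracted in \<open>zeta_eta\<close>.\<close>
    also have "\<dots> = c 0 * ?M powr (1 - snd p) + (\<Sum>j\<in>{1..N}. c j * ?M powr (1 - snd p - 2 * of_nat j))"
      by (simp add: sum.atMost_shift sum.atLeast1_atMost_eq del: of_nat_Suc)
    finally have "zeta_eta (snd p) (Suc m) = (\<Sum>j\<in>{1..N}. c j * ?M powr (1 - snd p - 2 * of_nat j)) - ?M powr (- snd p) / 2 + zeta_rem N (snd p) (Suc m)"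
      by (simp add: zeta_eta_def zeta_tail_eq[of _ _ N] c_def del: of_nat_Suc)
    then have "?M powr (- fst p) * zeta_eta (snd p) (Suc m) = (\<Sum>j\<in>{1..N}. c j * (?M powr (- fst p) * ?M powr (1 - snd p - 2 * of_nat j)))
       - (?M powr (- fst p) * ?M powr (- snd p)) / 2 + dz_term N m p"
      by (simp add: dz_term_def ring_distribs sum_distrib_left mult_ac del: of_nat_Suc)
    moreover have "?M powr (- fst p) * ?M powr (- snd p) = ?M powr (- (fst p + snd p))"
      unfolding powr_add[symmetric] by simp
    moreover have "?M powr (- fst p) * ?M powr (1 - snd p - 2 * of_nat j) = ?M powr (- (fst p + snd p - 1 + 2 * of_nat j))" for j
      unfolding powr_add[symmetric] by (rule arg_cong2[of _ _ _ _ "(powr)"]) auto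
    ultimately show ?thesis by (simp only:)
  qed
  have "(\<lambda>m. of_nat (Suc m) powr (- fst p) * zeta_eta (snd p) (Suc m)) sums
    ((\<Sum>j\<in>{1..N}. c j * zeta (fst p + snd p - 1 + 2 * of_nat j)) - zeta (fst p + snd p) / 2 + (\<Sum>m. dz_term N m p))"
    unfolding * using re
    by (intro sums_add sums_diff sums_sum sums_mult sums_divide zeta_sums summable_sums summable_dz_term p) auto
  also have "(\<Sum>j\<in>{1..N}. c j * zeta (fst p + snd p - 1 + 2 * of_nat j)) - zeta (fst p + snd p) / 2 + (\<Sum>m. dz_term N m p)
     = dz_approx N p - zeta (fst p + snd p - 1) / (snd p - 1)"
  proof -
    have "(\<Sum>j\<le>N. c j * zeta (fst p + snd p - 1 + 2 * of_nat j)) = c 0 * zeta (fst p + snd p - 1) + (\<Sum>j\<in>{1..N}. c j * zeta (fst p + snd p - 1 + 2 * of_nat j))"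
      by (simp add: sum.atMost_shift sum.atLeast1_atMost_eq)
    then show ?thesis by (simp add: dz_approx_def c_def)
  qed
  finally show ?thesis .
qed

lemma dz_cont_series:
  assumes "Re s2 > 1" "Re (s1 + s2) > 2"
  shows "dz_cont (s1, s2) = double_zeta_series s1 s2"
proof -
  \<comment> \<open>In the region of absolute convergence order zero is enough, and both pieces of
    the decomposition converge separately and can be recombined term by term.\<close>
  have d: "(s1, s2) \<in> dz_domain 0" using assms
    by (auto simp: dz_domain_def mem_singularities_iff dest!: dz_poles_le)
  have "(\<lambda>m. of_nat (Suc m) powr (- s1) * zeta_eta s2 (Suc m) + of_nat (Suc m) powr (- (s1 + s2 - 1)) / (s2 - 1)) sums
    (dz_approx 0 (s1, s2) - zeta (s1 + s2 - 1) / (s2 - 1) + zeta (s1 + s2 - 1) / (s2 - 1))"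
    using dz_approx_sums[OF d] assms by (intro sums_add sums_divide zeta_sums) auto
  moreover have "of_nat (Suc m) powr (- s1) * zeta_eta s2 (Suc m) + of_nat (Suc m) powr (- (s1 + s2 - 1)) / (s2 - 1)
     = of_nat (Suc m) powr (- s1) * (\<Sum>n. of_nat (Suc m + Suc n) powr (- s2))" for m
  proof -
    have e: "of_nat (Suc m) powr (- (s1 + s2 - 1)) = of_nat (Suc m) powr (- s1) * (of_nat (Suc m) powr (1 - s2) :: complex)"
      unfolding powr_add[symmetric] by (rule arg_cong2[of _ _ _ _ "(powr)"]) auto
    show ?thesis
      unfolding zeta_tail_series[OF assms(1), symmetric] zeta_eta_def e by (simp add: right_diff_distrib)
  qed
  ultimately show ?thesis
    unfolding double_zeta_series_def dz_cont_eq[OF d] by (simp add: sums_iff)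
qed

lemma double_zeta_spec: "holomorphic2_on double_zeta (- double_zeta_singularities)"
  "Re s2 > 1 \<Longrightarrow> Re (s1 + s2) > 2 \<Longrightarrow> double_zeta (s1, s2) = double_zeta_series s1 s2"
proof -
  have "holomorphic2_on double_zeta (- double_zeta_singularities) \<and>
     (\<forall>s1 s2. Re s2 > 1 \<and> Re (s1 + s2) > 2 \<longrightarrow> double_zeta (s1, s2) = double_zeta_series s1 s2)"
    unfolding double_zeta_def
    by (rule someI[of _ dz_cont]) (simp add: holomorphic2_dz_cont dz_cont_series)
  then show "holomorphic2_on double_zeta (- double_zeta_singularities)"
    "Re s2 > 1 \<Longrightarrow> Re (s1 + s2) > 2 \<Longrightarrow> double_zeta (s1, s2) = double_zeta_series s1 s2" by auto
qed

theorem double_zeta_sums: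
  assumes "(s1, s2) \<notin> double_zeta_singularities" "Re (s1 + s2) > 1"
  shows "(\<lambda>m. of_nat (Suc m) powr (- s1) * zeta_eta s2 (Suc m)) sums
    (double_zeta (s1, s2) - zeta (s1 + s2 - 1) / (s2 - 1))"
proof -
  have "double_zeta (s1, s2) = dz_cont (s1, s2)"
    by (rule double_zeta_continuation_unique) (use assms in \<open>auto simp: double_zeta_spec holomorphic2_dz_cont dz_cont_series\<close>)
  then show ?thesis
    using dz_approx_sums[OF dz_order[OF assms(1)]] assms(2) by (simp add: dz_cont_def)
qed

text \<open>With the order adapted to \<open>s\<close>, the remainder and every main term with
  \<open>j >= 1\<close> have exponents at most \<open>- Re s\<close>.\<close>

lemma zeta_eta_bound:
  assumes s: "s \<noteq> 1"
  obtains C where "C \<ge> 0" "\<And>m. m \<ge> 1 \<Longrightarrow> cmod (zeta_eta s m) \<le> C * real m powr (- Re s)"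
proof -
  define N where "N = em_order s"
  define c where "c j = of_real (em_coeff j) * pochhammer (s - 1) (2 * j) / (s - 1)" for j
  define C where "C = (\<Sum>j\<in>{1..N}. cmod (c j)) + 1 / 2 + em_const N s * inv_sq_sum"
  note ec = em_const_nonneg[of N s]
  have "cmod (zeta_eta s m) \<le> C * real m powr (- Re s)" if m: "m \<ge> 1" for m
  proof -
    have le: "real m powr a \<le> real m powr (- Re s)" if "a \<le> - Re s" for a
      using that m by (intro powr_mono) auto
    have "em_main N s m = (\<Sum>j\<le>N. c j * of_nat m powr (1 - s - 2 * of_nat j))"
      by (simp add: em_main_eq[OF s] c_def)
    also have "\<dots> = c 0 * of_nat m powr (1 - s) + (\<Sum>j\<in>{1..N}. c j * of_nat m powr (1 - s - 2 * of_nat j))"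
      by (simp add: sum.atMost_shift sum.atLeast1_atMost_eq)
    finally have "zeta_eta s m = (\<Sum>j\<in>{1..N}. c j * of_nat m powr (1 - s - 2 * of_nat j)) - of_nat m powr (- s) / 2 + zeta_rem N s m"
      by (simp add: zeta_eta_def zeta_tail_eq[of _ _ N] c_def)
    also have "cmod \<dots> \<le> (\<Sum>j\<in>{1..N}. cmod (c j) * real m powr (- Re s)) + 1 / 2 * real m powr (- Re s) + em_const N s * inv_sq_sum * real m powr (- Re s)"
    proof (intro order_trans[OF norm_triangle_ineq] add_mono order_trans[OF norm_triangle_ineq4] sum_norm_le)
      fix j assume "j \<in> {1..N}"
      then show "cmod (c j * of_nat m powr (1 - s - 2 * of_nat j)) \<le> cmod (c j) * real m powr (- Re s)"
        using m by (auto simp: norm_mult norm_of_nat_powr intro!: mult_left_mono le)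
    next
      have "cmod (zeta_rem N s m) \<le> em_const N s * inv_sq_sum * real m powr (- Re s - 2 * N)"
        using em_order[of s] by (intro norm_zeta_rem_le m s) (simp add: N_def)
      also have "\<dots> \<le> em_const N s * inv_sq_sum * real m powr (- Re s)"
        using ec inv_sq_sum_nonneg by (intro mult_left_mono le) auto
      finally show "cmod (zeta_rem N s m) \<le> \<dots>" .
    qed (use m in \<open>auto simp: norm_divide norm_of_nat_powr\<close>)
    also have "\<dots> = C * real m powr (- Re s)" by (simp add: C_def distrib_right sum_distrib_right)
    finally show ?thesis .
  qed
  moreover have "C \<ge> 0" unfolding C_def using ec inv_sq_sum_nonneg by (intro add_nonneg_nonneg sum_nonneg mult_nonneg_nonneg) auto
  ultimately show ?thesis using that by blast
qed

section \<open>Mean values of Dirichlet polynomials\<close>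

lemma norm_square_exp_sum:
  fixes a :: "nat \<Rightarrow> complex" and l :: "nat \<Rightarrow> real"
  shows "of_real ((cmod (\<Sum>m\<in>A. a m * exp (t *\<^sub>R (\<i> * of_real (l m)))))\<^sup>2) =
    (\<Sum>m\<in>A. \<Sum>n\<in>A. a m * cnj (a n) * exp (t *\<^sub>R (\<i> * of_real (l m - l n))))"
proof -
  have "exp (t *\<^sub>R (\<i> * of_real (l m))) * cnj (exp (t *\<^sub>R (\<i> * of_real (l n)))) = exp (t *\<^sub>R (\<i> * of_real (l m - l n)))" for m n
    by (simp add: exp_cnj exp_add[symmetric] algebra_simps)
  note e = this
  have "a m * exp (t *\<^sub>R (\<i> * of_real (l m))) * (cnj (a n) * cnj (exp (t *\<^sub>R (\<i> * of_real (l n)))))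
     = a m * cnj (a n) * exp (t *\<^sub>R (\<i> * of_real (l m - l n)))" for m n
    unfolding e[symmetric] by (simp only: mult_ac)
  then show ?thesis
    unfolding complex_norm_square cnj_sum complex_cnj_mult sum_product by (intro sum.cong refl)
qed

lemma has_integral_exp:
  fixes c :: complex
  assumes "c \<noteq> 0" "a \<le> b"
  shows "((\<lambda>t. exp (t *\<^sub>R c)) has_integral (exp (b *\<^sub>R c) - exp (a *\<^sub>R c)) / c) {a..b}"
proof -
  have "((\<lambda>t. exp (t *\<^sub>R c) / c) has_vector_derivative exp (t *\<^sub>R c)) (at t within {a..b})" for t
    using has_vector_derivative_divide[OF exp_scaleR_has_vector_derivative_right[of c t "{a..b}"], of c] assms
    by simp
  from fundamental_theorem_of_calculus[OF assms(2) this] show ?thesis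
    by (simp add: diff_divide_distrib)
qed

lemma exp_2pi_int: "exp (\<i> * of_real (2 * pi * (real m - real n))) = 1"
proof -
  have "exp (\<i> * of_real (2 * pi * (real m - real n))) = exp (2 * of_int (int m - int n) * of_real pi * \<i>)"
    by (simp add: algebra_simps)
  then show ?thesis using exp_integer_2pi[of "of_int (int m - int n)"] by simp
qed

lemma has_integral_linear_exp:
  fixes m n :: nat
  assumes "m \<noteq> n"
  defines "c \<equiv> \<i> * of_real (2 * pi * (real m - real n))"
  shows "((\<lambda>t. of_real (t - 1/2) * exp (t *\<^sub>R c)) has_integral 1 / c) {0..1}"
proof -
  have c: "c \<noteq> 0" using assms by (simp add: c_def)
  have "((\<lambda>t. of_real (t - 1/2) * (exp (t *\<^sub>R c) / c) - exp (t *\<^sub>R c) / c / c) has_vector_derivative of_real (t - 1/2) * exp (t *\<^sub>R c)) (at t within {0..1})" for t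
    using c by (auto intro!: derivative_eq_intros exp_scaleR_has_vector_derivative_right simp: add_divide_distrib)
  from fundamental_theorem_of_calculus[OF zero_le_one this]
  have "((\<lambda>t. of_real (t - 1/2) * exp (t *\<^sub>R c)) has_integral
     (of_real (1 - 1/2) * (exp (1 *\<^sub>R c) / c) - exp (1 *\<^sub>R c) / c / c) - (of_real (0 - 1/2) * (exp (0 *\<^sub>R c) / c) - exp (0 *\<^sub>R c) / c / c)) {0..1}"
    by simp
  moreover have "exp c = 1" unfolding c_def by (rule exp_2pi_int)
  ultimately show ?thesis by (simp add: field_simps)
qed

text \<open>Integrate \<open>(t - 1/2) |S(t)|^2\<close> over \<open>[0, 1]\<close>. The function
  \<open>t - 1/2\<close> has mean zero and its other Fourier coefficients produce
  \<open>1 / (2 pi i (m - n))\<close>, so the integral is the bilinear form up to the factor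
  \<open>2 pi i\<close>. As \<open>|t - 1/2| <= 1/2\<close>, it is at most half of the mean square
  of \<open>S\<close>, which Parseval evaluates.\<close>

lemma Hilbert_inequality:
  fixes x :: "nat \<Rightarrow> complex"
  assumes A: "finite A"
  shows "cmod (\<Sum>m\<in>A. \<Sum>n\<in>A - {m}. x m * cnj (x n) / of_real (real m - real n)) \<le> pi * (\<Sum>m\<in>A. (cmod (x m))\<^sup>2)"
proof -
  define S where "S t = (\<Sum>m\<in>A. x m * exp (t *\<^sub>R (\<i> * of_real (2 * pi * real m))))" for t :: real
  define c where "c m n = \<i> * of_real (2 * pi * (real m - real n))" for m n
  have S2: "of_real ((cmod (S t))\<^sup>2) = (\<Sum>m\<in>A. \<Sum>n\<in>A. x m * cnj (x n) * exp (t *\<^sub>R c m n))" for t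
    unfolding S_def norm_square_exp_sum c_def by (simp add: algebra_simps)
  have int: "((\<lambda>t. \<Sum>m\<in>A. \<Sum>n\<in>A. x m * cnj (x n) * exp (t *\<^sub>R c m n)) has_integral
     (\<Sum>m\<in>A. \<Sum>n\<in>A. x m * cnj (x n) * (if m = n then 1 else 0))) {0..1}"
  proof (intro has_integral_sum A has_integral_mult_right)
    fix m n
    show "((\<lambda>t. exp (t *\<^sub>R c m n)) has_integral (if m = n then 1 else 0)) {0..1}"
    proof (cases "m = n")
      case True
      then show ?thesis using has_integral_const_real[of "1::complex" 0 1] by (simp add: c_def)
    next
      case False
      then have "c m n \<noteq> 0" by (simp add: c_def)
      from has_integral_exp[OF this, of 0 1] show ?thesis
        using False exp_2pi_int[of m n] by (simp add: c_def)
    qed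
  qed
  have "((\<lambda>t. complex_of_real ((cmod (S t))\<^sup>2)) has_integral (\<Sum>m\<in>A. of_real ((cmod (x m))\<^sup>2))) {0..1}"
  proof -
    have "(\<Sum>n\<in>A. x m * cnj (x n) * (if m = n then 1 else 0)) = of_real ((cmod (x m))\<^sup>2)" if "m \<in> A" for m
      unfolding complex_norm_square using A that by (simp add: if_distrib[of "\<lambda>u. _ * u"] cong: if_cong)
    then have "(\<Sum>m\<in>A. \<Sum>n\<in>A. x m * cnj (x n) * (if m = n then 1 else 0)) = (\<Sum>m\<in>A. of_real ((cmod (x m))\<^sup>2))"
      by (rule sum.cong[OF refl])
    then show ?thesis using int unfolding S2 by (simp only:)
  qed
  from has_integral_Re[OF this]
  have I1: "((\<lambda>t. (cmod (S t))\<^sup>2) has_integral (\<Sum>m\<in>A. (cmod (x m))\<^sup>2)) {0..1}"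
    by simp
  have I2: "((\<lambda>t. of_real (t - 1/2) * of_real ((cmod (S t))\<^sup>2)) has_integral
     (\<Sum>m\<in>A. \<Sum>n\<in>A. x m * cnj (x n) * (if m = n then 0 else 1 / c m n))) {0..1}" (is "(_ has_integral ?I) _")
  proof -
    have "((\<lambda>t. \<Sum>m\<in>A. \<Sum>n\<in>A. x m * cnj (x n) * (of_real (t - 1/2) * exp (t *\<^sub>R c m n))) has_integral ?I) {0..1}"
    proof (intro has_integral_sum A has_integral_mult_right)
      fix m n
      show "((\<lambda>t. of_real (t - 1/2) * exp (t *\<^sub>R c m n)) has_integral (if m = n then 0 else 1 / c m n)) {0..1}"
      proof (cases "m = n")
        case True
        have "((\<lambda>t::real. t\<^sup>2 / 2 - t / 2) has_vector_derivative t - 1/2) (at t within {0..1})" for t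
          unfolding has_real_derivative_iff_has_vector_derivative[symmetric]
          by (auto intro!: derivative_eq_intros)
        from fundamental_theorem_of_calculus[OF zero_le_one this]
        have "((\<lambda>t::real. t - 1/2) has_integral 0) {0..1}" by simp
        from has_integral_of_real[OF this, where ?'b = complex] True show ?thesis by (simp add: c_def)
      next
        case False
        then show ?thesis using has_integral_linear_exp[of m n] by (simp add: c_def)
      qed
    qed
    then show ?thesis unfolding S2 by (simp add: sum_distrib_left mult_ac)
  qed
  have "cmod ?I \<le> (\<Sum>m\<in>A. (cmod (x m))\<^sup>2) / 2"
  proof -
    have "cmod (integral {0..1} (\<lambda>t. of_real (t - 1/2) * of_real ((cmod (S t))\<^sup>2) :: complex))
       \<le> integral {0..1} (\<lambda>t. 1/2 * (cmod (S t))\<^sup>2)"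
    proof (rule integral_norm_bound_integral)
      show "(\<lambda>t. of_real (t - 1/2) * of_real ((cmod (S t))\<^sup>2) :: complex) integrable_on {0..1}"
        using I2 by (rule has_integral_integrable)
      show "(\<lambda>t. 1/2 * (cmod (S t))\<^sup>2) integrable_on {0..1}"
        using has_integral_mult_right[OF I1, of "1/2"] by (rule has_integral_integrable)
      fix t :: real assume "t \<in> {0..1}"
      then have "\<bar>t - 1/2\<bar> \<le> 1/2" by (auto simp: abs_if)
      then have "\<bar>t - 1/2\<bar> * (cmod (S t))\<^sup>2 \<le> 1/2 * (cmod (S t))\<^sup>2" by (intro mult_right_mono) auto
      moreover have "cmod (of_real (t - 1/2) * of_real ((cmod (S t))\<^sup>2)) = \<bar>t - 1/2\<bar> * (cmod (S t))\<^sup>2"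
        by (simp only: norm_mult norm_of_real abs_power2 abs_norm_cancel power_abs)
      ultimately show "cmod (of_real (t - 1/2) * of_real ((cmod (S t))\<^sup>2)) \<le> 1/2 * (cmod (S t))\<^sup>2" by simp
    qed
    then show ?thesis
      using integral_unique[OF I2] integral_unique[OF has_integral_mult_right[OF I1, of "1/2"]] by simp
  qed
  moreover have "(\<Sum>m\<in>A. \<Sum>n\<in>A - {m}. x m * cnj (x n) / of_real (real m - real n)) = 2 * pi * \<i> * ?I"
  proof -
    have "(\<Sum>n\<in>A. x m * cnj (x n) * (if m = n then 0 else 1 / c m n)) = (\<Sum>n\<in>A - {m}. x m * cnj (x n) * (1 / c m n))" for m
      using A by (intro sum.mono_neutral_cong_right) auto
    moreover have "2 * pi * \<i> * (x m * cnj (x n) * (1 / c m n)) = x m * cnj (x n) / of_real (real m - real n)" for m n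
      by (simp add: c_def)
    ultimately show ?thesis by (simp add: sum_distrib_left)
  qed
  ultimately show ?thesis by (simp add: norm_mult)
qed

text \<open>With \<open>u = ln (m / n) / 2\<close> the second quotient is \<open>1 / (2 sinh u)\<close>, so that after this replacement
  the unweighted Hilbert inequality, applied to \<open>sqrt m * a m\<close>, does the work of the Montgomery--Vaughan
  inequality.\<close>

lemma inverse_ln_approx:
  assumes "m > 0" "n > 0" "m \<noteq> n"
  shows "\<bar>1 / (ln m - ln n) - sqrt m * sqrt n / (m - n)\<bar> \<le> 1"
proof -
  have *: "\<bar>1 / (ln m - ln n) - sqrt m * sqrt n / (m - n)\<bar> \<le> 1" if n: "0 < n" "n < m" for m n :: real
  proof -
    define u where "u = (ln m - ln n) / 2"
    have u: "u > 0" using n by (simp add: u_def)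
    define s where "s = (exp u - exp (- u)) / 2"
    have e: "exp u = sqrt m / sqrt n"
    proof -
      have "u = ln (sqrt m / sqrt n)" using n by (simp add: u_def ln_div ln_sqrt diff_divide_distrib)
      then show ?thesis using n by simp
    qed
    have 1: "sqrt m * sqrt n / (m - n) = 1 / (2 * s)"
    proof -
      have "p / q - q / p = (p * p - q * q) / (p * q)" if "p > 0" "q > 0" for p q :: real
        using that by (simp add: divide_simps)
      from this[of "sqrt m" "sqrt n"] have "sqrt m / sqrt n - sqrt n / sqrt m = (m - n) / (sqrt m * sqrt n)"
        using n by simp
      moreover have "2 * s = sqrt m / sqrt n - sqrt n / sqrt m"
      proof -
        have "2 * s = exp u - exp (- u)" by (simp add: s_def)
        then show ?thesis by (simp add: e exp_minus)
      qed
      ultimately show ?thesis by simp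
    qed
    \<comment> \<open>\<open>s\<close> is \<open>sinh u\<close>. Together with \<open>su\<close>
      this places \<open>1 / (2 u) - 1 / (2 s)\<close> between \<open>0\<close> and
      \<open>1\<close>. For the inequality itself, the quadratic Taylor polynomial \<open>E\<close>
      of \<open>exp\<close> already satisfies \<open>2 u <= E - 1 / E\<close>, which increases with
      \<open>E\<close>.\<close>
    have us: "u \<le> s"
    proof -
      define E where "E = 1 + u + u\<^sup>2 / 2"
      have E: "E > 0" "E \<le> exp u" using u exp_lower_Taylor_quadratic[of u] by (auto simp: E_def intro!: add_pos_nonneg)
      have "E * E - 1 - 2 * u * E = (u\<^sup>2)\<^sup>2 / 4" by (simp add: E_def power2_eq_square field_simps)
      then have "2 * u * E \<le> E * E - 1" using zero_le_power2[of "u\<^sup>2"] by linarith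
      then have "2 * u \<le> E - 1 / E" using E by (simp add: field_simps)
      moreover have "1 / exp u \<le> 1 / E" using E by (intro divide_left_mono) auto
      ultimately have "2 * u \<le> exp u - 1 / exp u" using E by linarith
      then show ?thesis by (simp add: s_def exp_minus inverse_eq_divide)
    qed
    \<comment> \<open>For \<open>u < 1\<close>, \<open>cosh u >= 1\<close> gives
      \<open>s <= exp u - 1\<close>, and \<open>(1 - u) exp u <= 1\<close> finishes.\<close>
    have su: "s - u \<le> u * s"
    proof (cases "u \<ge> 1")
      case True
      then have "1 * s \<le> u * s" using us u by (intro mult_right_mono) auto
      then show ?thesis using u by simp
    next
      case False
      have "2 \<le> exp u + exp (- u)"
        using cosh_real_ge_1[of u] by (simp add: cosh_field_def)
      then have "s \<le> exp u - 1" by (simp add: s_def)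
      then have "(1 - u) * s \<le> (1 - u) * (exp u - 1)" using False by (intro mult_left_mono) auto
      moreover have "(1 - u) * exp u \<le> exp (- u) * exp u"
        using exp_ge_add_one_self[of "- u"] by (intro mult_right_mono) auto
      ultimately show ?thesis by (simp add: exp_minus algebra_simps)
    qed
    have 2: "ln m - ln n = 2 * u" by (simp add: u_def)
    have "1 / (2 * u) - 1 / (2 * s) = (s - u) / (2 * (u * s))" using u us by (simp add: field_simps)
    moreover have "(s - u) / (2 * (u * s)) \<le> 1" "0 \<le> (s - u) / (2 * (u * s))"
      using u us su by (simp_all add: divide_le_eq)
    ultimately show ?thesis unfolding 1 2 by simp
  qed
  show ?thesis
  proof (cases "n < m")
    case True
    then show ?thesis using * assms by blast
  next
    case False
    then have "\<bar>1 / (ln n - ln m) - sqrt n * sqrt m / (n - m)\<bar> \<le> 1" using * assms by force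
    moreover have "1 / (ln m - ln n) = - (1 / (ln n - ln m))" by (metis minus_diff_eq minus_divide_right)
    moreover have "sqrt m * sqrt n / (m - n) = - (sqrt n * sqrt m / (n - m))" by (metis minus_diff_eq minus_divide_right mult.commute)
    ultimately show ?thesis by linarith
  qed
qed

text \<open>The bounded difference of the two kernels is estimated trivially and costs the square of
  the sum of absolute values. For coefficients of size \<open>m^(1-r)\<close> with
  \<open>3/2 <= r < 2\<close> this has the same order as the Hilbert part.\<close>

lemma log_bilinear_bound:
  fixes b :: "nat \<Rightarrow> complex"
  assumes A: "finite A" "0 \<notin> A"
  shows "cmod (\<Sum>m\<in>A. \<Sum>n\<in>A - {m}. b m * cnj (b n) / of_real (ln (real m) - ln (real n)))
    \<le> pi * (\<Sum>m\<in>A. real m * (cmod (b m))\<^sup>2) + (\<Sum>m\<in>A. cmod (b m))\<^sup>2"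
proof -
  define r where "r m n = 1 / (ln (real m) - ln (real n)) - sqrt m * sqrt n / (real m - real n)" for m n :: nat
  define x where "x m = of_real (sqrt m) * b m" for m :: nat
  have r: "\<bar>r m n\<bar> \<le> 1" if "m \<in> A" "n \<in> A - {m}" for m n
    unfolding r_def using that A by (intro inverse_ln_approx) (auto intro: gr0I)
  have "b m * cnj (b n) / of_real (ln (real m) - ln (real n)) = x m * cnj (x n) / of_real (real m - real n) + b m * cnj (b n) * of_real (r m n)" for m n
    by (simp add: r_def x_def ring_distribs)
  then have "(\<Sum>m\<in>A. \<Sum>n\<in>A - {m}. b m * cnj (b n) / of_real (ln (real m) - ln (real n))) =
     (\<Sum>m\<in>A. \<Sum>n\<in>A - {m}. x m * cnj (x n) / of_real (real m - real n)) + (\<Sum>m\<in>A. \<Sum>n\<in>A - {m}. b m * cnj (b n) * of_real (r m n))"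
    by (simp only: sum.distrib)
  also have "cmod \<dots> \<le> pi * (\<Sum>m\<in>A. (cmod (x m))\<^sup>2) + (\<Sum>m\<in>A. \<Sum>n\<in>A. cmod (b m) * cmod (b n))"
  proof (intro order_trans[OF norm_triangle_ineq] add_mono Hilbert_inequality A)
    show "cmod (\<Sum>m\<in>A. \<Sum>n\<in>A - {m}. b m * cnj (b n) * of_real (r m n)) \<le> (\<Sum>m\<in>A. \<Sum>n\<in>A. cmod (b m) * cmod (b n))"
    proof (rule sum_norm_le)
      fix m assume m: "m \<in> A"
      have "cmod (\<Sum>n\<in>A - {m}. b m * cnj (b n) * of_real (r m n)) \<le> (\<Sum>n\<in>A - {m}. cmod (b m) * cmod (b n))"
      proof (rule sum_norm_le)
        fix n assume n: "n \<in> A - {m}"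
        have "cmod (b m) * cmod (b n) * \<bar>r m n\<bar> \<le> cmod (b m) * cmod (b n) * 1"
          by (intro mult_left_mono r m n) auto
        then show "cmod (b m * cnj (b n) * of_real (r m n)) \<le> cmod (b m) * cmod (b n)"
          by (simp add: norm_mult)
      qed
      also have "\<dots> \<le> (\<Sum>n\<in>A. cmod (b m) * cmod (b n))" using A by (intro sum_mono2) auto
      finally show "cmod (\<Sum>n\<in>A - {m}. b m * cnj (b n) * of_real (r m n)) \<le> (\<Sum>n\<in>A. cmod (b m) * cmod (b n))" .
    qed
  qed
  also have "\<dots> = pi * (\<Sum>m\<in>A. real m * (cmod (b m))\<^sup>2) + (\<Sum>m\<in>A. cmod (b m))\<^sup>2"
    by (simp add: x_def norm_mult power_mult_distrib power2_eq_square[of "sum _ _"] sum_product)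
  finally show ?thesis .
qed

section \<open>Mean square of a Dirichlet polynomial\<close>

lemma of_nat_powr_exp:
  "m > 0 \<Longrightarrow> of_nat m powr (- (\<i> * of_real t)) = exp (t *\<^sub>R (\<i> * of_real (- ln (real m))))"
  by (simp add: powr_def Ln_of_nat scaleR_conv_of_real algebra_simps)

text \<open>Integrating the off-diagonal terms leaves one bilinear form with kernel
  \<open>1 / (ln m - ln n)\<close> for each endpoint. The oscillating factors at an endpoint are
  absorbed into the coefficients without changing their moduli, so \<open>log_bilinear_bound\<close>
  applies twice, uniformly in the endpoints.\<close>

theorem mean_value_Dirichlet_polynomial:
  fixes a :: "nat \<Rightarrow> complex"
  assumes A: "finite A" "0 \<notin> A" and T: "T1 \<le> T2"
  shows "\<bar>integral {T1..T2} (\<lambda>t. (cmod (\<Sum>m\<in>A. a m * of_nat m powr (- (\<i> * of_real t))))\<^sup>2)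
      - (T2 - T1) * (\<Sum>m\<in>A. (cmod (a m))\<^sup>2)\<bar>
    \<le> 2 * (pi * (\<Sum>m\<in>A. real m * (cmod (a m))\<^sup>2) + (\<Sum>m\<in>A. cmod (a m))\<^sup>2)"
proof -
  define l where "l m = - ln (real m)" for m
  define S where "S t = (\<Sum>m\<in>A. a m * exp (t *\<^sub>R (\<i> * of_real (l m))))" for t :: real
  have S: "(\<Sum>m\<in>A. a m * of_nat m powr (- (\<i> * of_real t))) = S t" for t
    unfolding S_def l_def using A by (intro sum.cong refl) (metis of_nat_powr_exp gr0I)
  define b where "b t m = a m * exp (t *\<^sub>R (\<i> * of_real (l m)))" for t m
  have nb: "cmod (b t m) = cmod (a m)" for t m by (simp add: b_def norm_mult)
  define F where "F t = (\<Sum>m\<in>A. \<Sum>n\<in>A - {m}. b t m * cnj (b t n) / of_real (ln (real m) - ln (real n)))" for t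
  have F: "cmod (F t) \<le> pi * (\<Sum>m\<in>A. real m * (cmod (a m))\<^sup>2) + (\<Sum>m\<in>A. cmod (a m))\<^sup>2" for t
    using log_bilinear_bound[OF A, of "b t"] by (simp only: F_def nb)
  define c where "c m n = \<i> * of_real (l m - l n)" for m n
  have "((\<lambda>t. \<Sum>m\<in>A. \<Sum>n\<in>A. a m * cnj (a n) * exp (t *\<^sub>R c m n)) has_integral
     (\<Sum>m\<in>A. \<Sum>n\<in>A. a m * cnj (a n) * (if m = n then of_real (T2 - T1) else (exp (T2 *\<^sub>R c m n) - exp (T1 *\<^sub>R c m n)) / c m n))) {T1..T2}"
    (is "(_ has_integral ?I) _")
  proof (intro has_integral_sum A has_integral_mult_right)
    fix m n assume mn: "m \<in> A" "n \<in> A"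
    show "((\<lambda>t. exp (t *\<^sub>R c m n)) has_integral (if m = n then of_real (T2 - T1) else (exp (T2 *\<^sub>R c m n) - exp (T1 *\<^sub>R c m n)) / c m n)) {T1..T2}"
    proof (cases "m = n")
      case True
      then show ?thesis using has_integral_const_real[of "1::complex" T1 T2] T by (simp add: c_def scaleR_conv_of_real)
    next
      case False
      have "m > 0" "n > 0" using mn A by (auto intro: gr0I)
      then have "c m n \<noteq> 0" using False by (simp add: c_def l_def)
      then show ?thesis using has_integral_exp[OF _ T, of "c m n"] False by simp
    qed
  qed
  then have "((\<lambda>t. complex_of_real ((cmod (S t))\<^sup>2)) has_integral ?I) {T1..T2}"
    unfolding S_def norm_square_exp_sum c_def .
  from has_integral_Re[OF this]
  have "((\<lambda>t. (cmod (S t))\<^sup>2) has_integral Re ?I) {T1..T2}" by (simp only: Re_complex_of_real)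
  then have int: "integral {T1..T2} (\<lambda>t. (cmod (S t))\<^sup>2) = Re ?I" by (rule integral_unique)
  have "?I = of_real ((T2 - T1) * (\<Sum>m\<in>A. (cmod (a m))\<^sup>2)) + \<i> * (F T2 - F T1)"
  proof -
    have diag: "(\<Sum>n\<in>A. a m * cnj (a n) * (if m = n then of_real (T2 - T1) else (exp (T2 *\<^sub>R c m n) - exp (T1 *\<^sub>R c m n)) / c m n))
       = of_real ((T2 - T1) * (cmod (a m))\<^sup>2) + (\<Sum>n\<in>A - {m}. a m * cnj (a n) * ((exp (T2 *\<^sub>R c m n) - exp (T1 *\<^sub>R c m n)) / c m n))" if "m \<in> A" for m
    proof -
      have "of_real ((T2 - T1) * (cmod (a m))\<^sup>2) = a m * cnj (a m) * of_real (T2 - T1)"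
        by (simp only: of_real_mult complex_norm_square mult.commute)
      then show ?thesis
        using A that by (subst sum.remove[of A m]) (auto intro!: sum.cong)
    qed
    have bb: "b t m * cnj (b t n) = a m * cnj (a n) * exp (t *\<^sub>R c m n)" for t m n
      by (simp add: b_def c_def exp_cnj exp_diff exp_minus ring_distribs scaleR_diff_right divide_inverse mult_ac)
    have off: "a m * cnj (a n) * ((exp (T2 *\<^sub>R c m n) - exp (T1 *\<^sub>R c m n)) / c m n) =
       \<i> * (b T2 m * cnj (b T2 n) / of_real (ln (real m) - ln (real n)) - b T1 m * cnj (b T1 n) / of_real (ln (real m) - ln (real n)))" for m n
    proof -
      have "c m n = - \<i> * of_real (ln (real m) - ln (real n))" by (simp add: c_def l_def algebra_simps)
      then have "z / c m n = \<i> * (z / of_real (ln (real m) - ln (real n)))" for z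
        by (simp add: divide_simps)
      then show ?thesis unfolding bb by (simp add: ring_distribs diff_divide_distrib mult_ac)
    qed
    let ?X = "\<lambda>t m n. b t m * cnj (b t n) / of_real (ln (real m) - ln (real n))"
    have "?I = (\<Sum>m\<in>A. of_real ((T2 - T1) * (cmod (a m))\<^sup>2) + (\<Sum>n\<in>A - {m}. \<i> * (?X T2 m n - ?X T1 m n)))"
      by (rule sum.cong[OF refl]) (simp only: diag off)
    also have "\<dots> = (\<Sum>m\<in>A. of_real ((T2 - T1) * (cmod (a m))\<^sup>2)) + \<i> * (\<Sum>m\<in>A. \<Sum>n\<in>A - {m}. ?X T2 m n - ?X T1 m n)"
      by (simp only: sum.distrib sum_distrib_left)
    also have "(\<Sum>m\<in>A. \<Sum>n\<in>A - {m}. ?X T2 m n - ?X T1 m n) = F T2 - F T1"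
      by (simp only: F_def sum_subtractf)
    also have "(\<Sum>m\<in>A. of_real ((T2 - T1) * (cmod (a m))\<^sup>2)) = (of_real ((T2 - T1) * (\<Sum>m\<in>A. (cmod (a m))\<^sup>2)) :: complex)"
      by (simp only: of_real_sum sum_distrib_left)
    finally show ?thesis .
  qed
  then have "Re ?I - (T2 - T1) * (\<Sum>m\<in>A. (cmod (a m))\<^sup>2) = Re (\<i> * (F T2 - F T1))"
    by simp
  also have "\<bar>\<dots>\<bar> \<le> cmod (F T2 - F T1)" using abs_Re_le_cmod[of "\<i> * (F T2 - F T1)"] by (simp add: norm_mult)
  also have "\<dots> \<le> cmod (F T2) + cmod (F T1)" by (rule norm_triangle_ineq4)
  finally show ?thesis using F[of T1] F[of T2] unfolding S int by simp
qed

section \<open>The Hardy--Littlewood approximation\<close>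

lemma exp_minus_ne_1:
  fixes z :: complex
  assumes "z \<noteq> 0" "cmod z < 2"
  shows "exp (- z) \<noteq> 1"
proof
  assume "exp (- z) = 1"
  then obtain n :: int where n: "Re z = 0" "Im (- z) = of_int (2 * n) * pi" by (auto simp: exp_eq_1)
  have "n \<noteq> 0" using n assms(1) by (auto simp: complex_eq_iff)
  then have "1 \<le> \<bar>real_of_int n\<bar>" by linarith
  then have "1 * (2 * pi) \<le> \<bar>real_of_int n\<bar> * (2 * pi)" by (intro mult_right_mono) auto
  moreover have "Im z = - (real_of_int n * (2 * pi))" using n(2) by simp
  then have "\<bar>Im z\<bar> = \<bar>real_of_int n\<bar> * (2 * pi)" by (simp add: abs_mult)
  ultimately have "2 * pi \<le> \<bar>Im z\<bar>" by simp
  then show False using assms(2) abs_Im_le_cmod[of z] pi_gt3 by linarith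
qed

text \<open>The kernel extends holomorphically over zero: \<open>(1 - exp (- z)) / z\<close> has a
  removable singularity and no zeros in the disc of radius 2, and the difference quotient at zero of
  its reciprocal is the kernel. Compactness of the unit disc then bounds the kernel and its
  derivative.\<close>

lemma bernoulli_kernel_bounds:
  obtains L :: real where "L \<ge> 0"
    "\<And>z. z \<noteq> 0 \<Longrightarrow> cmod z \<le> 1 \<Longrightarrow> cmod (1 / (1 - exp (- z)) - 1 / z) \<le> L"
    "\<And>y z. y \<noteq> 0 \<Longrightarrow> cmod y \<le> 1 \<Longrightarrow> z \<noteq> 0 \<Longrightarrow> cmod z \<le> 1 \<Longrightarrow>
       cmod ((1 / (1 - exp (- y)) - 1 / y) - (1 / (1 - exp (- z)) - 1 / z)) \<le> L * cmod (y - z)"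
proof -
  let ?S = "ball 0 2 :: complex set"
  define f where "f z = - exp (- z)" for z :: complex
  have df: "deriv f 0 = 1" unfolding f_def
    by (rule DERIV_imp_deriv) (auto intro!: derivative_eq_intros)
  define E where "E z = (if z = 0 then deriv f 0 else (f z - f 0) / (z - 0))" for z
  have "f holomorphic_on ?S" unfolding f_def by (intro holomorphic_intros)
  then have E: "E holomorphic_on ?S" unfolding E_def by (rule pole_lemma) simp
  have E0: "E z \<noteq> 0" if "z \<in> ?S" for z
    using that exp_minus_ne_1[of z] by (auto simp: E_def df f_def)
  define G where "G z = 1 / E z" for z
  have G: "G holomorphic_on ?S" unfolding G_def using E E0 by (intro holomorphic_intros) auto
  define B where "B z = (if z = 0 then deriv G 0 else (G z - G 0) / (z - 0))" for z
  have B: "B holomorphic_on ?S" unfolding B_def by (rule pole_lemma[OF G]) simp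
  have B_eq: "B z = 1 / (1 - exp (- z)) - 1 / z" if "z \<noteq> 0" for z
  proof -
    have "E z = (1 - exp (- z)) / z" "E 0 = 1" using that by (simp_all add: E_def df f_def)
    then have "G z = z / (1 - exp (- z))" "G 0 = 1" unfolding G_def by simp_all
    then have "B z = (z / (1 - exp (- z)) - 1) / z" using that by (simp add: B_def)
    then show ?thesis using that by (simp add: diff_divide_distrib)
  qed
  have dB: "deriv B holomorphic_on ?S" by (intro holomorphic_deriv B) auto
  have sub: "cball 0 1 \<subseteq> ?S" by auto
  have bdd: "\<exists>K. \<forall>z\<in>cball 0 1. cmod (g z) \<le> K" if "g holomorphic_on ?S" for g
  proof -
    have "bounded (g ` cball 0 1)"
      by (rule compact_imp_bounded[OF compact_continuous_image[OF continuous_on_subset[OF holomorphic_on_imp_continuous_on[OF that] sub] compact_cball]])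
    then show ?thesis unfolding bounded_iff by simp
  qed
  obtain L1 where L1: "\<And>z. z \<in> cball 0 1 \<Longrightarrow> cmod (B z) \<le> L1" using bdd[OF B] by metis
  obtain L2 where L2: "\<And>z. z \<in> cball 0 1 \<Longrightarrow> cmod (deriv B z) \<le> L2" using bdd[OF dB] by metis
  have lip: "cmod (B y - B z) \<le> L2 * cmod (y - z)" if "y \<in> cball 0 1" "z \<in> cball 0 1" for y z
  proof (rule field_differentiable_bound[of "cball 0 1" B "deriv B"])
    fix w :: complex assume "w \<in> cball 0 1"
    then have "w \<in> ?S" by (rule subsetD[OF sub])
    then have "(B has_field_derivative deriv B w) (at w)"
      by (rule holomorphic_derivI[OF B open_ball])
    then show "(B has_field_derivative deriv B w) (at w within cball 0 1)" by (rule has_field_derivative_at_within)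
    show "cmod (deriv B w) \<le> L2" by (rule L2) fact
  qed (rule that convex_cball)+
  show ?thesis
  proof (rule that[of "max L1 L2"])
    show "max L1 L2 \<ge> 0" using order_trans[OF norm_ge_zero L1[of 0]] by (simp add: le_max_iff_disj)
    show "cmod (1 / (1 - exp (- z)) - 1 / z) \<le> max L1 L2" if "z \<noteq> 0" "cmod z \<le> 1" for z
      using L1[of z] that B_eq[of z] by auto
    show "cmod ((1 / (1 - exp (- y)) - 1 / y) - (1 / (1 - exp (- z)) - 1 / z)) \<le> max L1 L2 * cmod (y - z)"
      if "y \<noteq> 0" "cmod y \<le> 1" "z \<noteq> 0" "cmod z \<le> 1" for y z
    proof -
      have "cmod (B y - B z) \<le> L2 * cmod (y - z)" using that by (intro lip) auto
      also have "\<dots> \<le> max L1 L2 * cmod (y - z)" by (intro mult_right_mono) auto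
      finally show ?thesis using that by (simp add: B_eq)
    qed
  qed
qed

section \<open>Differences of logarithms\<close>

definition log_step :: "nat \<Rightarrow> real" where "log_step n = ln (real (Suc n) / real n)"

lemma log_step_bounds:
  assumes "n \<ge> 1"
  shows "1 / (real n + 1) \<le> log_step n" "log_step n \<le> 1 / real n" "0 < log_step n"
    "log_step n - log_step (Suc n) \<le> 1 / (real n * (real n + 2))"
    "1 / (real n + 1) ^ 2 \<le> log_step n - log_step (Suc n)"
proof -
  have n: "real n \<ge> 1" using assms by simp
  have up: "ln y \<le> y - 1" if "y > 0" for y :: real using that by (rule ln_le_minus_one)
  have lo: "1 - 1 / y \<le> ln y" if "y > 0" for y :: real
    using ln_le_minus_one[of "1 / y"] that by (simp add: ln_div)
  have p: "real (Suc n) / real n > 0" using n by simp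
  have "1 - 1 / (real (Suc n) / real n) = 1 / (real n + 1)" using n by (simp add: field_simps)
  then show 1: "1 / (real n + 1) \<le> log_step n" using lo[OF p] unfolding log_step_def by linarith
  have "real (Suc n) / real n - 1 = 1 / real n" using n by (simp add: field_simps)
  then show "log_step n \<le> 1 / real n" using up[OF p] unfolding log_step_def by linarith
  have "0 < 1 / (real n + 1)" using n by simp
  then show "0 < log_step n" using 1 by linarith
  \<comment> \<open>The second difference of the logarithm is
    \<open>ln ((n+1)^2 / (n (n+2)))\<close>, where the numerator exceeds the denominator by exactly
    one.\<close>
  define D where "D = real n * (real n + 2)"
  have D: "D > 0" using n by (simp add: D_def)
  have D1: "(real n + 1)\<^sup>2 = D + 1" by (simp add: D_def power2_eq_square algebra_simps)
  have "log_step n - log_step (Suc n) = ln ((real n + 1)\<^sup>2 / D)"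
    using n by (simp add: log_step_def D_def ln_div ln_mult ln_realpow power2_eq_square add_ac)
  then have "log_step n - log_step (Suc n) = ln ((D + 1) / D)" unfolding D1 .
  moreover have "(D + 1) / D - 1 = 1 / D" "1 - 1 / ((D + 1) / D) = 1 / (D + 1)" "(D + 1) / D > 0"
    using D by (simp_all add: field_simps)
  ultimately show "log_step n - log_step (Suc n) \<le> 1 / (real n * (real n + 2))"
    "1 / (real n + 1) ^ 2 \<le> log_step n - log_step (Suc n)"
    using up[of "(D + 1) / D"] lo[of "(D + 1) / D"] unfolding D1 D_def[symmetric] by linarith+
qed

text \<open>\<open>1 / log_step n - n\<close> is bounded and changes by \<open>O(1 / n)\<close> per
  step: the regularity that partial summation demands of its multiplier.\<close>

lemma log_step_reciprocal_bounds:
  assumes "n \<ge> 1"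
  shows "\<bar>1 / log_step n - real n - 1\<bar> \<le> 1"
    "\<bar>(1 / log_step (Suc n) - real (Suc n)) - (1 / log_step n - real n)\<bar> \<le> 1 / real n"
proof -
  note b = log_step_bounds[OF assms]
  have b': "1 / (real n + 2) \<le> log_step (Suc n)" "log_step (Suc n) \<le> 1 / (real n + 1)" "0 < log_step (Suc n)"
    using log_step_bounds(1-3)[of "Suc n"] by (simp_all add: add.commute)
  have n: "real n \<ge> 1" using assms by simp
  have r: "x \<le> 1 / l" "1 / l \<le> y" if "1 / y \<le> l" "l \<le> 1 / x" "0 < l" "0 < x" "0 < y" for l x y :: real
    using that by (simp_all add: field_simps)
  have r1: "real n \<le> 1 / log_step n" "1 / log_step n \<le> real n + 1" using r[OF b(1,2,3)] n by auto
  then show "\<bar>1 / log_step n - real n - 1\<bar> \<le> 1" by linarith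
  have r2: "real n + 1 \<le> 1 / log_step (Suc n)" "1 / log_step (Suc n) \<le> real n + 2" using r[OF b'(1,2,3)] n by auto
  have e: "1 / log_step (Suc n) - 1 / log_step n = (log_step n - log_step (Suc n)) * ((1 / log_step n) * (1 / log_step (Suc n)))"
    using b(3) b'(3) by (simp add: field_simps)
  have nn: "0 \<le> 1 / (real n + 1) ^ 2" by simp
  have "(log_step n - log_step (Suc n)) * ((1 / log_step n) * (1 / log_step (Suc n))) \<le> 1 / (real n * (real n + 2)) * ((real n + 1) * (real n + 2))"
    using b(3) b'(3) r1 r2 n by (intro mult_mono b(4) mult_nonneg_nonneg) auto
  also have "\<dots> = 1 + 1 / real n"
  proof -
    have "real n * (real n + 2) \<noteq> 0" "real n \<noteq> 0" using n by auto
    then show ?thesis by (simp add: divide_simps)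
  qed
  finally have 1: "1 / log_step (Suc n) - 1 / log_step n \<le> 1 + 1 / real n" unfolding e .
  have "0 \<le> log_step n - log_step (Suc n)" using b(5) nn by linarith
  then have "1 / (real n + 1) ^ 2 * (real n * (real n + 1)) \<le> (log_step n - log_step (Suc n)) * ((1 / log_step n) * (1 / log_step (Suc n)))"
    using b(3) b'(3) r1 r2 n by (intro mult_mono b(5) mult_nonneg_nonneg) auto
  moreover have "1 / (real n + 1) ^ 2 * (real n * (real n + 1)) = 1 - 1 / (real n + 1)"
  proof -
    have "real n + 1 \<noteq> 0" using n by auto
    then show ?thesis by (simp add: power2_eq_square divide_simps)
  qed
  ultimately have 2: "1 - 1 / (real n + 1) \<le> 1 / log_step (Suc n) - 1 / log_step n" unfolding e by linarith
  have "1 / (real n + 1) \<le> 1 / real n" using n by (simp add: field_simps)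
  then have "\<bar>(1 / log_step (Suc n) - 1 / log_step n) - 1\<bar> \<le> 1 / real n" using 1 2 by linarith
  then show "\<bar>(1 / log_step (Suc n) - real (Suc n)) - (1 / log_step n - real n)\<bar> \<le> 1 / real n"
    by (simp add: algebra_simps)
qed

lemma powr_telescope_bound:
  assumes "k > 0" "n \<ge> 1"
  shows "k * real (Suc n) powr (- k - 1) \<le> real n powr (- k) - real (Suc n) powr (- k)"
proof -
  have n: "real n \<ge> 1" using assms by simp
  have "\<exists>z>real n. z < real (Suc n) \<and> real (Suc n) powr (- k) - real n powr (- k) = (real (Suc n) - real n) * (- k * z powr (- k - 1))"
    using n by (intro MVT2) (auto intro!: derivative_eq_intros)
  then obtain z where z: "z > real n" "z < real (Suc n)" "real n powr (- k) - real (Suc n) powr (- k) = k * z powr (- k - 1)"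
    by auto
  have "real (Suc n) powr (- k - 1) \<le> z powr (- k - 1)"
    using powr_mono2'[of "- k - 1" z "real (Suc n)"] z n assms by auto
  then show ?thesis unfolding z(3) using assms by (intro mult_left_mono) auto
qed

text \<open>Since \<open>n\<^sup>-\<^sup>w - \<integral>\<^sub>n\<^sup>n\<^sup>+\<^sup>1 x\<^sup>-\<^sup>w dx\<close> is a slowly varying multiple of \<open>n\<^sup>-\<^sup>w - (n+1)\<^sup>-\<^sup>w\<close> as long as
  \<open>\<bar>w\<bar> \<le> n\<close>, partial summation replaces the exponential sum estimates usually used here.\<close>

lemma power_sum_minus_integral:
  assumes k: "k > 0"
  obtains C where "C \<ge> 0" "\<And>w X Y. Re w = k \<Longrightarrow> cmod (w - 1) \<ge> 1 \<Longrightarrow> cmod w \<le> real X \<Longrightarrow> X \<le> Y \<Longrightarrow>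
      cmod ((\<Sum>n=X..<Y. of_nat n powr (- w)) - (of_nat X powr (1 - w) - of_nat Y powr (1 - w)) / (w - 1)) \<le> C * real X powr (- k)"
proof -
  obtain L where L: "L \<ge> 0"
    and L1: "\<And>z. z \<noteq> 0 \<Longrightarrow> cmod z \<le> 1 \<Longrightarrow> cmod (1 / (1 - exp (- z)) - 1 / z) \<le> L"
    and L2: "\<And>y z. y \<noteq> 0 \<Longrightarrow> cmod y \<le> 1 \<Longrightarrow> z \<noteq> 0 \<Longrightarrow> cmod z \<le> 1 \<Longrightarrow>
       cmod ((1 / (1 - exp (- y)) - 1 / y) - (1 / (1 - exp (- z)) - 1 / z)) \<le> L * cmod (y - z)"
    by (rule bernoulli_kernel_bounds, rule that)
  \<comment> \<open>Since \<open>1 <= |w - 1|\<close> and \<open>|w| <= 2 |w - 1|\<close>, the two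
    parts of \<open>lam\<close> below contribute \<open>1\<close> and \<open>2 * L\<close> after
    division by \<open>w - 1\<close>.\<close>
  define K where "K = 1 + 2 * L"
  have K: "K \<ge> 0" using L by (simp add: K_def)
  \<comment> \<open>Two boundary terms give \<open>2 * K\<close>, the weighted variation of
    \<open>lam\<close> gives \<open>2 * K / k\<close>.\<close>
  define C where "C = K * (2 + 2 / k)"
  have main: "cmod ((\<Sum>n=X..<Y. of_nat n powr (- w)) - (of_nat X powr (1 - w) - of_nat Y powr (1 - w)) / (w - 1)) \<le> C * real X powr (- k)"
    if w: "Re w = k" "cmod (w - 1) \<ge> 1" "cmod w \<le> real X" "X \<le> Y" for w X Y
  proof -
    have w0: "w \<noteq> 0" "w - 1 \<noteq> 0" using w k by auto
    have "0 < real X" using w0(1) w(3) zero_less_norm_iff[of w] by linarith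
    then have X: "X \<ge> 1" by simp
    have w2: "cmod w \<le> 2 * cmod (w - 1)"
      using norm_triangle_ineq[of "w - 1" 1] w(2) by simp
    define l where "l = log_step"
    define q where "q n = (of_nat n powr (- w) :: complex)" for n
    define B where "B n = 1 / (1 - exp (- (w * of_real (l n)))) - 1 / (w * of_real (l n))" for n
    \<comment> \<open>Chosen to satisfy \<open>step_eq\<close>: with
      \<open>r = exp (- w l n)\<close> the multiplier must be
      \<open>(w / (1 - r) - n - 1) / (w - 1)\<close>. The polar part of \<open>1 / (1 - r)\<close>
      contributes \<open>1 / l n\<close>, which compensates the growth of \<open>n\<close>.\<close>
    define lam where "lam n = (of_real (1 / l n - real n - 1) + w * B n) / (w - 1)" for n
    have wl: "w * of_real (l n) \<noteq> 0" "cmod (w * of_real (l n)) \<le> 1" if "n \<ge> X" for n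
    proof -
      have n: "n \<ge> 1" using that X by simp
      show "w * of_real (l n) \<noteq> 0" using w0 log_step_bounds(3)[OF n] by (simp add: l_def)
      have "cmod w * l n \<le> real n * (1 / real n)"
        using log_step_bounds(2,3)[OF n] w(3) that unfolding l_def by (intro mult_mono) auto
      then show "cmod (w * of_real (l n)) \<le> 1"
        using n log_step_bounds(3)[OF n] by (simp add: norm_mult l_def)
    qed
    have q: "cmod (q n) = real n powr (- k)" if "n \<ge> 1" for n
      using that w by (simp add: q_def norm_of_nat_powr)
    have step_eq: "q n - (of_nat n powr (1 - w) - of_nat (Suc n) powr (1 - w)) / (w - 1) = lam n * (q n - q (Suc n))" if n: "n \<ge> X" for n
    proof -
      have n1: "n \<ge> 1" using n X by simp
      have lp: "l n \<noteq> 0" using log_step_bounds(3)[OF n1] by (simp add: l_def)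
      define r where "r = exp (- (w * of_real (l n)))"
      have r1: "1 - r \<noteq> 0" using exp_minus_ne_1[of "w * of_real (l n)"] wl[OF n] by (auto simp: r_def)
      have qs: "q (Suc n) = q n * r"
      proof -
        have "Ln (of_nat (Suc n)) = Ln (of_nat n) + of_real (l n)"
          using n1 by (simp add: l_def log_step_def ln_div Ln_of_nat del: of_nat_Suc)
        then show ?thesis using n1 unfolding q_def r_def
          by (simp add: powr_def exp_add[symmetric] algebra_simps del: of_nat_Suc)
      qed
      have p: "of_nat m powr (1 - w) = of_nat m * q m" if "m \<ge> 1" for m
        using that by (simp add: q_def powr_diff powr_minus divide_inverse)
      have lamn: "lam n = (w / (1 - r) - of_nat n - 1) / (w - 1)"
        using lp w0 by (simp add: lam_def B_def r_def[symmetric] ring_distribs)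
      have "lam n * (q n - q (Suc n)) = q n * (w - (of_nat n + 1) * (1 - r)) / (w - 1)"
      proof -
        have "w / (1 - r) - of_nat n - 1 = (w - (of_nat n + 1) * (1 - r)) / (1 - r)"
          using r1 by (simp add: diff_divide_distrib)
        moreover have "q n - q (Suc n) = q n * (1 - r)" unfolding qs by (simp add: right_diff_distrib)
        ultimately show ?thesis using lamn r1 by simp
      qed
      also have "\<dots> = q n - (of_nat n * q n - (of_nat n + 1) * (q n * r)) / (w - 1)"
        using w0 by (simp add: field_simps)
      also have "\<dots> = q n - (of_nat n powr (1 - w) - of_nat (Suc n) powr (1 - w)) / (w - 1)"
        using n1 by (simp only: p[of n] p[of "Suc n"] qs) (simp add: add.commute)
      finally show ?thesis by simp
    qed
    have lam1: "cmod (lam n) \<le> K" if n: "n \<ge> X" for n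
    proof -
      have n1: "n \<ge> 1" using n X by simp
      have "cmod (B n) \<le> L" unfolding B_def by (rule L1[OF wl[OF n]])
      then have "cmod (w * B n) \<le> cmod w * L" by (simp add: norm_mult mult_left_mono)
      moreover have "cmod (of_real (1 / l n - real n - 1)) \<le> 1"
        using log_step_reciprocal_bounds(1)[OF n1] by (simp only: norm_of_real l_def)
      ultimately have "cmod (of_real (1 / l n - real n - 1) + w * B n) \<le> 1 + cmod w * L"
        by (intro order_trans[OF norm_triangle_ineq] add_mono)
      also have "\<dots> \<le> cmod (w - 1) + (2 * cmod (w - 1)) * L" using w w2 L by (intro add_mono mult_right_mono)
      finally show ?thesis using w0 by (simp add: lam_def norm_divide K_def divide_le_eq algebra_simps)
    qed
    \<comment> \<open>\<open>|w| <= n\<close> offsets one factor of the \<open>O(1 / n^2)\<close>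
      change of \<open>l n\<close>, leaving a variation \<open>O(1 / n)\<close> that is uniform in
      \<open>w\<close>.\<close>
    have lam2: "cmod (lam (Suc n) - lam n) \<le> K / real n" if n: "n \<ge> X" for n
    proof -
      have n1: "n \<ge> 1" "real n \<ge> 1" using n X by simp_all
      have ll: "\<bar>l (Suc n) - l n\<bar> \<le> 1 / (real n * (real n + 2))"
      proof -
        have "0 \<le> 1 / (real n + 1) ^ 2" by simp
        then show ?thesis using log_step_bounds(4,5)[OF n1(1)] unfolding l_def by linarith
      qed
      have "cmod (w * of_real (l (Suc n)) - w * of_real (l n)) = cmod w * \<bar>l (Suc n) - l n\<bar>"
        by (metis norm_mult norm_of_real of_real_diff right_diff_distrib)
      also have "\<dots> \<le> real n * (1 / (real n * (real n + 2)))"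
        using ll w(3) n by (intro mult_mono) auto
      also have "\<dots> = 1 / (real n + 2)" using n1 by simp
      also have "\<dots> \<le> 1 / real n" using n1 by (intro divide_left_mono) auto
      finally have d: "cmod (w * of_real (l (Suc n)) - w * of_real (l n)) \<le> 1 / real n" .
      have "cmod (B (Suc n) - B n) \<le> L * cmod (w * of_real (l (Suc n)) - w * of_real (l n))"
        unfolding B_def using wl[of n] wl[of "Suc n"] n by (intro L2) auto
      also have "\<dots> \<le> L * (1 / real n)" using d L by (intro mult_left_mono)
      finally have dB: "cmod (B (Suc n) - B n) \<le> L * (1 / real n)" .
      have dl: "\<bar>(1 / l (Suc n) - real (Suc n)) - (1 / l n - real n)\<bar> \<le> 1 / real n"
        using log_step_reciprocal_bounds(2)[OF n1(1)] by (simp only: l_def)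
      have "lam (Suc n) - lam n = (of_real ((1 / l (Suc n) - real (Suc n)) - (1 / l n - real n)) + w * (B (Suc n) - B n)) / (w - 1)"
        by (simp add: lam_def diff_divide_distrib add_divide_distrib ring_distribs)
      also have "cmod \<dots> \<le> (1 / real n + cmod w * (L * (1 / real n))) / cmod (w - 1)"
      proof -
        have "cmod (w * (B (Suc n) - B n)) \<le> cmod w * (L * (1 / real n))"
          unfolding norm_mult using dB by (intro mult_left_mono) auto
        moreover have "cmod (of_real ((1 / l (Suc n) - real (Suc n)) - (1 / l n - real n))) \<le> 1 / real n"
          using dl by (simp only: norm_of_real)
        ultimately show ?thesis unfolding norm_divide
          by (intro divide_right_mono order_trans[OF norm_triangle_ineq] add_mono) auto
      qed
      also have "\<dots> \<le> (cmod (w - 1) * (1 / real n) + (2 * cmod (w - 1)) * (L * (1 / real n))) / cmod (w - 1)"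
      proof -
        have "1 * (1 / real n) \<le> cmod (w - 1) * (1 / real n)" using w(2) by (intro mult_right_mono) auto
        moreover have "cmod w * (L * (1 / real n)) \<le> (2 * cmod (w - 1)) * (L * (1 / real n))"
          using w2 L by (intro mult_right_mono) auto
        ultimately show ?thesis by (intro divide_right_mono) auto
      qed
      also have "\<dots> = K / real n" using w0 n1 by (simp add: K_def field_simps)
      finally show ?thesis .
    qed
    \<comment> \<open>Abel summation of \<open>step_eq\<close>.\<close>
    have eq: "(\<Sum>n=X..<Y. q n) - (of_nat X powr (1 - w) - of_nat Y powr (1 - w)) / (w - 1)
       = lam X * q X - lam Y * q Y + (\<Sum>n=X..<Y. (lam (Suc n) - lam n) * q (Suc n))"
      using w(4)
    proof (induction Y rule: dec_induct)
      case (step n)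
      have "(\<Sum>m=X..<Suc n. q m) - (of_nat X powr (1 - w) - of_nat (Suc n) powr (1 - w)) / (w - 1)
        = ((\<Sum>m=X..<n. q m) - (of_nat X powr (1 - w) - of_nat n powr (1 - w)) / (w - 1)) + (q n - (of_nat n powr (1 - w) - of_nat (Suc n) powr (1 - w)) / (w - 1))"
        using step(1) by (simp add: diff_divide_distrib del: of_nat_Suc)
      also have "\<dots> = lam X * q X - lam n * q n + (\<Sum>n=X..<n. (lam (Suc n) - lam n) * q (Suc n)) + lam n * (q n - q (Suc n))"
        using step(3) step_eq[OF step(1)] by simp
      also have "\<dots> = lam X * q X - lam (Suc n) * q (Suc n) + (\<Sum>n=X..<Suc n. (lam (Suc n) - lam n) * q (Suc n))"
        using step(1) by (simp add: algebra_simps)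
      finally show ?case .
    qed simp
    have tele: "(\<Sum>n=X..<Y. cmod ((lam (Suc n) - lam n) * q (Suc n))) \<le> K * (2 / k) * (real X powr (- k) - real Y powr (- k))"
      using w(4)
    proof (induction Y rule: dec_induct)
      case (step n)
      have n1: "n \<ge> 1" using step X by simp
      have "cmod ((lam (Suc n) - lam n) * q (Suc n)) \<le> K / real n * real (Suc n) powr (- k)"
        unfolding norm_mult using lam2[OF step(1)] q[of "Suc n"] K by (intro mult_mono) auto
      also have "\<dots> \<le> K * 2 * real (Suc n) powr (- k - 1)"
      proof -
        have "real (Suc n) powr (- k - 1) = real (Suc n) powr (- k) / real (Suc n)" by (simp add: powr_diff)
        moreover have "1 / real n \<le> 2 / real (Suc n)" using n1 by (simp add: field_simps)
        then have "K * real (Suc n) powr (- k) * (1 / real n) \<le> K * real (Suc n) powr (- k) * (2 / real (Suc n))"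
          using K by (intro mult_left_mono) auto
        ultimately show ?thesis by (simp add: mult_ac)
      qed
      also have "\<dots> = K * (2 / k) * (k * real (Suc n) powr (- k - 1))" using k by simp
      also have "\<dots> \<le> K * (2 / k) * (real n powr (- k) - real (Suc n) powr (- k))"
        using K k by (intro mult_left_mono powr_telescope_bound n1) auto
      finally have "cmod ((lam (Suc n) - lam n) * q (Suc n)) \<le> \<dots>" .
      then show ?case using step by (simp add: algebra_simps del: of_nat_Suc)
    qed simp
    have YX: "real Y powr (- k) \<le> real X powr (- k)" using w X k by (intro powr_mono2') auto
    have a: "cmod (lam X * q X) \<le> K * real X powr (- k)"
      using lam1[of X] q[OF X] by (simp add: norm_mult mult_right_mono)
    have b: "cmod (lam Y * q Y) \<le> K * real Y powr (- k)"
      using lam1[of Y] q[of Y] X w(4) by (simp add: norm_mult mult_right_mono)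
    also have "\<dots> \<le> K * real X powr (- k)" using YX K by (intro mult_left_mono)
    finally have b: "cmod (lam Y * q Y) \<le> K * real X powr (- k)" .
    have c: "cmod (\<Sum>n=X..<Y. (lam (Suc n) - lam n) * q (Suc n)) \<le> K * (2 / k) * real X powr (- k)"
    proof -
      have "cmod (\<Sum>n=X..<Y. (lam (Suc n) - lam n) * q (Suc n)) \<le> K * (2 / k) * (real X powr (- k) - real Y powr (- k))"
        using norm_sum tele by (rule order_trans)
      also have "\<dots> \<le> K * (2 / k) * real X powr (- k)" using K k by (intro mult_left_mono) auto
      finally show ?thesis .
    qed
    have "cmod (lam X * q X - lam Y * q Y + (\<Sum>n=X..<Y. (lam (Suc n) - lam n) * q (Suc n))) \<le> K * real X powr (- k) + K * real X powr (- k) + K * (2 / k) * real X powr (- k)"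
      by (intro order_trans[OF norm_triangle_ineq] add_mono order_trans[OF norm_triangle_ineq4] a b c)
    also have "\<dots> = C * real X powr (- k)" by (simp add: C_def algebra_simps)
    finally show ?thesis using eq unfolding q_def by simp
  qed
  show ?thesis
  proof (rule that[of C])
    show "C \<ge> 0" using K k by (simp add: C_def)
  qed (use main in blast)
qed

text \<open>Let \<open>Y\<close> tend to infinity in \<open>power_sum_minus_integral\<close>: by
  \<open>zeta_eta_bound\<close>, the sum up to \<open>Y\<close> plus
  \<open>Y^(1-w) / (w - 1)\<close> tends to \<open>zeta w\<close> for every
  \<open>Re w > 0\<close>.\<close>

theorem Hardy_Littlewood_approximation:
  assumes k: "k > 0"
  obtains C where "C \<ge> 0" "\<And>w X. Re w = k \<Longrightarrow> cmod (w - 1) \<ge> 1 \<Longrightarrow> cmod w \<le> real X \<Longrightarrow>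
      cmod (zeta_tail w X - of_nat X powr (1 - w) / (w - 1)) \<le> C * real X powr (- k)"
proof -
  obtain C where C: "C \<ge> 0" "\<And>w X Y. Re w = k \<Longrightarrow> cmod (w - 1) \<ge> 1 \<Longrightarrow> cmod w \<le> real X \<Longrightarrow> X \<le> Y \<Longrightarrow>
      cmod ((\<Sum>n=X..<Y. of_nat n powr (- w)) - (of_nat X powr (1 - w) - of_nat Y powr (1 - w)) / (w - 1)) \<le> C * real X powr (- k)"
    by (rule power_sum_minus_integral[OF k], rule that)
  \<comment> \<open>The sums over \<open>X..<Y\<close> include \<open>n = X\<close>, which
    \<open>zeta_tail\<close> omits; that single term accounts for the \<open>+ 1\<close>.\<close>
  have "cmod (zeta_tail w X - of_nat X powr (1 - w) / (w - 1)) \<le> (C + 1) * real X powr (- k)"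
    if w: "Re w = k" "cmod (w - 1) \<ge> 1" "cmod w \<le> real X" for w X
  proof -
    have w1: "w \<noteq> 1" "w \<noteq> 0" using w k by auto
    have "0 < real X" using w1(2) w(3) zero_less_norm_iff[of w] by linarith
    then have X: "X \<ge> 1" by simp
    \<comment> \<open>\<open>D\<close> depends on \<open>w\<close> but serves only to identify the
      limit, so the final constant stays uniform in \<open>w\<close>.\<close>
    obtain D where D: "\<And>m. m \<ge> 1 \<Longrightarrow> cmod (zeta_eta w m) \<le> D * real m powr (- Re w)"
      using zeta_eta_bound[OF w1(1)] by blast
    have eta0: "(\<lambda>Y. zeta_eta w Y) \<longlonglongrightarrow> 0"
    proof (rule Lim_null_comparison)
      show "\<forall>\<^sub>F Y in sequentially. cmod (zeta_eta w Y) \<le> D * real Y powr (- Re w)"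
        using eventually_ge_at_top[of 1] by eventually_elim (rule D)
      show "(\<lambda>Y. D * real Y powr (- Re w)) \<longlonglongrightarrow> 0"
        using w k tendsto_mult_right_zero[OF tendsto_neg_powr[OF _ filterlim_real_sequentially], of "- Re w" D] by simp
    qed
    have q0: "(\<lambda>Y. of_nat Y powr (- w) :: complex) \<longlonglongrightarrow> 0"
      by (rule tendsto_of_nat_powr_0) (use w k in simp)
    let ?E = "zeta_tail w X - of_nat X powr (1 - w) / (w - 1)"
    have e: "(\<Sum>n=X..<Y. of_nat n powr (- w)) - (of_nat X powr (1 - w) - of_nat Y powr (1 - w)) / (w - 1)
       = ?E + of_nat X powr (- w) - of_nat Y powr (- w) - zeta_eta w Y" if "Y \<ge> X" for Y
    proof -
      have "(\<Sum>n=1..Y. of_nat n powr (- w)) + of_nat X powr (- w) = (\<Sum>n=1..X. of_nat n powr (- w)) + (\<Sum>n=X..<Y. of_nat n powr (- w)) + (of_nat Y powr (- w) :: complex)"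
        using that
      proof (induction Y rule: dec_induct)
        case (step n)
        then show ?case by (simp add: add_ac)
      qed simp
      then show ?thesis by (simp add: zeta_eta_def zeta_tail_def diff_divide_distrib algebra_simps)
    qed
    have "(\<lambda>Y. cmod (?E + of_nat X powr (- w) - of_nat Y powr (- w) - zeta_eta w Y)) \<longlonglongrightarrow> cmod (?E + of_nat X powr (- w) - 0 - 0)"
      by (intro tendsto_intros q0 eta0)
    then have "cmod (?E + of_nat X powr (- w) - 0 - 0) \<le> C * real X powr (- k)"
    proof (rule LIMSEQ_le_const2, intro exI[of _ X] allI impI)
      fix Y assume "Y \<ge> X"
      then show "cmod (?E + of_nat X powr (- w) - of_nat Y powr (- w) - zeta_eta w Y) \<le> C * real X powr (- k)"
        using C(2)[OF w, of Y] e[of Y] by simp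
    qed
    then have "cmod (?E + of_nat X powr (- w)) \<le> C * real X powr (- k)" by simp
    moreover have "cmod (of_nat X powr (- w)) = real X powr (- k)" using X w by (simp add: norm_of_nat_powr)
    moreover have "cmod ?E \<le> cmod (?E + of_nat X powr (- w)) + cmod (of_nat X powr (- w))"
      using norm_triangle_ineq4[of "?E + of_nat X powr (- w)" "of_nat X powr (- w)"] by simp
    ultimately show ?thesis by (simp add: distrib_right)
  qed
  then show ?thesis using that[of "C + 1"] C(1) by auto
qed

section \<open>Approximation of the double zeta-function on a vertical line\<close>

lemma powr_tail_sum:
  assumes k: "k > 0" and X: "X \<ge> 1"
  shows "summable (\<lambda>m. real (X + Suc m) powr (- k - 1))"
    "(\<Sum>m. real (X + Suc m) powr (- k - 1)) \<le> real X powr (- k) / k"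
proof -
  have partial: "(\<Sum>m<n. real (X + Suc m) powr (- k - 1)) \<le> (real X powr (- k) - real (X + n) powr (- k)) / k" for n
  proof (induction n)
    case (Suc n)
    have "k * real (Suc (X + n)) powr (- k - 1) \<le> real (X + n) powr (- k) - real (Suc (X + n)) powr (- k)"
      using X by (intro powr_telescope_bound k) simp
    then have "real (X + Suc n) powr (- k - 1) \<le> (real (X + n) powr (- k) - real (X + Suc n) powr (- k)) / k"
      using k by (simp add: pos_le_divide_eq mult.commute)
    then show ?case using Suc by (simp add: diff_divide_distrib)
  qed simp
  have le: "(\<Sum>m<n. real (X + Suc m) powr (- k - 1)) \<le> real X powr (- k) / k" for n
  proof -
    have "(real X powr (- k) - real (X + n) powr (- k)) / k \<le> real X powr (- k) / k"
      using k by (intro divide_right_mono) auto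
    then show ?thesis using partial[of n] by linarith
  qed
  show s: "summable (\<lambda>m. real (X + Suc m) powr (- k - 1))"
    by (rule summableI_nonneg_bounded[OF _ le]) simp
  show "(\<Sum>m. real (X + Suc m) powr (- k - 1)) \<le> real X powr (- k) / k"
    by (rule suminf_le_const[OF s le])
qed

lemma sum_powr_le:
  assumes b: "0 \<le> b" "b < 1" and X: "X \<ge> 1"
  shows "(\<Sum>m=1..X. real m powr (- b)) \<le> real X powr (1 - b) / (1 - b)"
  using X
proof (induction X rule: dec_induct)
  case (step X)
  have "\<exists>z>real X. z < real (Suc X) \<and> real (Suc X) powr (1 - b) - real X powr (1 - b) = (real (Suc X) - real X) * ((1 - b) * z powr (1 - b - 1))"
    using step by (intro MVT2) (auto intro!: derivative_eq_intros)
  then obtain z where z: "z > real X" "z < real (Suc X)" "real (Suc X) powr (1 - b) - real X powr (1 - b) = (1 - b) * z powr (- b)"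
    by auto
  have "real (Suc X) powr (- b) \<le> z powr (- b)" using z b step by (intro powr_mono2') auto
  then have "(1 - b) * real (Suc X) powr (- b) \<le> (1 - b) * z powr (- b)" using b by (intro mult_left_mono) auto
  then have "(1 - b) * real (Suc X) powr (- b) \<le> real (Suc X) powr (1 - b) - real X powr (1 - b)" unfolding z(3) .
  then have "real (Suc X) powr (- b) \<le> (real (Suc X) powr (1 - b) - real X powr (1 - b)) / (1 - b)"
    using b by (simp add: pos_le_divide_eq mult.commute)
  then show ?case using step by (simp add: diff_divide_distrib del: of_nat_Suc)
qed (use b in simp)

lemma harmonic_bounds:
  assumes "X \<ge> 1"
  shows "ln (real X) \<le> (\<Sum>m=1..X. 1 / real m)" "(\<Sum>m=1..X. 1 / real m) \<le> 1 + ln (real X)"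
proof -
  \<comment> \<open>The additional \<open>1 / X\<close> strengthens the induction so that
    \<open>log_step X <= 1 / X\<close> is all the step needs.\<close>
  have "ln (real X) + 1 / real X \<le> (\<Sum>m=1..X. 1 / real m)"
    using assms
  proof (induction X rule: dec_induct)
    case (step X)
    have "ln (real (Suc X)) = ln (real X) + log_step X" using step by (simp add: log_step_def ln_div)
    also have "\<dots> \<le> ln (real X) + 1 / real X" using log_step_bounds(2)[of X] step by simp
    finally show ?case using step by simp
  qed simp
  moreover have "0 \<le> 1 / real X" by simp
  ultimately show "ln (real X) \<le> (\<Sum>m=1..X. 1 / real m)" by linarith
  show "(\<Sum>m=1..X. 1 / real m) \<le> 1 + ln (real X)" using assms
  proof (induction X rule: dec_induct)
    case (step X)
    have "ln (real (Suc X)) = ln (real X) + log_step X" using step by (simp add: log_step_def ln_div)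
    moreover have "1 / (real X + 1) \<le> log_step X" using log_step_bounds(1)[of X] step by simp
    ultimately show ?case using step by (simp add: add.commute)
  qed simp
qed

lemma integral_diff_le:
  fixes f g h :: "real \<Rightarrow> real"
  assumes "continuous_on {a..b} f" "continuous_on {a..b} g" "continuous_on {a..b} h"
    and "\<And>t. t \<in> {a..b} \<Longrightarrow> \<bar>f t - g t\<bar> \<le> h t"
  shows "\<bar>integral {a..b} f - integral {a..b} g\<bar> \<le> integral {a..b} h"
proof -
  have i: "f integrable_on {a..b}" "g integrable_on {a..b}" "h integrable_on {a..b}"
    using assms by (auto intro: integrable_continuous_real)
  have "norm (integral {a..b} (\<lambda>t. f t - g t)) \<le> integral {a..b} h"
    by (rule integral_norm_bound_integral) (use assms i in \<open>auto intro: integrable_diff\<close>)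
  then show ?thesis using i by (simp add: integral_diff)
qed

text \<open>Halving \<open>T\<close> until it enters \<open>[2, 2 * U]\<close> produces a geometric
  series, convergent because \<open>\<alpha> > 0\<close>; the last block dominates and no logarithm
  appears.\<close>

lemma doubling_bound:
  fixes g :: "real \<Rightarrow> real"
  assumes \<alpha>: "\<alpha> > 0" and U: "U \<ge> 2" and C: "C \<ge> 0"
    and base: "\<And>T. 2 \<le> T \<Longrightarrow> T \<le> 2 * U \<Longrightarrow> \<bar>g T\<bar> \<le> B"
    and step: "\<And>T. U \<le> T \<Longrightarrow> \<bar>g (2 * T) - g T\<bar> \<le> C * T powr \<alpha>"
  shows "\<exists>K. \<forall>T\<ge>2. \<bar>g T\<bar> \<le> K * T powr \<alpha>"
proof -
  have a1: "2 powr \<alpha> > 1" using \<alpha> by simp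
  \<comment> \<open>\<open>C / (2 powr \<alpha> - 1)\<close> solves
    \<open>K + C = K * 2 powr \<alpha>\<close>, the invariance behind the induction step;
    \<open>B\<close> covers the initial range.\<close>
  define K where "K = B + C / (2 powr \<alpha> - 1)"
  have "B \<ge> 0" using order_trans[OF abs_ge_zero base[of 2]] U by simp
  then have K: "K \<ge> B" "K \<ge> 0" using C a1 by (auto simp: K_def)
  have K2: "K + C \<le> K * 2 powr \<alpha>"
  proof -
    have "C = C / (2 powr \<alpha> - 1) * (2 powr \<alpha> - 1)" using \<alpha> by simp
    also have "\<dots> \<le> K * (2 powr \<alpha> - 1)" using a1 \<open>B \<ge> 0\<close> by (intro mult_right_mono) (auto simp: K_def)
    finally show ?thesis by (simp add: algebra_simps)
  qed
  have main: "\<bar>g T\<bar> \<le> K * T powr \<alpha>" if "2 \<le> T" "T \<le> 2 ^ n * (2 * U)" for n T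
    using that
  proof (induction n arbitrary: T)
    case 0
    have "\<bar>g T\<bar> \<le> B" using 0 by (intro base) auto
    also have "B \<le> K * 1" using K by simp
    also have "\<dots> \<le> K * T powr \<alpha>" using 0 \<alpha> K by (intro mult_left_mono) (auto simp: ge_one_powr_ge_zero)
    finally show ?case .
  next
    case (Suc n)
    show ?case
    proof (cases "T \<le> 2 * U")
      case True
      have "\<bar>g T\<bar> \<le> B" using Suc True by (intro base) auto
      also have "B \<le> K * 1" using K by simp
      also have "\<dots> \<le> K * T powr \<alpha>" using Suc \<alpha> K by (intro mult_left_mono) (auto simp: ge_one_powr_ge_zero)
      finally show ?thesis .
    next
      case False
      have "\<bar>g T\<bar> \<le> \<bar>g (T / 2)\<bar> + C * (T / 2) powr \<alpha>"
        using step[of "T / 2"] False by simp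
      also have "\<bar>g (T / 2)\<bar> \<le> K * (T / 2) powr \<alpha>"
        using Suc.prems False U by (intro Suc.IH) auto
      also have "K * (T / 2) powr \<alpha> + C * (T / 2) powr \<alpha> = (K + C) * (T / 2) powr \<alpha>" by (simp add: distrib_right)
      also have "\<dots> \<le> (K * 2 powr \<alpha>) * (T / 2) powr \<alpha>" using K2 by (intro mult_right_mono) auto
      also have "\<dots> = K * T powr \<alpha>" using Suc.prems by (simp add: powr_mult[symmetric])
      finally show ?thesis by simp
    qed
  qed
  have "\<bar>g T\<bar> \<le> K * T powr \<alpha>" if T: "T \<ge> 2" for T
  proof -
    obtain n where "T < 2 ^ n" using real_arch_pow[of 2 T] by auto
    also have "(2::real) ^ n * 1 \<le> 2 ^ n * (2 * U)" using U by (intro mult_left_mono) auto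
    finally show ?thesis using main[of T n] T by simp
  qed
  then show ?thesis by blast
qed

section \<open>Coefficients and truncation on a vertical line\<close>

locale dz_line =
  fixes \<sigma>1 :: real and s2 :: complex
  assumes ne1: "s2 \<noteq> 1"
    and avoid: "\<And>t. t \<ge> 2 \<Longrightarrow> (Complex \<sigma>1 t, s2) \<notin> double_zeta_singularities"
begin

definition r :: real where "r = \<sigma>1 + Re s2"

definition coeff :: "nat \<Rightarrow> complex" where
  "coeff m = of_nat m powr (- of_real \<sigma>1) * zeta_tail s2 m"

definition S :: "nat \<Rightarrow> real \<Rightarrow> complex" where
  "S X t = (\<Sum>m=1..X. coeff m * of_nat m powr (- (\<i> * of_real t)))"

abbreviation F :: "real \<Rightarrow> complex" where "F t \<equiv> double_zeta (Complex \<sigma>1 t, s2)"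

definition D :: "nat \<Rightarrow> real" where "D X = (\<Sum>m=1..X. (cmod (coeff m))\<^sup>2)"
text \<open>\<open>W\<close> and \<open>P\<close> are the two ingredients of the mean value error,
  from Hilbert's inequality and from the bounded kernel difference respectively.\<close>

definition W :: "nat \<Rightarrow> real" where "W X = (\<Sum>m=1..X. real m * (cmod (coeff m))\<^sup>2)"
definition P :: "nat \<Rightarrow> real" where "P X = (\<Sum>m=1..X. cmod (coeff m))"

lemma zeta_sq_term_eq:
  assumes "m \<ge> 1"
  shows "zeta_sq_term (2 * \<sigma>1) s2 m = (cmod (coeff m))\<^sup>2"
proof -
  have "(cmod (of_nat m powr (- of_real \<sigma>1)))\<^sup>2 = 1 / real m powr (2 * \<sigma>1)"
  proof -
    have "cmod (of_nat m powr (- of_real \<sigma>1)) = real m powr (- \<sigma>1)"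
      using norm_of_nat_powr[OF assms, of "- of_real \<sigma>1"] by simp
    then have "(cmod (of_nat m powr (- of_real \<sigma>1)))\<^sup>2 = real m powr (- (2 * \<sigma>1))"
      by (simp add: power2_eq_square powr_add[symmetric])
    then show ?thesis by (simp add: powr_minus_divide)
  qed
  moreover have "zeta s2 - (\<Sum>n=1..m. 1 / of_nat n powr s2) = zeta_tail s2 m"
    by (simp add: zeta_tail_def powr_minus_divide)
  ultimately show ?thesis
    by (simp only: zeta_sq_term_def coeff_def norm_mult power_mult_distrib)
qed

lemma mean_value_S:
  "T1 \<le> T2 \<Longrightarrow> \<bar>integral {T1..T2} (\<lambda>t. (cmod (S X t))\<^sup>2) - (T2 - T1) * D X\<bar> \<le> 2 * (pi * W X + (P X)\<^sup>2)"
  unfolding S_def D_def W_def P_def by (intro mean_value_Dirichlet_polynomial) auto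

text \<open>The size estimate serves all ranges of \<open>r\<close>. The second estimate isolates
  the leading term of the square, from which the constant at \<open>r = 3/2\<close> arises.\<close>

lemma coeff_bound:
  obtains A where "A \<ge> 0" "\<And>m. m \<ge> 1 \<Longrightarrow> cmod (coeff m) \<le> A * real m powr (1 - r)"
    "\<And>m. m \<ge> 1 \<Longrightarrow> \<bar>(cmod (coeff m))\<^sup>2 - real m powr (2 - 2 * r) / (cmod (s2 - 1))\<^sup>2\<bar> \<le> A * real m powr (1 - 2 * r)"
proof -
  obtain C where C: "C \<ge> 0" "\<And>m. m \<ge> 1 \<Longrightarrow> cmod (zeta_eta s2 m) \<le> C * real m powr (- Re s2)"
    using zeta_eta_bound[OF ne1] by metis
  define c where "c = 1 / cmod (s2 - 1)"
  have c: "c > 0" using ne1 by (simp add: c_def)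
  define A where "A = (c + C) + C * (2 * c + C)"
  have A: "c + C \<le> A" "C * (2 * c + C) \<le> A" "A \<ge> 0" using c C by (auto simp: A_def)
  have split: "cmod (coeff m) \<le> c * real m powr (1 - r) + C * real m powr (- r) \<and>
      \<bar>cmod (coeff m) - c * real m powr (1 - r)\<bar> \<le> C * real m powr (- r)" if m: "m \<ge> 1" for m
  proof -
    define p where "p = of_nat m powr (- of_real \<sigma>1) * (of_nat m powr (1 - s2) / (s2 - 1))"
    define e where "e = of_nat m powr (- of_real \<sigma>1) * zeta_eta s2 m"
    have "coeff m = p + e" by (simp add: coeff_def p_def e_def zeta_eta_def algebra_simps)
    have "cmod p = c * (real m powr (- \<sigma>1) * real m powr (1 - Re s2))"
      using m by (simp add: p_def norm_mult norm_divide norm_of_nat_powr c_def)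
    then have p: "cmod p = c * real m powr (1 - r)"
      unfolding powr_add[symmetric] by (simp add: r_def algebra_simps)
    have "cmod e \<le> real m powr (- \<sigma>1) * (C * real m powr (- Re s2))"
      unfolding e_def norm_mult using m C by (intro mult_mono) (auto simp: norm_of_nat_powr)
    also have "\<dots> = C * (real m powr (- \<sigma>1) * real m powr (- Re s2))" by simp
    also have "\<dots> = C * real m powr (- r)" unfolding powr_add[symmetric] by (simp add: r_def)
    finally have e: "cmod e \<le> C * real m powr (- r)" .
    have "\<bar>cmod (coeff m) - cmod p\<bar> \<le> cmod e"
      using norm_triangle_ineq3[of "coeff m" p] \<open>coeff m = p + e\<close> by simp
    then show ?thesis using e p by linarith
  qed
  have le: "real m powr (- r) \<le> real m powr (1 - r)" if "m \<ge> 1" for m using that by (intro powr_mono) auto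
  show ?thesis
  proof (rule that[of A])
    fix m :: nat assume m: "m \<ge> 1"
    have "cmod (coeff m) \<le> c * real m powr (1 - r) + C * real m powr (- r)" using split[OF m] by blast
    also have "\<dots> \<le> c * real m powr (1 - r) + C * real m powr (1 - r)"
      using le[OF m] C c by (intro add_mono mult_left_mono) auto
    finally have 1: "cmod (coeff m) \<le> (c + C) * real m powr (1 - r)" by (simp add: distrib_right)
    also have "\<dots> \<le> A * real m powr (1 - r)" using A by (intro mult_right_mono) auto
    finally show "cmod (coeff m) \<le> A * real m powr (1 - r)" .
    define x where "x = c * real m powr (1 - r)"
    have "(cmod (coeff m))\<^sup>2 - x\<^sup>2 = (cmod (coeff m) - x) * (cmod (coeff m) + x)"
      by (simp add: power2_eq_square algebra_simps)
    then have "\<bar>(cmod (coeff m))\<^sup>2 - x\<^sup>2\<bar> = \<bar>cmod (coeff m) - x\<bar> * (cmod (coeff m) + x)"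
      using c by (simp add: abs_mult x_def)
    also have "\<dots> \<le> (C * real m powr (- r)) * ((c + C) * real m powr (1 - r) + c * real m powr (1 - r))"
      using split[OF m] 1 C c by (intro mult_mono add_mono) (auto simp: x_def)
    also have "\<dots> = C * (2 * c + C) * (real m powr (- r) * real m powr (1 - r))" by (simp add: algebra_simps)
    also have "real m powr (- r) * real m powr (1 - r) = real m powr (1 - 2 * r)"
      unfolding powr_add[symmetric] by simp
    also have "C * (2 * c + C) * real m powr (1 - 2 * r) \<le> A * real m powr (1 - 2 * r)"
      using A by (intro mult_right_mono) auto
    finally have "\<bar>(cmod (coeff m))\<^sup>2 - x\<^sup>2\<bar> \<le> A * real m powr (1 - 2 * r)" .
    moreover have "x\<^sup>2 = real m powr (2 - 2 * r) / (cmod (s2 - 1))\<^sup>2"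
      by (simp add: x_def c_def power_mult_distrib power_divide power2_eq_square[of "_ powr _"] powr_add[symmetric])
    ultimately show "\<bar>(cmod (coeff m))\<^sup>2 - real m powr (2 - 2 * r) / (cmod (s2 - 1))\<^sup>2\<bar> \<le> A * real m powr (1 - 2 * r)"
      by simp
  qed (use A in auto)
qed

text \<open>Removing the first \<open>X\<close> terms of \<open>double_zeta_sums\<close> also
  removes their leading powers; added back, these turn \<open>zeta (s1 + s2 - 1)\<close> into its
  own tail after \<open>X\<close>.\<close>

lemma F_minus_S_sums:
  assumes r: "r > 1" and t: "(Complex \<sigma>1 t, s2) \<notin> double_zeta_singularities"
  shows "(\<lambda>m. of_nat (X + Suc m) powr (- Complex \<sigma>1 t) * zeta_eta s2 (X + Suc m)) sums
     (F t - S X t - zeta_tail (Complex \<sigma>1 t + s2 - 1) X / (s2 - 1))"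
proof -
  let ?s = "Complex \<sigma>1 t" and ?w = "Complex \<sigma>1 t + s2 - 1"
  have "(\<lambda>m. of_nat (Suc m) powr (- ?s) * zeta_eta s2 (Suc m)) sums (F t - zeta ?w / (s2 - 1))"
    using r by (intro double_zeta_sums t) (simp add: r_def)
  from sums_split_initial_segment[OF this, of X]
  have "(\<lambda>m. of_nat (X + Suc m) powr (- ?s) * zeta_eta s2 (X + Suc m)) sums
     (F t - zeta ?w / (s2 - 1) - (\<Sum>m<X. of_nat (Suc m) powr (- ?s) * zeta_eta s2 (Suc m)))"
    by (simp only: add_Suc_right add.commute[of _ X])
  moreover have "(\<Sum>m<X. of_nat (Suc m) powr (- ?s) * zeta_eta s2 (Suc m)) = S X t - (\<Sum>m=1..X. of_nat m powr (- ?w)) / (s2 - 1)"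
  proof -
    have "(\<Sum>m<X. of_nat (Suc m) powr (- ?s) * zeta_eta s2 (Suc m)) = (\<Sum>m=1..X. of_nat m powr (- ?s) * zeta_eta s2 m)"
      by (simp add: sum.atLeast1_atMost_eq)
    also have "\<dots> = (\<Sum>m=1..X. coeff m * of_nat m powr (- (\<i> * of_real t)) - of_nat m powr (- ?w) / (s2 - 1))"
    proof (rule sum.cong[OF refl])
      fix m
      have "of_nat m powr (- ?s) = of_nat m powr (- of_real \<sigma>1) * (of_nat m powr (- (\<i> * of_real t)) :: complex)"
        unfolding powr_add[symmetric] by (simp add: Complex_eq)
      moreover have "of_nat m powr (- ?s) * of_nat m powr (1 - s2) = (of_nat m powr (- ?w) :: complex)"
        unfolding powr_add[symmetric] by (simp add: algebra_simps)
      ultimately show "of_nat m powr (- ?s) * zeta_eta s2 m = coeff m * of_nat m powr (- (\<i> * of_real t)) - of_nat m powr (- ?w) / (s2 - 1)"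
        unfolding zeta_eta_def coeff_def right_diff_distrib times_divide_eq_right by (simp add: mult_ac)
    qed
    also have "\<dots> = S X t - (\<Sum>m=1..X. of_nat m powr (- ?w)) / (s2 - 1)"
      by (simp add: S_def sum_subtractf sum_divide_distrib)
    finally show ?thesis .
  qed
  moreover have "F t - zeta ?w / (s2 - 1) - (S X t - (\<Sum>m=1..X. of_nat m powr (- ?w)) / (s2 - 1))
     = F t - S X t - zeta_tail ?w X / (s2 - 1)"
    by (simp add: zeta_tail_def diff_divide_distrib)
  ultimately show ?thesis by (simp only:)
qed

lemma F_minus_S_bound:
  assumes r: "r > 1"
  obtains C where "C \<ge> 0" "\<And>t X. X \<ge> 1 \<Longrightarrow> (Complex \<sigma>1 t, s2) \<notin> double_zeta_singularities \<Longrightarrow>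
     cmod (F t - S X t - zeta_tail (Complex \<sigma>1 t + s2 - 1) X / (s2 - 1)) \<le> C * real X powr (1 - r)"
proof -
  obtain C where C: "C \<ge> 0" "\<And>m. m \<ge> 1 \<Longrightarrow> cmod (zeta_eta s2 m) \<le> C * real m powr (- Re s2)"
    using zeta_eta_bound[OF ne1] by metis
  show ?thesis
  proof (rule that[of "C / (r - 1)"])
    show "C / (r - 1) \<ge> 0" using C r by simp
    fix t X assume X: "(X::nat) \<ge> 1" and t: "(Complex \<sigma>1 t, s2) \<notin> double_zeta_singularities"
    have le: "cmod (of_nat (X + Suc m) powr (- Complex \<sigma>1 t) * zeta_eta s2 (X + Suc m)) \<le> C * real (X + Suc m) powr (- (r - 1) - 1)" for m
    proof -
      have "cmod (of_nat (X + Suc m) powr (- Complex \<sigma>1 t) * zeta_eta s2 (X + Suc m)) \<le> real (X + Suc m) powr (- \<sigma>1) * (C * real (X + Suc m) powr (- Re s2))"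
        unfolding norm_mult using C by (intro mult_mono) (auto simp: norm_of_nat_powr simp del: of_nat_Suc of_nat_add)
      also have "\<dots> = C * (real (X + Suc m) powr (- \<sigma>1) * real (X + Suc m) powr (- Re s2))" by simp
      also have "\<dots> = C * real (X + Suc m) powr (- (r - 1) - 1)" unfolding powr_add[symmetric] by (simp add: r_def)
      finally show ?thesis .
    qed
    have s: "summable (\<lambda>m. C * real (X + Suc m) powr (- (r - 1) - 1))"
      by (intro summable_mult powr_tail_sum X) (use r in simp)
    have "cmod (\<Sum>m. of_nat (X + Suc m) powr (- Complex \<sigma>1 t) * zeta_eta s2 (X + Suc m)) \<le> (\<Sum>m. C * real (X + Suc m) powr (- (r - 1) - 1))"
      by (rule norm_suminf_le[OF le s])
    also have "\<dots> = C * (\<Sum>m. real (X + Suc m) powr (- (r - 1) - 1))"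
      by (intro suminf_mult powr_tail_sum X) (use r in simp)
    also have "\<dots> \<le> C * (real X powr (- (r - 1)) / (r - 1))"
      using r C by (intro mult_left_mono powr_tail_sum X) auto
    finally show "cmod (F t - S X t - zeta_tail (Complex \<sigma>1 t + s2 - 1) X / (s2 - 1)) \<le> C / (r - 1) * real X powr (1 - r)"
      using F_minus_S_sums[OF r t, of X] by (simp add: sums_iff)
  qed
qed

lemma F_approx:
  assumes r: "r > 1"
  obtains C T0 where "C \<ge> 0" "T0 \<ge> 2" "\<And>t X. t \<ge> T0 \<Longrightarrow> 2 * t \<le> real X \<Longrightarrow>
     cmod (F t - S X t) \<le> C * (real X powr (2 - r) / t + real X powr (1 - r))"
proof -
  obtain C1 where C1: "C1 \<ge> 0" "\<And>t X. X \<ge> 1 \<Longrightarrow> (Complex \<sigma>1 t, s2) \<notin> double_zeta_singularities \<Longrightarrow>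
     cmod (F t - S X t - zeta_tail (Complex \<sigma>1 t + s2 - 1) X / (s2 - 1)) \<le> C1 * real X powr (1 - r)"
    by (rule F_minus_S_bound[OF r], rule that)
  obtain C2 where C2: "C2 \<ge> 0" "\<And>w X. Re w = r - 1 \<Longrightarrow> cmod (w - 1) \<ge> 1 \<Longrightarrow> cmod w \<le> real X \<Longrightarrow>
      cmod (zeta_tail w X - of_nat X powr (1 - w) / (w - 1)) \<le> C2 * real X powr (- (r - 1))"
    by (rule Hardy_Littlewood_approximation[of "r - 1"], use r in simp, rule that)
  define c where "c = 1 / cmod (s2 - 1)"
  have c: "c > 0" using ne1 by (simp add: c_def)
  define C where "C = C1 + (C2 + 2) * c"
  \<comment> \<open>For \<open>t >= T0\<close> the imaginary part gives
    \<open>|w - 1| >= t / 2\<close>, and \<open>|w| <= 2 t <= X\<close>: the two conditions of the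
    Hardy--Littlewood approximation.\<close>
  define T0 where "T0 = 2 + 2 * \<bar>Im s2\<bar> + r"
  show ?thesis
  proof (rule that[of C T0])
    show "C \<ge> 0" using C1 C2 c by (simp add: C_def)
    show "T0 \<ge> 2" using r by (simp add: T0_def)
    fix t X assume t: "t \<ge> T0" and X: "2 * t \<le> real X"
    have t2: "t \<ge> 2" using t r by (simp add: T0_def)
    have X1: "X \<ge> 1" using X t2 by simp
    let ?w = "Complex \<sigma>1 t + s2 - 1"
    have w1: "cmod (?w - 1) \<ge> t / 2"
      using abs_Im_le_cmod[of "?w - 1"] t r by (simp add: T0_def abs_if split: if_splits)
    have "cmod ?w \<le> \<bar>Re ?w\<bar> + \<bar>Im ?w\<bar>" by (rule cmod_le)
    also have "\<dots> \<le> 2 * t" using t r by (simp add: T0_def r_def abs_if split: if_splits)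
    finally have w: "cmod ?w \<le> real X" using X by linarith
    have Xw: "cmod (of_nat X powr (1 - ?w) / (?w - 1)) \<le> real X powr (2 - r) / (t / 2)"
    proof -
      have "cmod (of_nat X powr (1 - ?w)) = real X powr (2 - r)" using X1 by (simp add: norm_of_nat_powr r_def algebra_simps)
      moreover have "0 < cmod (?w - 1)" using w1 t2 by linarith
      ultimately show ?thesis unfolding norm_divide using w1 t2 by (simp only:) (intro divide_left_mono mult_pos_pos, auto)
    qed
    have HL: "cmod (zeta_tail ?w X - of_nat X powr (1 - ?w) / (?w - 1)) \<le> C2 * real X powr (1 - r)"
      using C2(2)[of ?w X] w w1 t2 by (simp add: r_def)
    have zt: "cmod (zeta_tail ?w X) \<le> C2 * real X powr (1 - r) + real X powr (2 - r) / (t / 2)"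
      using norm_triangle_ineq[of "zeta_tail ?w X - of_nat X powr (1 - ?w) / (?w - 1)" "of_nat X powr (1 - ?w) / (?w - 1)"] HL Xw by simp
    have "cmod (zeta_tail ?w X / (s2 - 1)) = c * cmod (zeta_tail ?w X)" by (simp add: norm_divide c_def)
    also have "\<dots> \<le> c * (C2 * real X powr (1 - r) + real X powr (2 - r) / (t / 2))"
      using zt c by (intro mult_left_mono) auto
    finally have a: "cmod (zeta_tail ?w X / (s2 - 1)) \<le> c * (C2 * real X powr (1 - r) + real X powr (2 - r) / (t / 2))" .
    have b: "cmod (F t - S X t - zeta_tail ?w X / (s2 - 1)) \<le> C1 * real X powr (1 - r)"
      by (intro C1 X1 avoid t2)
    have "cmod (F t - S X t) \<le> C1 * real X powr (1 - r) + c * (C2 * real X powr (1 - r) + real X powr (2 - r) / (t / 2))"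
      using norm_triangle_ineq[of "F t - S X t - zeta_tail ?w X / (s2 - 1)" "zeta_tail ?w X / (s2 - 1)"] a b by simp
    also have "\<dots> = (C1 + C2 * c) * real X powr (1 - r) + (2 * c) * (real X powr (2 - r) / t)"
      by (simp add: algebra_simps)
    also have "\<dots> \<le> C * real X powr (1 - r) + C * (real X powr (2 - r) / t)"
      using C1 C2 c t2 by (intro add_mono mult_right_mono) (auto simp: C_def distrib_right)
    finally show "cmod (F t - S X t) \<le> C * (real X powr (2 - r) / t + real X powr (1 - r))"
      by (simp add: distrib_left add.commute)
  qed
qed

lemma continuous_F: "a \<ge> 2 \<Longrightarrow> continuous_on {a..b} F"
proof -
  assume a: "a \<ge> 2"
  have h: "(\<lambda>z. double_zeta (z, s2)) holomorphic_on {z. (z, s2) \<in> - double_zeta_singularities}"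
    using double_zeta_spec(1) unfolding holomorphic2_on_def by blast
  have i: "Complex \<sigma>1 ` {a..b} \<subseteq> {z. (z, s2) \<in> - double_zeta_singularities}" using a avoid by auto
  have c: "continuous_on {a..b} (Complex \<sigma>1)" unfolding Complex_eq by (intro continuous_intros)
  show ?thesis by (rule continuous_on_compose2[OF holomorphic_on_imp_continuous_on[OF h] c i])
qed

lemma continuous_S: "continuous_on A (S X)"
  unfolding S_def by (intro continuous_intros) auto

lemma S_norm_le: "cmod (S X t) \<le> P X"
  unfolding S_def P_def
proof (rule sum_norm_le)
  fix m assume "m \<in> {1..X}"
  then show "cmod (coeff m * of_nat m powr (- (\<i> * of_real t))) \<le> cmod (coeff m)"
    by (simp add: norm_mult norm_of_nat_powr)
qed

lemma square_diff_le:
  assumes "cmod (F t - S X t) \<le> e"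
  shows "\<bar>(cmod (F t))\<^sup>2 - (cmod (S X t))\<^sup>2\<bar> \<le> e * (2 * cmod (S X t) + e)"
proof -
  have "(cmod (F t))\<^sup>2 - (cmod (S X t))\<^sup>2 = (cmod (F t) - cmod (S X t)) * (cmod (F t) + cmod (S X t))"
    by (simp add: power2_eq_square algebra_simps)
  then have "\<bar>(cmod (F t))\<^sup>2 - (cmod (S X t))\<^sup>2\<bar> = \<bar>cmod (F t) - cmod (S X t)\<bar> * (cmod (F t) + cmod (S X t))"
    by (simp add: abs_mult)
  also have "\<dots> \<le> e * (2 * cmod (S X t) + e)"
    using norm_triangle_ineq3[of "F t" "S X t"] norm_triangle_sub[of "F t" "S X t"] assms
    by (intro mult_mono) auto
  finally show ?thesis .
qed

text \<open>The exponents \<open>2 r - 3\<close> and \<open>r - 1\<close> both lie in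
  \<open>[0, 1)\<close>, so \<open>sum_powr_le\<close> applies to both sums, and \<open>W\<close>
  and the square of \<open>P\<close> come out with the same power of \<open>X\<close>.\<close>

lemma W_P_bound_less:
  assumes r: "3 / 2 \<le> r" "r < 2"
  obtains C where "C \<ge> 0" "\<And>X. X \<ge> 1 \<Longrightarrow> 2 * (pi * W X + (P X)\<^sup>2) \<le> C * real X powr (4 - 2 * r)"
proof -
  obtain A where A: "A \<ge> 0" "\<And>m. m \<ge> 1 \<Longrightarrow> cmod (coeff m) \<le> A * real m powr (1 - r)"
    by (rule coeff_bound, rule that)
  define C where "C = 2 * (pi * (A\<^sup>2 / (4 - 2 * r)) + (A / (2 - r))\<^sup>2)"
  show ?thesis
  proof (rule that[of C])
    show "C \<ge> 0" using r by (simp add: C_def)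
    fix X :: nat assume X: "X \<ge> 1"
    have "W X \<le> (\<Sum>m=1..X. A\<^sup>2 * real m powr (- (2 * r - 3)))"
      unfolding W_def
    proof (rule sum_mono)
      fix m assume m: "m \<in> {1..X}"
      have "(cmod (coeff m))\<^sup>2 \<le> (A * real m powr (1 - r))\<^sup>2" using m A by (intro power_mono) auto
      then have "real m * (cmod (coeff m))\<^sup>2 \<le> real m powr 1 * (A\<^sup>2 * (real m powr (1 - r) * real m powr (1 - r)))"
      proof -
        have "(A * real m powr (1 - r))\<^sup>2 = A\<^sup>2 * (real m powr (1 - r) * real m powr (1 - r))"
          by (simp add: power2_eq_square mult_ac)
        then show ?thesis using m \<open>_ \<le> (A * real m powr (1 - r))\<^sup>2\<close> by (simp only: powr_one) (simp add: mult_left_mono)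
      qed
      also have "\<dots> = A\<^sup>2 * (real m powr 1 * (real m powr (1 - r) * real m powr (1 - r)))" by simp
      also have "\<dots> = A\<^sup>2 * real m powr (- (2 * r - 3))" unfolding powr_add[symmetric] by (simp add: algebra_simps)
      finally show "real m * (cmod (coeff m))\<^sup>2 \<le> A\<^sup>2 * real m powr (- (2 * r - 3))" .
    qed
    also have "\<dots> = A\<^sup>2 * (\<Sum>m=1..X. real m powr (- (2 * r - 3)))" by (simp add: sum_distrib_left)
    also have "\<dots> \<le> A\<^sup>2 * (real X powr (1 - (2 * r - 3)) / (1 - (2 * r - 3)))"
      using r X by (intro mult_left_mono sum_powr_le) auto
    finally have W: "W X \<le> A\<^sup>2 / (4 - 2 * r) * real X powr (4 - 2 * r)" by simp
    have "P X \<le> (\<Sum>m=1..X. A * real m powr (- (r - 1)))"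
      unfolding P_def using A by (intro sum_mono) auto
    also have "\<dots> = A * (\<Sum>m=1..X. real m powr (- (r - 1)))" by (simp add: sum_distrib_left)
    also have "\<dots> \<le> A * (real X powr (1 - (r - 1)) / (1 - (r - 1)))"
      using r X A by (intro mult_left_mono sum_powr_le) auto
    finally have "P X \<le> A / (2 - r) * real X powr (2 - r)" by simp
    then have "(P X)\<^sup>2 \<le> (A / (2 - r) * real X powr (2 - r))\<^sup>2"
      by (intro power_mono) (auto simp: P_def sum_nonneg)
    also have "\<dots> = (A / (2 - r))\<^sup>2 * (real X powr (2 - r) * real X powr (2 - r))" by (simp add: power_mult_distrib power2_eq_square)
    also have "\<dots> = (A / (2 - r))\<^sup>2 * real X powr (4 - 2 * r)" unfolding powr_add[symmetric] by simp
    finally have P: "(P X)\<^sup>2 \<le> (A / (2 - r))\<^sup>2 * real X powr (4 - 2 * r)" .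
    have "2 * (pi * W X + (P X)\<^sup>2) \<le> 2 * (pi * (A\<^sup>2 / (4 - 2 * r) * real X powr (4 - 2 * r)) + (A / (2 - r))\<^sup>2 * real X powr (4 - 2 * r))"
      using W P by (intro mult_left_mono add_mono) auto
    also have "\<dots> = C * real X powr (4 - 2 * r)" by (simp add: C_def algebra_simps)
    finally show "2 * (pi * W X + (P X)\<^sup>2) \<le> C * real X powr (4 - 2 * r)" .
  qed
qed

text \<open>The exponent \<open>2 - 2 r\<close> is written in the shape that
  \<open>powr_tail_sum\<close> takes with \<open>k = 2 r - 3\<close>.\<close>

lemma coeff_square_bound:
  obtains A where "A \<ge> 0" "\<And>m. m \<ge> 1 \<Longrightarrow> (cmod (coeff m))\<^sup>2 \<le> A * real m powr (- (2 * r - 3) - 1)"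
proof -
  obtain A where A: "A \<ge> 0" "\<And>m. m \<ge> 1 \<Longrightarrow> cmod (coeff m) \<le> A * real m powr (1 - r)"
    by (rule coeff_bound, rule that)
  show ?thesis
  proof (rule that[of "A\<^sup>2"])
    fix m :: nat assume "m \<ge> 1"
    then have "(cmod (coeff m))\<^sup>2 \<le> (A * real m powr (1 - r))\<^sup>2" using A by (intro power_mono) auto
    also have "\<dots> = A\<^sup>2 * (real m powr (1 - r) * real m powr (1 - r))" by (simp add: power_mult_distrib power2_eq_square)
    also have "\<dots> = A\<^sup>2 * real m powr (- (2 * r - 3) - 1)" unfolding powr_add[symmetric] by (simp add: algebra_simps)
    finally show "(cmod (coeff m))\<^sup>2 \<le> A\<^sup>2 * real m powr (- (2 * r - 3) - 1)" .
  qed simp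
qed

lemma summable_zeta_sq_term:
  assumes r: "r > 3 / 2"
  shows "summable (\<lambda>m. zeta_sq_term (2 * \<sigma>1) s2 (Suc m))"
proof -
  obtain A where A: "A \<ge> 0" "\<And>m. m \<ge> 1 \<Longrightarrow> (cmod (coeff m))\<^sup>2 \<le> A * real m powr (- (2 * r - 3) - 1)"
    by (rule coeff_square_bound, rule that)
  have "summable (\<lambda>m. A * real (Suc m) powr (- (2 * r - 2)))"
    using r by (intro summable_mult summable_Suc_powr) simp
  then show ?thesis
  proof (rule summable_comparison_test')
    fix m
    show "norm (zeta_sq_term (2 * \<sigma>1) s2 (Suc m)) \<le> A * real (Suc m) powr (- (2 * r - 2))"
    proof -
      have "- (2 * r - 3) - 1 = - (2 * r - 2)" by simp
      then show ?thesis using A(2)[of "Suc m"] zeta_sq_term_eq[of "Suc m"] by simp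
    qed
  qed
qed

lemma D_tail:
  assumes r: "r > 3 / 2"
  obtains C where "C \<ge> 0"
    "\<And>X. X \<ge> 1 \<Longrightarrow> \<bar>zeta_sq_series (2 * \<sigma>1) s2 - D X\<bar> \<le> C * real X powr (3 - 2 * r)"
proof -
  obtain A where A: "A \<ge> 0" "\<And>m. m \<ge> 1 \<Longrightarrow> (cmod (coeff m))\<^sup>2 \<le> A * real m powr (- (2 * r - 3) - 1)"
    by (rule coeff_square_bound, rule that)
  define c where "c m = (cmod (coeff m))\<^sup>2" for m
  have s: "summable (\<lambda>m. c (Suc m))"
    using summable_zeta_sq_term[OF r] by (simp add: zeta_sq_term_eq c_def)
  show ?thesis
  proof (rule that[of "A / (2 * r - 3)"])
    show "A / (2 * r - 3) \<ge> 0" using A r by simp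
    fix X :: nat assume X: "X \<ge> 1"
    have "zeta_sq_series (2 * \<sigma>1) s2 = (\<Sum>m. c (Suc m))" by (simp add: zeta_sq_series_def zeta_sq_term_eq c_def)
    also have "\<dots> = (\<Sum>m. c (Suc (m + X))) + (\<Sum>m<X. c (Suc m))"
      by (rule suminf_split_initial_segment[OF s])
    also have "(\<Sum>m<X. c (Suc m)) = D X" by (simp add: D_def c_def sum.atLeast1_atMost_eq)
    finally have e: "zeta_sq_series (2 * \<sigma>1) s2 - D X = (\<Sum>m. c (X + Suc m))" by (simp add: add.commute)
    have s': "summable (\<lambda>m. c (X + Suc m))" using summable_ignore_initial_segment[OF s, of X] by (simp add: add.commute)
    have s2: "summable (\<lambda>m. A * real (X + Suc m) powr (- (2 * r - 3) - 1))"
      by (intro summable_mult powr_tail_sum X) (use r in simp)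
    have "(\<Sum>m. c (X + Suc m)) \<le> (\<Sum>m. A * real (X + Suc m) powr (- (2 * r - 3) - 1))"
      unfolding c_def by (intro suminf_le A s'[unfolded c_def] s2) auto
    also have "\<dots> = A * (\<Sum>m. real (X + Suc m) powr (- (2 * r - 3) - 1))"
      by (intro suminf_mult powr_tail_sum X) (use r in simp)
    also have "\<dots> \<le> A * (real X powr (- (2 * r - 3)) / (2 * r - 3))"
      using r A by (intro mult_left_mono powr_tail_sum X) auto
    finally have "(\<Sum>m. c (X + Suc m)) \<le> A / (2 * r - 3) * real X powr (3 - 2 * r)" by simp
    moreover have "0 \<le> (\<Sum>m. c (X + Suc m))" by (intro suminf_nonneg s') (simp add: c_def)
    ultimately show "\<bar>zeta_sq_series (2 * \<sigma>1) s2 - D X\<bar> \<le> A / (2 * r - 3) * real X powr (3 - 2 * r)"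
      unfolding e by simp
  qed
qed

lemma integral_F_mono:
  assumes "2 \<le> T" "T \<le> T'"
  shows "0 \<le> integral {2..T} (\<lambda>t. (cmod (F t))\<^sup>2)"
    "integral {2..T} (\<lambda>t. (cmod (F t))\<^sup>2) \<le> integral {2..T'} (\<lambda>t. (cmod (F t))\<^sup>2)"
proof -
  have i: "(\<lambda>t. (cmod (F t))\<^sup>2) integrable_on {2..b}" for b
    by (intro integrable_continuous_real continuous_intros continuous_F) simp
  show "0 \<le> integral {2..T} (\<lambda>t. (cmod (F t))\<^sup>2)" by (intro integral_nonneg i) simp
  show "integral {2..T} (\<lambda>t. (cmod (F t))\<^sup>2) \<le> integral {2..T'} (\<lambda>t. (cmod (F t))\<^sup>2)"
    using assms by (intro integral_subset_le i) auto
qed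

lemma integral_F_split:
  assumes "2 \<le> a" "a \<le> b"
  shows "integral {2..b} (\<lambda>t. (cmod (F t))\<^sup>2) = integral {2..a} (\<lambda>t. (cmod (F t))\<^sup>2) + integral {a..b} (\<lambda>t. (cmod (F t))\<^sup>2)"
  using assms
  by (intro Henstock_Kurzweil_Integration.integral_combine[symmetric] integrable_continuous_real continuous_intros continuous_F) auto

end

section \<open>The mean square\<close>

context dz_line
begin

abbreviation I :: "real \<Rightarrow> real" where "I T \<equiv> integral {2..T} (\<lambda>t. (cmod (F t))\<^sup>2)"

abbreviation Z :: real where "Z \<equiv> zeta_sq_series (2 * \<sigma>1) s2"

lemma continuous_F_square: "a \<ge> 2 \<Longrightarrow> continuous_on {a..b} (\<lambda>t. (cmod (F t))\<^sup>2)"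
  by (intro continuous_intros continuous_F)

lemma continuous_S_square: "continuous_on A (\<lambda>t. (cmod (S X t))\<^sup>2)"
  by (intro continuous_intros continuous_S)

lemma W_P_nonneg: "W X \<ge> 0" "P X \<ge> 0" "D X \<ge> 0"
  by (simp_all add: W_def P_def D_def sum_nonneg)

section \<open>The range \<open>r > 2\<close>\<close>

lemma S_tendsto_F:
  assumes r: "r > 2" and t: "t \<ge> 2"
  shows "(\<lambda>X. S X t) \<longlonglongrightarrow> F t"
proof -
  let ?w = "Complex \<sigma>1 t + s2 - 1"
  obtain C where C: "C \<ge> 0" "\<And>t X. X \<ge> 1 \<Longrightarrow> (Complex \<sigma>1 t, s2) \<notin> double_zeta_singularities \<Longrightarrow>
     cmod (F t - S X t - zeta_tail (Complex \<sigma>1 t + s2 - 1) X / (s2 - 1)) \<le> C * real X powr (1 - r)"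
    by (rule F_minus_S_bound, use r in simp, rule that)
  have 1: "(\<lambda>X. F t - S X t - zeta_tail ?w X / (s2 - 1)) \<longlonglongrightarrow> 0"
  proof (rule Lim_null_comparison)
    show "\<forall>\<^sub>F X in sequentially. cmod (F t - S X t - zeta_tail ?w X / (s2 - 1)) \<le> C * real X powr (1 - r)"
      using eventually_ge_at_top[of 1] by eventually_elim (intro C avoid t)
    show "(\<lambda>X. C * real X powr (1 - r)) \<longlonglongrightarrow> 0"
      by (intro tendsto_mult_right_zero tendsto_neg_powr filterlim_real_sequentially) (use r in simp)
  qed
  have "Re ?w > 1" using r by (simp add: r_def)
  from zeta_sums[OF this] have "(\<lambda>X. \<Sum>n=1..X. of_nat n powr (- ?w)) \<longlonglongrightarrow> zeta ?w"
    by (simp add: sums_def sum.atLeast1_atMost_eq)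
  then have "(\<lambda>X. zeta ?w - (\<Sum>n=1..X. of_nat n powr (- ?w))) \<longlonglongrightarrow> zeta ?w - zeta ?w"
    by (intro tendsto_intros)
  then have "(\<lambda>X. zeta_tail ?w X) \<longlonglongrightarrow> 0" by (simp add: zeta_tail_def)
  then have 2: "(\<lambda>X. zeta_tail ?w X / (s2 - 1)) \<longlonglongrightarrow> 0" by (rule tendsto_divide_zero)
  have "(\<lambda>X. F t - ((F t - S X t - zeta_tail ?w X / (s2 - 1)) + zeta_tail ?w X / (s2 - 1))) \<longlonglongrightarrow> F t - (0 + 0)"
    by (intro tendsto_diff tendsto_add tendsto_const 1 2)
  then show ?thesis by simp
qed

text \<open>The exponents \<open>2 r - 3\<close> and \<open>r - 1\<close> now both exceed
  \<open>1\<close>.\<close>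

lemma W_P_bounded:
  assumes r: "r > 2"
  obtains B where "\<And>X. W X \<le> B" "\<And>X. P X \<le> B"
proof -
  obtain A where A: "A \<ge> 0" "\<And>m. m \<ge> 1 \<Longrightarrow> cmod (coeff m) \<le> A * real m powr (1 - r)"
    by (rule coeff_bound, rule that)
  obtain A' where A': "A' \<ge> 0" "\<And>m. m \<ge> 1 \<Longrightarrow> (cmod (coeff m))\<^sup>2 \<le> A' * real m powr (- (2 * r - 3) - 1)"
    by (rule coeff_square_bound, rule that)
  have bnd: "(\<Sum>m=1..X. f m) \<le> A * (\<Sum>m. real (Suc m) powr (- b))"
    if "b > 1" "\<And>m. m \<ge> 1 \<Longrightarrow> f m \<le> A * real m powr (- b)" "A \<ge> 0" for f :: "nat \<Rightarrow> real" and A b X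
  proof -
    have "(\<Sum>m=1..X. f m) \<le> (\<Sum>m=1..X. A * real m powr (- b))" using that by (intro sum_mono) auto
    also have "\<dots> = A * (\<Sum>m<X. real (Suc m) powr (- b))"
      by (simp add: sum_distrib_left sum.atLeast1_atMost_eq)
    also have "\<dots> \<le> A * (\<Sum>m. real (Suc m) powr (- b))"
      using that by (intro mult_left_mono sum_le_suminf summable_Suc_powr) auto
    finally show ?thesis .
  qed
  have W: "W X \<le> A' * (\<Sum>m. real (Suc m) powr (- (2 * r - 3)))" for X
    unfolding W_def
  proof (rule bnd)
    fix m :: nat assume m: "m \<ge> 1"
    have "real m * (cmod (coeff m))\<^sup>2 \<le> real m powr 1 * (A' * real m powr (- (2 * r - 3) - 1))"
      using A'(2)[OF m] m by (simp add: mult_left_mono)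
    also have "\<dots> = A' * (real m powr 1 * real m powr (- (2 * r - 3) - 1))" by simp
    also have "\<dots> = A' * real m powr (- (2 * r - 3))" unfolding powr_add[symmetric] by simp
    finally show "real m * (cmod (coeff m))\<^sup>2 \<le> A' * real m powr (- (2 * r - 3))" .
  qed (use r A' in auto)
  have P: "P X \<le> A * (\<Sum>m. real (Suc m) powr (- (r - 1)))" for X
    unfolding P_def by (rule bnd) (use r A in auto)
  show ?thesis
    by (rule that[of "max (A' * (\<Sum>m. real (Suc m) powr (- (2 * r - 3)))) (A * (\<Sum>m. real (Suc m) powr (- (r - 1))))"])
      (use W P in \<open>auto simp: le_max_iff_disj\<close>)
qed

text \<open>The mean value error is bounded independently of both \<open>X\<close> and
  \<open>T\<close>, so the truncation can be removed at fixed \<open>T\<close> by dominated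
  convergence.\<close>

lemma case_greater:
  assumes r: "r > 2"
  shows "\<exists>C. \<forall>T\<ge>2. \<bar>I T - Z * T\<bar> \<le> C"
proof -
  obtain B where B: "\<And>X. W X \<le> B" "\<And>X. P X \<le> B" by (rule W_P_bounded[OF r], rule that)
  have B0: "B \<ge> 0" using B(1)[of 0] by (simp add: W_def)
  define K where "K = 2 * (pi * B + B\<^sup>2)"
  have K: "\<bar>I T - (T - 2) * Z\<bar> \<le> K" if T: "T \<ge> 2" for T
  proof -
    have lim: "(\<lambda>X. integral {2..T} (\<lambda>t. (cmod (S X t))\<^sup>2)) \<longlonglongrightarrow> I T"
    proof (rule dominated_convergence(2))
      show "(\<lambda>t. (cmod (S X t))\<^sup>2) integrable_on {2..T}" for X
        by (intro integrable_continuous_real continuous_S_square)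
      show "(\<lambda>t. B\<^sup>2) integrable_on {2..T}" by (intro integrable_continuous_real continuous_intros)
      show "norm ((cmod (S X t))\<^sup>2) \<le> B\<^sup>2" for X t
        using order_trans[OF S_norm_le B(2)] by (simp add: power_mono)
      show "(\<lambda>X. (cmod (S X t))\<^sup>2) \<longlonglongrightarrow> (cmod (F t))\<^sup>2" if "t \<in> {2..T}" for t
        using that by (intro tendsto_intros S_tendsto_F r) auto
    qed
    have "(\<lambda>X. D X) \<longlonglongrightarrow> Z"
    proof -
      have "summable (\<lambda>m. zeta_sq_term (2 * \<sigma>1) s2 (Suc m))" using r by (intro summable_zeta_sq_term) simp
      from summable_LIMSEQ[OF this] show ?thesis
        by (simp add: zeta_sq_series_def D_def zeta_sq_term_eq sum.atLeast1_atMost_eq)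
    qed
    then have "(\<lambda>X. \<bar>integral {2..T} (\<lambda>t. (cmod (S X t))\<^sup>2) - (T - 2) * D X\<bar>) \<longlonglongrightarrow> \<bar>I T - (T - 2) * Z\<bar>"
      by (intro tendsto_intros lim)
    then show ?thesis
    proof (rule LIMSEQ_le_const2, intro exI[of _ 0] allI impI)
      fix X
      have "2 * (pi * W X + (P X)\<^sup>2) \<le> K"
        unfolding K_def using B W_P_nonneg(2)[of X] by (intro mult_left_mono add_mono power_mono) auto
      then show "\<bar>integral {2..T} (\<lambda>t. (cmod (S X t))\<^sup>2) - (T - 2) * D X\<bar> \<le> K"
        using mean_value_S[OF T, of X] by linarith
    qed
  qed
  have "\<bar>I T - Z * T\<bar> \<le> K + 2 * \<bar>Z\<bar>" if "T \<ge> 2" for T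
  proof -
    have "I T - Z * T = (I T - (T - 2) * Z) - 2 * Z" by (simp add: algebra_simps)
    then show ?thesis using K[OF that] by linarith
  qed
  then show ?thesis by blast
qed

section \<open>The range \<open>3/2 < r < 2\<close>, and dyadic blocks\<close>

lemma dyadic_block:
  assumes r: "3 / 2 \<le> r" "r < 2"
  obtains C T0 where "C \<ge> 0" "T0 \<ge> 2" "\<And>T. T \<ge> T0 \<Longrightarrow> \<exists>X::nat. 4 * T \<le> real X \<and> real X \<le> 5 * T \<and>
     \<bar>integral {T..2 * T} (\<lambda>t. (cmod (F t))\<^sup>2) - T * D X\<bar> \<le> C * T powr (4 - 2 * r) + C * T powr (2 - r) * (1 + D X)"
proof -
  obtain C1 T0 where C1: "C1 \<ge> 0" "T0 \<ge> 2" "\<And>t X. t \<ge> T0 \<Longrightarrow> 2 * t \<le> real X \<Longrightarrow>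
     cmod (F t - S X t) \<le> C1 * (real X powr (2 - r) / t + real X powr (1 - r))"
    by (rule F_approx, use r in simp, rule that)
  obtain C2 where C2: "C2 \<ge> 0" "\<And>X. X \<ge> 1 \<Longrightarrow> 2 * (pi * W X + (P X)\<^sup>2) \<le> C2 * real X powr (4 - 2 * r)"
    by (rule W_P_bound_less[OF r], rule that)
  define C where "C = 5 * C2 * (1 + 6 * C1) + 6 * C1 * (1 + 6 * C1)"
  show ?thesis
  proof (rule that[of C T0])
    show "C \<ge> 0" using C1 C2 by (simp add: C_def)
    fix T assume T: "T \<ge> T0"
    have T2: "T \<ge> 2" using T C1 by simp
    \<comment> \<open>\<open>t\<close> reaches \<open>2 * T\<close> and \<open>F_approx\<close>
      requires \<open>2 * t <= X\<close>, whence \<open>4 * T\<close>; rounding up stays below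
      \<open>5 * T\<close>.\<close>
    define X where "X = nat \<lceil>4 * T\<rceil>"
    have X: "4 * T \<le> real X" "real X \<le> 5 * T" using T2 unfolding X_def by linarith+
    have X1: "X \<ge> 1" using X T2 by simp
    \<comment> \<open>On the block \<open>X^(2-r) / t\<close> is at most \<open>5 T^(1-r)\<close>
      and \<open>X^(1-r)\<close> at most \<open>T^(1-r)\<close>.\<close>
    define e where "e = 6 * C1 * T powr (1 - r)"
    have e0: "e \<ge> 0" using C1 by (simp add: e_def)
    have e1: "e \<le> 6 * C1"
    proof -
      have "T powr (1 - r) \<le> T powr 0" using r T2 by (intro powr_mono) auto
      then show ?thesis using C1 T2 mult_left_mono[of "T powr (1 - r)" 1 "6 * C1"] by (simp add: e_def)
    qed
    have pw: "real X powr b \<le> 5 * T powr b" if "0 \<le> b" "b \<le> 1" for b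
    proof -
      have "real X powr b \<le> (5 * T) powr b" using X that by (intro powr_mono2) auto
      also have "\<dots> = 5 powr b * T powr b" using T2 by (simp add: powr_mult)
      also have "\<dots> \<le> 5 * T powr b" using that powr_mono[of b 1 5] by (intro mult_right_mono) auto
      finally show ?thesis .
    qed
    have E: "cmod (F t - S X t) \<le> e" if t: "t \<in> {T..2 * T}" for t
    proof -
      have "real X powr (2 - r) / t \<le> (5 * T powr (2 - r)) / T"
        using pw[of "2 - r"] r t T2 by (intro frac_le) auto
      also have "\<dots> = 5 * T powr (1 - r)" using T2 powr_diff[of T "2 - r" 1] by simp
      finally have 1: "real X powr (2 - r) / t \<le> 5 * T powr (1 - r)" .
      have 2: "real X powr (1 - r) \<le> T powr (1 - r)" using X T2 r by (intro powr_mono2') auto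
      have "cmod (F t - S X t) \<le> C1 * (real X powr (2 - r) / t + real X powr (1 - r))"
        using t T X by (intro C1) auto
      also have "\<dots> \<le> C1 * (5 * T powr (1 - r) + T powr (1 - r))" using 1 2 C1 by (intro mult_left_mono add_mono) auto
      finally show ?thesis by (simp add: e_def)
    qed
    let ?IF = "integral {T..2 * T} (\<lambda>t. (cmod (F t))\<^sup>2)" and ?IS = "integral {T..2 * T} (\<lambda>t. (cmod (S X t))\<^sup>2)"
    have "\<bar>?IF - ?IS\<bar> \<le> integral {T..2 * T} (\<lambda>t. e * (cmod (S X t))\<^sup>2 + e * (1 + e))"
    proof (rule integral_diff_le)
      fix t assume t: "t \<in> {T..2 * T}"
      \<comment> \<open>Trading the cross term for \<open>|S|^2 + 1\<close> brings back the mean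
        square of \<open>S\<close>, which \<open>mean_value_S\<close> evaluates. \<open>D X\<close>
        stays explicit in the result because it is bounded for \<open>r > 3/2\<close> but
        logarithmic at \<open>r = 3/2\<close>.\<close>
      have "2 * cmod (S X t) \<le> (cmod (S X t))\<^sup>2 + 1"
        using zero_le_power2[of "cmod (S X t) - 1"] by (simp add: power2_eq_square algebra_simps)
      then have "e * (2 * cmod (S X t) + e) \<le> e * ((cmod (S X t))\<^sup>2 + 1 + e)" using e0 by (intro mult_left_mono) auto
      then show "\<bar>(cmod (F t))\<^sup>2 - (cmod (S X t))\<^sup>2\<bar> \<le> e * (cmod (S X t))\<^sup>2 + e * (1 + e)"
        using square_diff_le[OF E[OF t]] by (simp add: algebra_simps)
    qed (use T2 in \<open>intro continuous_intros continuous_F_square continuous_S_square continuous_S; simp\<close>)+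
    also have "\<dots> = e * ?IS + e * (1 + e) * T"
    proof -
      have i: "(\<lambda>t. (cmod (S X t))\<^sup>2) integrable_on {T..2 * T}" by (intro integrable_continuous_real continuous_S_square)
      have h: "((\<lambda>t. e * (cmod (S X t))\<^sup>2 + e * (1 + e)) has_integral (e * ?IS + (2 * T - T) * (e * (1 + e)))) {T..2 * T}"
        using has_integral_const_real[of "e * (1 + e)" T "2 * T"] T2
        by (intro has_integral_add has_integral_mult_right integrable_integral i) simp
      show ?thesis using integral_unique[OF h] by (simp add: mult.commute)
    qed
    finally have a: "\<bar>?IF - ?IS\<bar> \<le> e * ?IS + e * (1 + e) * T" .
    have b: "\<bar>?IS - T * D X\<bar> \<le> 5 * C2 * T powr (4 - 2 * r)"
    proof -
      have "C2 * real X powr (4 - 2 * r) \<le> C2 * (5 * T powr (4 - 2 * r))" using r C2 by (intro mult_left_mono pw) auto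
      then show ?thesis using mean_value_S[of T "2 * T" X] C2(2)[OF X1] T2 by simp
    qed
    have TT: "T powr (2 - r) = T powr (1 - r) * T" using T2 powr_add[of T "1 - r" 1] by simp
    have "e * ?IS \<le> e * (T * D X + 5 * C2 * T powr (4 - 2 * r))" using b e0 by (intro mult_left_mono) auto
    also have "\<dots> = 6 * C1 * T powr (2 - r) * D X + e * (5 * C2 * T powr (4 - 2 * r))"
      by (simp add: e_def TT algebra_simps)
    also have "e * (5 * C2 * T powr (4 - 2 * r)) \<le> 6 * C1 * (5 * C2 * T powr (4 - 2 * r))"
      using e1 C2 by (intro mult_right_mono) auto
    finally have c: "e * ?IS \<le> 6 * C1 * T powr (2 - r) * D X + 6 * C1 * (5 * C2 * T powr (4 - 2 * r))" by simp
    have "e * (1 + e) * T \<le> e * (1 + 6 * C1) * T" using e0 e1 T2 by (intro mult_right_mono mult_left_mono) auto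
    also have "\<dots> = 6 * C1 * (1 + 6 * C1) * T powr (2 - r)" by (simp add: e_def TT)
    finally have d: "e * (1 + e) * T \<le> 6 * C1 * (1 + 6 * C1) * T powr (2 - r)" .
    have "\<bar>?IF - T * D X\<bar> \<le> 5 * C2 * (1 + 6 * C1) * T powr (4 - 2 * r) + (6 * C1 * T powr (2 - r) * D X + 6 * C1 * (1 + 6 * C1) * T powr (2 - r))"
      using a b c d by (simp add: algebra_simps)
    also have "\<dots> \<le> C * T powr (4 - 2 * r) + C * T powr (2 - r) * (1 + D X)"
    proof (rule add_mono)
      show "5 * C2 * (1 + 6 * C1) * T powr (4 - 2 * r) \<le> C * T powr (4 - 2 * r)"
        using C1 by (intro mult_right_mono) (auto simp: C_def)
      have c1: "6 * C1 \<le> C" "6 * C1 * (1 + 6 * C1) \<le> C"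
      proof -
        have n: "0 \<le> 5 * C2 * (1 + 6 * C1)" "0 \<le> 6 * C1 * (6 * C1)" using C1 C2 by simp_all
        have "6 * C1 * (1 + 6 * C1) = 6 * C1 + 6 * C1 * (6 * C1)" by (simp only: distrib_left mult_1_right)
        then show "6 * C1 \<le> C" unfolding C_def using n by linarith
        show "6 * C1 * (1 + 6 * C1) \<le> C" unfolding C_def using n by linarith
      qed
      have "6 * C1 * (T powr (2 - r) * D X) \<le> C * (T powr (2 - r) * D X)"
        using c1 W_P_nonneg(3) by (intro mult_right_mono mult_nonneg_nonneg) auto
      moreover have "6 * C1 * (1 + 6 * C1) * T powr (2 - r) \<le> C * T powr (2 - r)"
        using c1 by (intro mult_right_mono) auto
      ultimately show "6 * C1 * T powr (2 - r) * D X + 6 * C1 * (1 + 6 * C1) * T powr (2 - r) \<le> C * T powr (2 - r) * (1 + D X)"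
        by (simp add: algebra_simps)
    qed
    finally show "\<exists>X::nat. 4 * T \<le> real X \<and> real X \<le> 5 * T \<and>
     \<bar>integral {T..2 * T} (\<lambda>t. (cmod (F t))\<^sup>2) - T * D X\<bar> \<le> C * T powr (4 - 2 * r) + C * T powr (2 - r) * (1 + D X)"
      using X by blast
  qed (use C1 in auto)
qed

lemma case_between:
  assumes r: "3 / 2 < r" "r < 2"
  shows "\<exists>C. \<forall>T\<ge>2. \<bar>I T - Z * T\<bar> \<le> C * T powr (4 - 2 * r)"
proof -
  obtain C T0 where C: "C \<ge> 0" "T0 \<ge> 2" "\<And>T. T \<ge> T0 \<Longrightarrow> \<exists>X::nat. 4 * T \<le> real X \<and> real X \<le> 5 * T \<and>
     \<bar>integral {T..2 * T} (\<lambda>t. (cmod (F t))\<^sup>2) - T * D X\<bar> \<le> C * T powr (4 - 2 * r) + C * T powr (2 - r) * (1 + D X)"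
    by (rule dyadic_block, use r in simp, use r in simp, rule that)
  obtain C3 where C3: "C3 \<ge> 0" "\<And>X. X \<ge> 1 \<Longrightarrow> \<bar>Z - D X\<bar> \<le> C3 * real X powr (3 - 2 * r)"
    by (rule D_tail[OF r(1)], rule that)
  define K where "K = C + C * (1 + \<bar>Z\<bar> + C3) + C3"
  show ?thesis
  proof (rule doubling_bound[where U = T0 and C = K and B = "I (2 * T0) + \<bar>Z\<bar> * (2 * T0)"])
    show "K \<ge> 0" using C C3 by (simp add: K_def)
    fix T assume T: "2 \<le> T" "T \<le> 2 * T0"
    have "\<bar>Z * T\<bar> \<le> \<bar>Z\<bar> * (2 * T0)" unfolding abs_mult using T by (intro mult_left_mono) auto
    then show "\<bar>I T - Z * T\<bar> \<le> I (2 * T0) + \<bar>Z\<bar> * (2 * T0)"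
      using integral_F_mono[OF T] by linarith
  next
    fix T assume T: "T0 \<le> T"
    have T2: "T \<ge> 2" using T C by simp
    obtain X :: nat where X: "4 * T \<le> real X"
     and J: "\<bar>integral {T..2 * T} (\<lambda>t. (cmod (F t))\<^sup>2) - T * D X\<bar> \<le> C * T powr (4 - 2 * r) + C * T powr (2 - r) * (1 + D X)"
      using C(3)[OF T] by blast
    have X1: "X \<ge> 1" using X T2 by simp
    have "real X powr (3 - 2 * r) \<le> T powr (3 - 2 * r)" using X T2 r by (intro powr_mono2') auto
    then have "C3 * real X powr (3 - 2 * r) \<le> C3 * T powr (3 - 2 * r)" using C3 by (intro mult_left_mono) auto
    then have Dx: "\<bar>Z - D X\<bar> \<le> C3 * T powr (3 - 2 * r)" using C3(2)[OF X1] by linarith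
    have "T powr (3 - 2 * r) \<le> T powr 0" using T2 r by (intro powr_mono) auto
    then have "C3 * T powr (3 - 2 * r) \<le> C3 * 1" using C3 T2 by (intro mult_left_mono) auto
    then have DX: "1 + D X \<le> 1 + \<bar>Z\<bar> + C3" using Dx by linarith
    have "T * \<bar>Z - D X\<bar> \<le> T powr 1 * (C3 * T powr (3 - 2 * r))" using Dx T2 by (simp add: mult_left_mono)
    also have "\<dots> = C3 * (T powr 1 * T powr (3 - 2 * r))" by simp
    also have "\<dots> = C3 * T powr (4 - 2 * r)" unfolding powr_add[symmetric] by (simp add: algebra_simps)
    finally have a: "T * \<bar>Z - D X\<bar> \<le> C3 * T powr (4 - 2 * r)" .
    \<comment> \<open>\<open>2 - r <= 4 - 2 * r\<close> because \<open>r < 2\<close>.\<close>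
    have "C * T powr (2 - r) * (1 + D X) \<le> C * T powr (4 - 2 * r) * (1 + \<bar>Z\<bar> + C3)"
      using DX C r T2 W_P_nonneg(3)[of X] by (intro mult_mono mult_left_mono powr_mono) auto
    then have b: "\<bar>integral {T..2 * T} (\<lambda>t. (cmod (F t))\<^sup>2) - T * D X\<bar> \<le> C * T powr (4 - 2 * r) + C * T powr (4 - 2 * r) * (1 + \<bar>Z\<bar> + C3)"
      using J by linarith
    have c: "\<bar>T * Z - T * D X\<bar> \<le> C3 * T powr (4 - 2 * r)" using a T2 by (simp add: abs_mult flip: right_diff_distrib)
    have "\<bar>integral {T..2 * T} (\<lambda>t. (cmod (F t))\<^sup>2) - T * Z\<bar> \<le> C * T powr (4 - 2 * r) + C * T powr (4 - 2 * r) * (1 + \<bar>Z\<bar> + C3) + C3 * T powr (4 - 2 * r)"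
      using b c by linarith
    also have "\<dots> = K * T powr (4 - 2 * r)" by (simp add: K_def algebra_simps)
    finally have "\<bar>integral {T..2 * T} (\<lambda>t. (cmod (F t))\<^sup>2) - T * Z\<bar> \<le> K * T powr (4 - 2 * r)" .
    moreover have "I (2 * T) - Z * (2 * T) - (I T - Z * T) = integral {T..2 * T} (\<lambda>t. (cmod (F t))\<^sup>2) - T * Z"
      using integral_F_split[of T "2 * T"] T2 by simp
    ultimately show "\<bar>I (2 * T) - Z * (2 * T) - (I T - Z * T)\<bar> \<le> K * T powr (4 - 2 * r)" by simp
  qed (use r C in auto)
qed

section \<open>The critical value \<open>r = 3/2\<close>\<close>

lemma D_asymptotic_critical:
  assumes r: "r = 3 / 2"
  obtains B where "B \<ge> 0" "\<And>X. X \<ge> 1 \<Longrightarrow> \<bar>D X - ln (real X) / (cmod (s2 - 1))\<^sup>2\<bar> \<le> B"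
proof -
  obtain A where A: "A \<ge> 0"
    "\<And>m. m \<ge> 1 \<Longrightarrow> \<bar>(cmod (coeff m))\<^sup>2 - real m powr (2 - 2 * r) / (cmod (s2 - 1))\<^sup>2\<bar> \<le> A * real m powr (1 - 2 * r)"
    by (rule coeff_bound, rule that)
  define c where "c = 1 / (cmod (s2 - 1))\<^sup>2"
  have c: "c \<ge> 0" by (simp add: c_def)
  show ?thesis
  proof (rule that[of "A * inv_sq_sum + c"])
    show "A * inv_sq_sum + c \<ge> 0" using A c inv_sq_sum_nonneg by simp
    fix X :: nat assume X: "X \<ge> 1"
    have "\<bar>D X - (\<Sum>m=1..X. c * (1 / real m))\<bar> = \<bar>\<Sum>m=1..X. (cmod (coeff m))\<^sup>2 - c * (1 / real m)\<bar>"
      by (simp add: D_def sum_subtractf)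
    also have "\<dots> \<le> (\<Sum>m=1..X. A * (1 / real m ^ 2))"
    proof (rule order_trans[OF sum_abs], rule sum_mono)
      fix m assume m: "m \<in> {1..X}"
      then have m1: "m \<ge> 1" by simp
      \<comment> \<open>The leading parts form a harmonic sum and yield \<open>ln X\<close>; the
        corrections have exponent \<open>- 2\<close> and contribute a bounded amount.\<close>
      have "2 - 2 * r = - 1" "1 - 2 * r = - 2" using r by simp_all
      then have p: "real m powr (2 - 2 * r) = 1 / real m" "real m powr (1 - 2 * r) = 1 / real m ^ 2"
        using m1 by (simp_all only: powr_minus_divide) (simp_all add: powr_numeral)
      have "c * (1 / real m) = 1 / real m / (cmod (s2 - 1))\<^sup>2" by (simp add: c_def)
      then show "\<bar>(cmod (coeff m))\<^sup>2 - c * (1 / real m)\<bar> \<le> A * (1 / real m ^ 2)"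
        using A(2)[OF m1] unfolding p by (simp only:)
    qed
    also have "\<dots> = A * (\<Sum>m<X. 1 / real (Suc m) ^ 2)"
      by (simp add: sum_distrib_left sum.atLeast1_atMost_eq)
    also have "\<dots> \<le> A * inv_sq_sum"
      unfolding inv_sq_sum_def using A by (intro mult_left_mono sum_le_suminf summable_inv_sq) auto
    finally have 1: "\<bar>D X - (\<Sum>m=1..X. c * (1 / real m))\<bar> \<le> A * inv_sq_sum" .
    have "\<bar>(\<Sum>m=1..X. 1 / real m) - ln (real X)\<bar> \<le> 1" using harmonic_bounds[OF X] by linarith
    then have "c * \<bar>(\<Sum>m=1..X. 1 / real m) - ln (real X)\<bar> \<le> c * 1" using c by (intro mult_left_mono)
    moreover have "(\<Sum>m=1..X. c * (1 / real m)) - c * ln (real X) = c * ((\<Sum>m=1..X. 1 / real m) - ln (real X))"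
      by (simp only: sum_distrib_left right_diff_distrib)
    ultimately have 2: "\<bar>(\<Sum>m=1..X. c * (1 / real m)) - c * ln (real X)\<bar> \<le> c"
      using c by (simp only: abs_mult abs_of_nonneg mult_1_right)
    have "ln (real X) / (cmod (s2 - 1))\<^sup>2 = c * ln (real X)" by (simp add: c_def)
    then show "\<bar>D X - ln (real X) / (cmod (s2 - 1))\<^sup>2\<bar> \<le> A * inv_sq_sum + c" using 1 2 by linarith
  qed
qed

lemma case_critical:
  assumes r: "r = 3 / 2"
  shows "\<exists>C. \<forall>T\<ge>2. \<bar>I T - T * ln T / (cmod (s2 - 1))\<^sup>2\<bar> \<le> C * T"
proof -
  obtain C T0 where C: "C \<ge> 0" "T0 \<ge> 2" "\<And>T. T \<ge> T0 \<Longrightarrow> \<exists>X::nat. 4 * T \<le> real X \<and> real X \<le> 5 * T \<and>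
     \<bar>integral {T..2 * T} (\<lambda>t. (cmod (F t))\<^sup>2) - T * D X\<bar> \<le> C * T powr (4 - 2 * r) + C * T powr (2 - r) * (1 + D X)"
    by (rule dyadic_block, use r in simp, use r in simp, rule that)
  obtain B where B: "B \<ge> 0" "\<And>X. X \<ge> 1 \<Longrightarrow> \<bar>D X - ln (real X) / (cmod (s2 - 1))\<^sup>2\<bar> \<le> B"
    by (rule D_asymptotic_critical[OF r], rule that)
  define c where "c = 1 / (cmod (s2 - 1))\<^sup>2"
  have c: "c \<ge> 0" by (simp add: c_def)
  define B' where "B' = B + 4 * c"
  define K where "K = C + C * (1 + B' + 2 * c) + B' + 2 * c * ln 2"
  have B': "B' \<ge> 0" using B c by (simp add: B'_def)
  have K0: "K \<ge> 0" using C c B' by (simp add: K_def)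
  have "\<exists>K. \<forall>T\<ge>2. \<bar>I T - c * (T * ln T)\<bar> \<le> K * T powr 1"
  proof (rule doubling_bound[where U = T0 and C = K and B = "I (2 * T0) + c * (2 * T0 * ln (2 * T0))"])
    fix T assume T: "2 \<le> T" "T \<le> 2 * T0"
    have "0 \<le> ln T" "ln T \<le> ln (2 * T0)" using T by auto
    then have "c * (T * ln T) \<le> c * (2 * T0 * ln (2 * T0))" "0 \<le> c * (T * ln T)"
      using T c by (auto intro!: mult_left_mono mult_mono)
    then show "\<bar>I T - c * (T * ln T)\<bar> \<le> I (2 * T0) + c * (2 * T0 * ln (2 * T0))"
      using integral_F_mono[OF T] by linarith
  next
    fix T assume T: "T0 \<le> T"
    have T2: "T \<ge> 2" using T C by simp
    obtain X :: nat where X: "4 * T \<le> real X" "real X \<le> 5 * T"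
     and J: "\<bar>integral {T..2 * T} (\<lambda>t. (cmod (F t))\<^sup>2) - T * D X\<bar> \<le> C * T powr (4 - 2 * r) + C * T powr (2 - r) * (1 + D X)"
      using C(3)[OF T] by blast
    have X1: "X \<ge> 1" using X T2 by simp
    have "ln T \<le> ln (real X)" using X T2 by simp
    moreover have "ln (real X) \<le> ln (5 * T)" using X T2 X1 by simp
    moreover have "ln (5 * T) = ln 5 + ln T" using T2 by (simp add: ln_mult)
    moreover have "ln (5::real) \<le> 4" using ln_le_minus_one[of "5::real"] by simp
    ultimately have "\<bar>ln (real X) - ln T\<bar> \<le> 4" by linarith
    then have "c * \<bar>ln (real X) - ln T\<bar> \<le> c * 4" using c by (intro mult_left_mono)
    then have "\<bar>c * ln (real X) - c * ln T\<bar> \<le> 4 * c" using c by (simp add: abs_mult flip: right_diff_distrib)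
    moreover have "\<bar>D X - c * ln (real X)\<bar> \<le> B" using B(2)[OF X1] by (simp add: c_def)
    ultimately have DX: "\<bar>D X - c * ln T\<bar> \<le> B'" unfolding B'_def by linarith
    \<comment> \<open>In \<open>dyadic_block\<close> the factor \<open>1 + D X\<close> is now
      logarithmic but comes with \<open>T powr (1 / 2)\<close> only, so any bound of the logarithm
      by the square root makes the product \<open>O(T)\<close>.\<close>
    have lnT: "ln T \<le> 2 * T powr (1 / 2)"
    proof -
      have "ln T = 2 * ln (T powr (1 / 2))" using T2 by (simp add: ln_powr)
      also have "\<dots> \<le> 2 * T powr (1 / 2)" using ln_le_minus_one[of "T powr (1 / 2)"] T2 by simp
      finally show ?thesis .
    qed
    have h1: "1 \<le> T powr (1 / 2)" using T2 by (simp add: ge_one_powr_ge_zero)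
    have "D X \<le> B' + c * ln T" using DX by linarith
    then have "1 + D X \<le> (1 + B') * 1 + c * ln T" by simp
    also have "\<dots> \<le> (1 + B') * T powr (1 / 2) + c * (2 * T powr (1 / 2))"
      using h1 lnT c B' by (intro add_mono mult_left_mono) auto
    finally have "1 + D X \<le> (1 + B' + 2 * c) * T powr (1 / 2)" by (simp add: algebra_simps)
    then have "C * T powr (1 / 2) * (1 + D X) \<le> C * T powr (1 / 2) * ((1 + B' + 2 * c) * T powr (1 / 2))"
      using C by (intro mult_left_mono) auto
    also have "\<dots> = C * (1 + B' + 2 * c) * (T powr (1 / 2) * T powr (1 / 2))" by (simp add: mult_ac)
    also have "T powr (1 / 2) * T powr (1 / 2) = T" unfolding powr_add[symmetric] using T2 by simp
    finally have a: "C * T powr (1 / 2) * (1 + D X) \<le> C * (1 + B' + 2 * c) * T" .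
    have "\<bar>integral {T..2 * T} (\<lambda>t. (cmod (F t))\<^sup>2) - T * D X\<bar> \<le> C * T + C * T powr (1 / 2) * (1 + D X)"
      using J T2 by (simp add: r)
    then have b: "\<bar>integral {T..2 * T} (\<lambda>t. (cmod (F t))\<^sup>2) - T * D X\<bar> \<le> C * T + C * (1 + B' + 2 * c) * T"
      using a by linarith
    have "T * \<bar>D X - c * ln T\<bar> \<le> T * B'" using DX T2 by (intro mult_left_mono) auto
    then have d: "\<bar>T * D X - T * (c * ln T)\<bar> \<le> B' * T" using T2 by (simp add: abs_mult mult.commute flip: right_diff_distrib)
    have ln2: "ln (2 * T) = ln 2 + ln T" using T2 by (simp add: ln_mult)
    \<comment> \<open>Doubling changes \<open>T ln T\<close> by \<open>T ln T + 2 T ln 2\<close>;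
      the diagonal of the block matches the first part, and the second is
      \<open>O(T)\<close>.\<close>
    have "I (2 * T) - c * (2 * T * ln (2 * T)) - (I T - c * (T * ln T))
       = (integral {T..2 * T} (\<lambda>t. (cmod (F t))\<^sup>2) - T * D X) + (T * D X - T * (c * ln T)) - 2 * c * ln 2 * T"
      using integral_F_split[of T "2 * T"] T2 unfolding ln2 by (simp add: algebra_simps)
    moreover have "0 \<le> 2 * c * ln 2 * T" using c T2 by simp
    ultimately have "\<bar>I (2 * T) - c * (2 * T * ln (2 * T)) - (I T - c * (T * ln T))\<bar>
      \<le> (C * T + C * (1 + B' + 2 * c) * T) + B' * T + 2 * c * ln 2 * T"
      using b d by linarith
    also have "\<dots> = K * T powr 1" using T2 by (simp add: K_def algebra_simps)
    finally show "\<bar>I (2 * T) - c * (2 * T * ln (2 * T)) - (I T - c * (T * ln T))\<bar> \<le> K * T powr 1" .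
  qed (use C K0 in auto)
  then obtain K where K: "\<And>T. T \<ge> 2 \<Longrightarrow> \<bar>I T - c * (T * ln T)\<bar> \<le> K * T powr 1" by blast
  have "\<bar>I T - T * ln T / (cmod (s2 - 1))\<^sup>2\<bar> \<le> K * T" if "T \<ge> 2" for T
    using K[OF that] that by (simp add: c_def)
  then show ?thesis by blast
qed

section \<open>The boundary value \<open>r = 2\<close>\<close>

lemma W_P_bound_boundary:
  assumes r: "r = 2"
  obtains A where "A \<ge> 0" "\<And>X. X \<ge> 1 \<Longrightarrow> P X \<le> A * (1 + ln (real X))" "\<And>X. X \<ge> 1 \<Longrightarrow> W X \<le> A\<^sup>2 * (1 + ln (real X))"
proof -
  obtain A where A: "A \<ge> 0" "\<And>m. m \<ge> 1 \<Longrightarrow> cmod (coeff m) \<le> A * real m powr (1 - r)"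
    by (rule coeff_bound, rule that)
  have A': "cmod (coeff m) \<le> A * (1 / real m)" if "m \<ge> 1" for m
    using A(2)[OF that] that by (simp add: r powr_minus divide_inverse)
  show ?thesis
  proof (rule that[OF A(1)])
    fix X :: nat assume X: "X \<ge> 1"
    have "P X \<le> (\<Sum>m=1..X. A * (1 / real m))" unfolding P_def using A' by (intro sum_mono) auto
    also have "\<dots> = A * (\<Sum>m=1..X. 1 / real m)" by (simp add: sum_distrib_left)
    also have "\<dots> \<le> A * (1 + ln (real X))" using A harmonic_bounds[OF X] by (intro mult_left_mono) auto
    finally show "P X \<le> A * (1 + ln (real X))" .
    have "W X \<le> (\<Sum>m=1..X. A\<^sup>2 * (1 / real m))"
      unfolding W_def
    proof (rule sum_mono)
      fix m assume m: "m \<in> {1..X}"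
      have "(cmod (coeff m))\<^sup>2 \<le> (A * (1 / real m))\<^sup>2" using A'[of m] m by (intro power_mono) auto
      then have "real m * (cmod (coeff m))\<^sup>2 \<le> real m * (A * (1 / real m))\<^sup>2" by (intro mult_left_mono) auto
      also have "\<dots> = A\<^sup>2 * (1 / real m)" using m by (simp add: power2_eq_square)
      finally show "real m * (cmod (coeff m))\<^sup>2 \<le> A\<^sup>2 * (1 / real m)" .
    qed
    also have "\<dots> = A\<^sup>2 * (\<Sum>m=1..X. 1 / real m)" by (simp add: sum_distrib_left)
    also have "\<dots> \<le> A\<^sup>2 * (1 + ln (real X))" using harmonic_bounds[OF X] by (intro mult_left_mono) auto
    finally show "W X \<le> A\<^sup>2 * (1 + ln (real X))" .
  qed
qed

text \<open>Here \<open>W\<close> and \<open>P\<close> are both \<open>O(log T)\<close>, so the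
  square of \<open>P\<close> dominates the mean value error. The truncation error is
  \<open>O(1 / t)\<close>; multiplied by the bound \<open>P\<close> for the partial sum and
  integrated, it gives a second term of order \<open>(log T)^2\<close>.\<close>

lemma case_boundary:
  assumes r: "r = 2"
  shows "\<exists>C. \<forall>T\<ge>2. \<bar>I T - Z * T\<bar> \<le> C * (ln T)\<^sup>2"
proof -
  obtain C T0 where C: "C \<ge> 0" "T0 \<ge> 2" "\<And>t X. t \<ge> T0 \<Longrightarrow> 2 * t \<le> real X \<Longrightarrow>
     cmod (F t - S X t) \<le> C * (real X powr (2 - r) / t + real X powr (1 - r))"
    by (rule F_approx, use r in simp, rule that)
  obtain A where A: "A \<ge> 0" "\<And>X. X \<ge> 1 \<Longrightarrow> P X \<le> A * (1 + ln (real X))" "\<And>X. X \<ge> 1 \<Longrightarrow> W X \<le> A\<^sup>2 * (1 + ln (real X))"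
    by (rule W_P_bound_boundary[OF r], rule that)
  obtain C3 where C3: "C3 \<ge> 0" "\<And>X. X \<ge> 1 \<Longrightarrow> \<bar>Z - D X\<bar> \<le> C3 * real X powr (3 - 2 * r)"
    by (rule D_tail, use r in simp, rule that)
  define M where "M = I T0 + \<bar>Z\<bar> * T0"
  have M: "M \<ge> 0" using integral_F_mono(1)[of T0 T0] C by (simp add: M_def)
  define K where "K = 4 * (M + C3) + 2 * (pi * (14 * A\<^sup>2) + 49 * A\<^sup>2) + 2 * C * (14 * A + 2 * C)"
  \<comment> \<open>A lower bound for \<open>ln T\<close> lets constants be absorbed into multiples
    of \<open>(ln T)^2\<close>, down to \<open>T = 2\<close>.\<close>
  have half: "1 / 2 \<le> ln T" if "T \<ge> 2" for T :: real
  proof -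
    have "1 - 1 / 2 \<le> ln (2::real)" using ln_le_minus_one[of "1 / 2 :: real"] by (simp add: ln_div)
    also have "ln 2 \<le> ln T" using that by simp
    finally show ?thesis by simp
  qed
  have "\<bar>I T - Z * T\<bar> \<le> K * (ln T)\<^sup>2" if T: "T \<ge> 2" for T
  proof -
    define L where "L = ln T"
    have L: "1 / 2 \<le> L" unfolding L_def by (rule half[OF T])
    have "(1 / 2)\<^sup>2 \<le> L\<^sup>2" using L by (intro power_mono) auto
    then have L2: "1 \<le> 4 * L\<^sup>2" by (simp add: power2_eq_square)
    have const: "x \<le> 4 * x * L\<^sup>2" if "x \<ge> 0" for x using mult_left_mono[OF L2 that] by (simp add: mult_ac)
    have K: "4 * (M + C3) \<le> K" using A C by (simp add: K_def)
    show ?thesis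
    proof (cases "T \<le> T0")
      case True
      have "\<bar>Z * T\<bar> \<le> \<bar>Z\<bar> * T0" unfolding abs_mult using T True by (intro mult_left_mono) auto
      then have "\<bar>I T - Z * T\<bar> \<le> M" unfolding M_def using integral_F_mono[OF T True] by linarith
      also have "M \<le> 4 * M * L\<^sup>2" by (rule const[OF M])
      also have "\<dots> \<le> K * L\<^sup>2" using K C3 by (intro mult_right_mono) auto
      finally show ?thesis by (simp add: L_def)
    next
      case False
      then have TT: "T0 \<le> T" by simp
      define X where "X = nat \<lceil>2 * T\<rceil>"
      have X: "2 * T \<le> real X" "real X \<le> 3 * T" using T unfolding X_def by linarith+
      have X1: "X \<ge> 1" using X T by simp
      have "ln (real X) \<le> ln (3 * T)" using X T X1 by simp
      moreover have "ln (3 * T) = ln 3 + L" using T by (simp add: ln_mult L_def)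
      moreover have "ln (3::real) \<le> 2" using ln_le_minus_one[of "3::real"] by simp
      \<comment> \<open>\<open>1 + ln 3 + L <= 3 + L\<close>, and \<open>3 <= 6 * L\<close> by
        \<open>L >= 1 / 2\<close>.\<close>
      ultimately have lnX: "1 + ln (real X) \<le> 7 * L" using L by linarith
      have "P X \<le> A * (7 * L)" using A(2)[OF X1] lnX mult_left_mono[OF lnX A(1)] by linarith
      then have P: "P X \<le> 7 * A * L" by simp
      have "A\<^sup>2 * (1 + ln (real X)) \<le> A\<^sup>2 * (7 * L)" using lnX by (intro mult_left_mono) auto
      also have "\<dots> \<le> A\<^sup>2 * (14 * L\<^sup>2)" using L by (intro mult_left_mono) (auto simp: power2_eq_square)
      finally have W: "W X \<le> 14 * A\<^sup>2 * L\<^sup>2" using A(3)[OF X1] by linarith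
      have P2: "(P X)\<^sup>2 \<le> 49 * A\<^sup>2 * L\<^sup>2" using power_mono[OF P W_P_nonneg(2), of 2] by (simp add: power_mult_distrib)
      let ?IF = "integral {T0..T} (\<lambda>t. (cmod (F t))\<^sup>2)" and ?IS = "integral {T0..T} (\<lambda>t. (cmod (S X t))\<^sup>2)"
      let ?c = "2 * C * (14 * A + 2 * C) * L"
      have "\<bar>?IF - ?IS\<bar> \<le> integral {T0..T} (\<lambda>t. ?c * (1 / t))"
      proof (rule integral_diff_le)
        fix t assume t: "t \<in> {T0..T}"
        then have t2: "t \<ge> 2" using C by simp
        have "cmod (F t - S X t) \<le> C * (real X powr (2 - r) / t + real X powr (1 - r))"
          using t X by (intro C) auto
        also have "\<dots> = C * (1 / t + 1 / real X)" using X1 by (simp add: r powr_minus divide_inverse)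
        also have "\<dots> \<le> C * (1 / t + 1 / t)" using t t2 X C by (intro mult_left_mono add_mono divide_left_mono) auto
        finally have E: "cmod (F t - S X t) \<le> 2 * C / t" by (simp add: mult.commute)
        have "2 * C / t \<le> 2 * C / 2" using t2 C by (intro divide_left_mono) auto
        also have "\<dots> \<le> 2 * C * L" using C mult_left_mono[OF L, of "2 * C"] by simp
        finally have e: "2 * C / t \<le> 2 * C * L" .
        have "cmod (S X t) \<le> 7 * A * L" using order_trans[OF S_norm_le P] .
        then have "2 * cmod (S X t) + 2 * C / t \<le> (14 * A + 2 * C) * L" using e by (simp add: algebra_simps)
        then have "2 * C / t * (2 * cmod (S X t) + 2 * C / t) \<le> 2 * C / t * ((14 * A + 2 * C) * L)"
          using C t2 by (intro mult_left_mono) auto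
        also have "\<dots> = ?c * (1 / t)" by simp
        finally show "\<bar>(cmod (F t))\<^sup>2 - (cmod (S X t))\<^sup>2\<bar> \<le> ?c * (1 / t)" using square_diff_le[OF E] by linarith
      qed (use C in \<open>auto intro!: continuous_intros continuous_F continuous_S\<close>)
      also have "\<dots> = ?c * (ln T - ln T0)"
      proof -
        have "((\<lambda>t. 1 / t) has_integral (ln T - ln T0)) {T0..T}"
        proof (rule fundamental_theorem_of_calculus[OF TT])
          fix t assume "t \<in> {T0..T}"
          then have "t > 0" using C by simp
          then show "(ln has_vector_derivative 1 / t) (at t within {T0..T})"
            unfolding has_real_derivative_iff_has_vector_derivative[symmetric]
            by (auto intro!: derivative_eq_intros)
        qed
        from integral_unique[OF has_integral_mult_right[OF this, of ?c]] show ?thesis .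
      qed
      also have "\<dots> \<le> ?c * L"
      proof (rule mult_left_mono)
        have "0 \<le> ln T0" using C by simp
        then show "ln T - ln T0 \<le> L" by (simp add: L_def)
        show "0 \<le> ?c" using C A L by simp
      qed
      finally have a: "\<bar>?IF - ?IS\<bar> \<le> 2 * C * (14 * A + 2 * C) * L\<^sup>2" by (simp add: power2_eq_square mult_ac)
      have "2 * (pi * W X + (P X)\<^sup>2) \<le> 2 * (pi * (14 * A\<^sup>2 * L\<^sup>2) + 49 * A\<^sup>2 * L\<^sup>2)"
        using W P2 by (intro mult_left_mono add_mono) auto
      then have b: "\<bar>?IS - (T - T0) * D X\<bar> \<le> 2 * (pi * (14 * A\<^sup>2) + 49 * A\<^sup>2) * L\<^sup>2"
        using mean_value_S[OF TT, of X] by (simp add: algebra_simps)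
      have "\<bar>Z - D X\<bar> \<le> C3 * (1 / real X)" using C3(2)[OF X1] X1 by (simp add: r powr_minus divide_inverse)
      then have "(T - T0) * \<bar>Z - D X\<bar> \<le> real X * (C3 * (1 / real X))"
        using X T TT C by (intro mult_mono) auto
      then have "(T - T0) * \<bar>Z - D X\<bar> \<le> C3" using X1 by simp
      then have c: "\<bar>(T - T0) * Z - (T - T0) * D X\<bar> \<le> C3" using TT by (simp add: abs_mult flip: right_diff_distrib)
      have "I T - Z * T = I T0 - Z * T0 + (?IF - ?IS) + (?IS - (T - T0) * D X) - ((T - T0) * Z - (T - T0) * D X)"
        using integral_F_split[of T0 T] TT C by (simp add: algebra_simps)
      moreover have "\<bar>I T0 - Z * T0\<bar> \<le> M"
        unfolding M_def using integral_F_mono(1)[of T0 T0] C abs_triangle_ineq4[of "I T0" "Z * T0"] by (simp add: abs_mult)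
      ultimately have "\<bar>I T - Z * T\<bar> \<le> (M + C3) + 2 * (pi * (14 * A\<^sup>2) + 49 * A\<^sup>2) * L\<^sup>2 + 2 * C * (14 * A + 2 * C) * L\<^sup>2"
        using a b c by linarith
      also have "\<dots> \<le> 4 * (M + C3) * L\<^sup>2 + 2 * (pi * (14 * A\<^sup>2) + 49 * A\<^sup>2) * L\<^sup>2 + 2 * C * (14 * A + 2 * C) * L\<^sup>2"
        using const[of "M + C3"] M C3 by simp
      also have "\<dots> = K * L\<^sup>2" by (simp add: K_def algebra_simps)
      finally show ?thesis by (simp add: L_def)
    qed
  qed
  then show ?thesis by blast
qed

end

text \<open>Summability is claimed alongside because \<open>suminf\<close> carries no information
  about a divergent series. Avoidance of the singularities is asked for all \<open>t1 >= 2\<close>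
  since each constant has to serve every \<open>T\<close>.\<close>

theorem theorem1p1:
  fixes \<sigma>1 \<sigma>2 t2 :: real and s2 :: complex
  assumes s2: "s2 = Complex \<sigma>2 t2"
    and ne1: "s2 \<noteq> 1"
    and avoid: "\<forall>t1\<ge>2. (Complex \<sigma>1 t1, s2) \<notin> double_zeta_singularities"
  shows "(\<sigma>1 + \<sigma>2 > 3/2 \<longrightarrow> summable (\<lambda>m. zeta_sq_term (2 * \<sigma>1) s2 (Suc m))) \<and>
    (\<sigma>1 + \<sigma>2 > 2 \<longrightarrow>
      (\<exists>C. \<forall>T\<ge>2. \<bar>mean_square \<sigma>1 s2 T - zeta_sq_series (2 * \<sigma>1) s2 * T\<bar> \<le> C)) \<and>
    (3/2 < \<sigma>1 + \<sigma>2 \<and> \<sigma>1 + \<sigma>2 < 2 \<longrightarrow>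
      (\<exists>C. \<forall>T\<ge>2. \<bar>mean_square \<sigma>1 s2 T - zeta_sq_series (2 * \<sigma>1) s2 * T\<bar>
                    \<le> C * T powr (4 - 2 * \<sigma>1 - 2 * \<sigma>2))) \<and>
    (\<sigma>1 + \<sigma>2 = 2 \<longrightarrow>
      (\<exists>C. \<forall>T\<ge>2. \<bar>mean_square \<sigma>1 s2 T - zeta_sq_series (2 * \<sigma>1) s2 * T\<bar> \<le> C * (ln T)\<^sup>2)) \<and>
    (\<sigma>1 + \<sigma>2 = 3/2 \<longrightarrow>
      (\<exists>C. \<forall>T\<ge>2. \<bar>mean_square \<sigma>1 s2 T - T * ln T / (cmod (s2 - 1))\<^sup>2\<bar> \<le> C * T))"
proof -
  interpret dz_line \<sigma>1 s2 by unfold_locales (use ne1 avoid in auto)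
  have r: "\<sigma>1 + \<sigma>2 = r" unfolding r_def using s2 by simp
  then have e: "4 - 2 * \<sigma>1 - 2 * \<sigma>2 = 4 - 2 * r" by linarith
  have "r > 3/2 \<longrightarrow> summable (\<lambda>m. zeta_sq_term (2 * \<sigma>1) s2 (Suc m))"
    by (intro impI summable_zeta_sq_term)
  moreover have "r > 2 \<longrightarrow> (\<exists>C. \<forall>T\<ge>2. \<bar>I T - Z * T\<bar> \<le> C)"
    by (intro impI case_greater)
  moreover have "3/2 < r \<and> r < 2 \<longrightarrow> (\<exists>C. \<forall>T\<ge>2. \<bar>I T - Z * T\<bar> \<le> C * T powr (4 - 2 * r))"
    by (intro impI case_between) (simp_all only:)
  moreover have "r = 2 \<longrightarrow> (\<exists>C. \<forall>T\<ge>2. \<bar>I T - Z * T\<bar> \<le> C * (ln T)\<^sup>2)"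
    by (intro impI case_boundary)
  moreover have "r = 3/2 \<longrightarrow> (\<exists>C. \<forall>T\<ge>2. \<bar>I T - T * ln T / (cmod (s2 - 1))\<^sup>2\<bar> \<le> C * T)"
    by (intro impI case_critical)
  ultimately show ?thesis
    unfolding e r mean_square_def by (intro conjI)
qed

end
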